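(* Let $E$ be an elliptic curve defined over a finite field $\mathbb{F}_q$, let $d$ be an integer coprime to $q$, and let $(\tau_n)_{n\ge 1}$ be the sequence of integers such that $\#E(\mathbb{F}_{q^n}) = q^n + 1 - \tau_n$. Then for each $n \geq 1$ there exists some non-negative integer $N$ depending on $q, \tau_1, d, n$ such that $$\lim_{\substack{m\to\infty\\ m \equiv n \bmod c d^N}} \delta(L_d,q^m) = \frac{1}{2}\Big(\frac{1}{\pi_{n,+}} + \frac{1}{\pi_{n,-}}\Big),$$ where $$\pi_{n,\pm} := \prod_{\ell \mid d} \ell^{v_\ell(q^n+1\pm\tau_n)},$$ the product is taken over all primes $\ell$ dividing $d$, $c := \mathrm{lcm}(\ell^2 - 1 : \ell \mid d \text{ is prime})$, and the limit is taken over all positive integers $m$ such that $m \equiv n \bmod c d^N$.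
   Context: $\mathbb{F}_q$ is a finite field with $q$ elements. An elliptic curve $E/\mathbb{F}_q$ is given by a Weierstrass equation $y^2 + A_1xy + A_3y = x^3 + A_2x^2 + A_4x + A_6$ with $A_i \in \mathbb{F}_q$ (any characteristic allowed), with base point $O$ the unique point at infinity, and $x : E \to \mathbb{P}^1$ denotes the $x$-coordinate projection, with $x(O)=\infty$. For $d\in\mathbb{Z}$, the $d$th Lattès map $L_d \in \mathbb{F}_q(x)$ associated to $E$ is the unique rational function such that $L_d(x(P)) = x(dP)$ for all $P \in E(\overline{\mathbb{F}}_q)$. For $m\ge1$, a point $a \in \mathbb{P}^1(\mathbb{F}_{q^m})$ is periodic under $L_d$ if $L_d^k(a) = a$ for some $k \ge 1$, where $L_d^k$ is the $k$-fold composition; $\mathrm{Per}(L_d,\mathbb{F}_{q^m})$ is the set of such points, and $\delta(L_d,q^m) := \#\mathrm{Per}(L_d,\mathbb{F}_{q^m})/\#\mathbb{P}^1(\mathbb{F}_{q^m})$. For a prime $\ell$ and a nonzero integer $k$, $v_\ell(k)$ is the multiplicity of $\ell$ as a factor of $k$. The lcm of the empty set is $1$. *)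

theory Defs
  imports
    Complex_Main
    "HOL-Library.Cardinality"
    "HOL-Computational_Algebra.Computational_Algebra"
    "HOL-Number_Theory.Cong"
    "HOL-Algebra.Algebraic_Closure_Type"
begin

section \<open>Finite fields and the projective line\<close>

text \<open>
  The base field is the type \<open>'a\<close>, with \<open>q = CARD('a)\<close>. For \<open>Q = q ^ n\<close> with
  \<open>n \<ge> 1\<close>, the set below is the unique subfield with \<open>Q\<close> elements of the algebraic
  closure.
\<close>
definition GF :: "nat \<Rightarrow> 'a :: finite_field alg_closure set" where
  "GF Q = {x. x ^ Q = x}"

datatype 'k P1 = Affine 'k | Infinity

definition P1_over :: "'k set \<Rightarrow> 'k P1 set" where
  "P1_over K = insert Infinity (Affine ` K)"


section \<open>Elliptic curves in Weierstrass form\<close>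

text \<open>The curve \<open>y^2 + A1 x y + A3 y = x^3 + A2 x^2 + A4 x + A6\<close>.\<close>
datatype 'k weierstrass =
  Weierstrass (A1: 'k) (A2: 'k) (A3: 'k) (A4: 'k) (A6: 'k)

datatype 'k ec_point = Origin | Point 'k 'k

fun on_curve :: "'k :: field weierstrass \<Rightarrow> 'k ec_point \<Rightarrow> bool" where
  "on_curve E Origin \<longleftrightarrow> True"
| "on_curve E (Point x y) \<longleftrightarrow>
     y ^ 2 + A1 E * x * y + A3 E * y = x ^ 3 + A2 E * x ^ 2 + A4 E * x + A6 E"

text \<open>
  The two partial derivatives of the equation of the curve. The point at infinity of a
  Weierstrass cubic is always smooth.
\<close>
definition singular_at :: "'k :: field weierstrass \<Rightarrow> 'k \<Rightarrow> 'k \<Rightarrow> bool" where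
  "singular_at E x y \<longleftrightarrow>
     A1 E * y - (3 * x ^ 2 + 2 * A2 E * x + A4 E) = 0 \<and>
     2 * y + A1 E * x + A3 E = 0"

abbreviation base_change :: "'a :: field weierstrass \<Rightarrow> 'a alg_closure weierstrass" where
  "base_change \<equiv> map_weierstrass to_ac"

definition elliptic_curve :: "'a :: field weierstrass \<Rightarrow> bool" where
  "elliptic_curve E \<longleftrightarrow>
     (\<forall>x y. on_curve (base_change E) (Point x y) \<longrightarrow> \<not> singular_at (base_change E) x y)"

definition rational_points ::
    "'a :: field weierstrass \<Rightarrow> 'a alg_closure set \<Rightarrow> 'a alg_closure ec_point set" where
  "rational_points E K =
     {P. on_curve (base_change E) P \<and> (\<forall>x y. P = Point x y \<longrightarrow> x \<in> K \<and> y \<in> K)}"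

text \<open>
  The chord-and-tangent group law. The second point of a chord is the negative of the
  first exactly if the abscissae agree and \<open>y1 + y2 + A1 x2 + A3 = 0\<close>.
\<close>
fun ec_neg :: "'k :: field weierstrass \<Rightarrow> 'k ec_point \<Rightarrow> 'k ec_point" where
  "ec_neg E Origin = Origin"
| "ec_neg E (Point x y) = Point x (- y - A1 E * x - A3 E)"

fun ec_add :: "'k :: field weierstrass \<Rightarrow> 'k ec_point \<Rightarrow> 'k ec_point \<Rightarrow> 'k ec_point" where
  "ec_add E Origin Q = Q"
| "ec_add E P Origin = P"
| "ec_add E (Point x1 y1) (Point x2 y2) =
     (if x1 = x2 \<and> y1 + y2 + A1 E * x2 + A3 E = 0 then Origin
      else
        let s = (if x1 = x2
                 then (3 * x1 ^ 2 + 2 * A2 E * x1 + A4 E - A1 E * y1) / (2 * y1 + A1 E * x1 + A3 E)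
                 else (y2 - y1) / (x2 - x1));
            x3 = s ^ 2 + A1 E * s - A2 E - x1 - x2
        in Point x3 (- (s * (x3 - x1) + y1) - A1 E * x3 - A3 E))"

definition ec_mult :: "'k :: field weierstrass \<Rightarrow> int \<Rightarrow> 'k ec_point \<Rightarrow> 'k ec_point" where
  "ec_mult E d P =
     (let R = (ec_add E P ^^ nat \<bar>d\<bar>) Origin in if d \<ge> 0 then R else ec_neg E R)"

fun x_coord :: "'k ec_point \<Rightarrow> 'k P1" where
  "x_coord Origin = Infinity"
| "x_coord (Point x y) = Affine x"

text \<open>\<open>\<tau>\<^sub>n\<close>, determined by \<open>#E(F) = q ^ n + 1 - \<tau>\<^sub>n\<close> for the field \<open>F\<close> of order \<open>q ^ n\<close>.\<close>
definition frob_trace :: "'a :: finite_field weierstrass \<Rightarrow> nat \<Rightarrow> int" where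
  "frob_trace E n =
     int (CARD('a) ^ n) + 1 - int (card (rational_points E (GF (CARD('a) ^ n))))"


section \<open>Rational functions as self-maps of the projective line\<close>

text \<open>
  Elements of \<open>'a poly fract\<close> are the rational functions over \<open>'a\<close>. A representation in
  lowest terms is unique only up to a common nonzero scalar, which does not affect
  \<open>rat_eval\<close>.
\<close>
definition lowest_terms :: "'a :: field poly fract \<Rightarrow> 'a poly \<times> 'a poly" where
  "lowest_terms r =
     (SOME (f, g). g \<noteq> 0 \<and> coprime f g \<and> r = Fract f g)"

definition rat_eval :: "'a :: field poly fract \<Rightarrow> 'a alg_closure P1 \<Rightarrow> 'a alg_closure P1" where
  "rat_eval r a =
     (let f = map_poly to_ac (fst (lowest_terms r));
          g = map_poly to_ac (snd (lowest_terms r))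
      in case a of
           Affine t \<Rightarrow> if poly g t = 0 then Infinity else Affine (poly f t / poly g t)
         | Infinity \<Rightarrow> if degree f > degree g then Infinity
                       else Affine (coeff f (degree g) / lead_coeff g))"

definition lattes :: "'a :: field weierstrass \<Rightarrow> int \<Rightarrow> 'a poly fract" where
  "lattes E d =
     (THE L. \<forall>P \<in> rational_points E UNIV.
        rat_eval L (x_coord P) = x_coord (ec_mult (base_change E) d P))"

text \<open>In the next two definitions, \<open>Q\<close> is the order of the finite field.\<close>
definition Per :: "'a :: finite_field poly fract \<Rightarrow> nat \<Rightarrow> 'a alg_closure P1 set" where
  "Per L Q = {a \<in> P1_over (GF Q). \<exists>k\<ge>1. (rat_eval L ^^ k) a = a}"

definition per_density :: "'a :: finite_field poly fract \<Rightarrow> nat \<Rightarrow> real" where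
  "per_density L Q =
     real (card (Per L Q)) / real (card (P1_over (GF Q :: 'a alg_closure set)))"


section \<open>The constants of the limit formula\<close>

definition lcm_const :: "int \<Rightarrow> int" where
  "lcm_const d = Lcm {l ^ 2 - 1 | l. Factorial_Ring.prime l \<and> l dvd d}"

text \<open>\<open>\<pi>\<^sub>n\<^sub>,\<^sub>\<plusminus>\<close> is the value at \<open>k = q ^ n + 1 \<plusminus> \<tau>\<^sub>n\<close>.\<close>
definition pi_prod :: "int \<Rightarrow> int \<Rightarrow> int" where
  "pi_prod d k = (\<Prod>l \<in> {l. Factorial_Ring.prime l \<and> l dvd d}. l ^ multiplicity l k)"

end

theory Submission
  imports Defs "HOL-Number_Theory.Number_Theory" "HOL-Algebra.Sylow"
begin

text \<open>
  Write \<open>\<phi>\<close> for the Frobenius of the field of order \<open>q\<close> and \<open>Q = q ^ m\<close>. A point of the projective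
  line over the field of order \<open>Q\<close> is the abscissa of a point \<open>P\<close> with \<open>\<phi>\<^sup>m P = P\<close> or
  \<open>\<phi>\<^sup>m P = -P\<close>; these two finite groups have \<open>Q + 1 - \<tau>\<^sub>m\<close> and \<open>Q + 1 + \<tau>\<^sub>m\<close> elements. As the Lattes
  map is multiplication by \<open>d\<close> on abscissae, \<open>x(P)\<close> is periodic iff the order of \<open>P\<close> is
  coprime to \<open>d\<close>, so the density of periodic points is the average of \<open>A / ((Q + 1) A\<^sub>d)\<close> over
  the orders \<open>A\<close> of the two groups, where \<open>A\<^sub>d\<close> is the \<open>d\<close>-primary part of \<open>A\<close>. It remains to see
  that \<open>A / (Q + 1)\<close> tends to \<open>1\<close>, which the Stepanov--Bombieri method gives, and that \<open>A\<^sub>d\<close> is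
  eventually constant along the progression. The latter holds because \<open>l\<close>-torsion has at most
  \<open>l\<^sup>2\<close> points for each prime \<open>l\<close>, so that \<open>\<phi>\<close> acts on it with order dividing
  \<open>(l\<^sup>2 - 1) l\<close>, and on \<open>d\<^sup>k\<close>-torsion with order dividing \<open>c d\<^sup>k\<^sup>+\<^sup>1\<close>.

  The group law is associative because the ideals \<open>I\<^sub>P = (x - x\<^sub>P, y - y\<^sub>P)\<close> of the coordinate ring
  satisfy \<open>I\<^sub>P I\<^sub>Q \<sim> I\<^sub>P\<^sub>+\<^sub>Q\<close> and no \<open>I\<^sub>P\<close> is principal. The Lattes map and the bound on torsion come
  from a recursion for coprime polynomials \<open>F\<^sub>n, G\<^sub>n\<close> with \<open>x(nP) = F\<^sub>n / G\<^sub>n\<close>, in which \<open>x((n+1)P)\<close> is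
  split off from the quadratic form with roots \<open>x((n+1)P)\<close> and \<open>x((n-1)P)\<close>.
\<close>

text \<open>Point counts: an auxiliary function gives upper bounds Q + O(sqrt Q) only. As the two
  groups have 2 (Q + 1) elements together, an upper bound for one is a lower bound for the other, so
  the method is run on both. Torsion: the denominator of x(lP) bounds the l-torsion only by 2 l^2 -
  1. By Cauchy its order is a power of l, and below l^3 this leaves 1, l and l^2. The exponent (l^2
  - 1) l then covers the two kinds of Frobenius action on a plane over the field of l elements:
  without invariant line, and triangular. The obstacle in the last step is that a larger m may bring
  in points of higher d-power order. If d^e kills the d-part at n, then such a point has a multiple
  killed by d^(e+1) but not by d^e. The m-th and n-th powers of Frobenius agree on this multiple as
  soon as N >= e + 2, so it would occur at n already. The level found this way depends on the curve.
  Every larger N works too, so that levels of different curves can be merged.\<close>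

text \<open>A membership certificate: with \<open>L = R\<close> the equation of the curve and
  \<open>k\<close> an explicit cofactor, an identity on the curve becomes a formal polynomial
  identity.\<close>

lemma eq_if_diff_multiple:
  fixes A B L R :: "'c :: comm_ring_1"
  assumes "L = R" "A - B = k * (L - R)"
  shows "A = B"
  using assms by simp

section \<open>The coordinate ring\<close>

locale weierstrass_curve =
  fixes E :: "'k :: field weierstrass"
begin

definition lin_poly :: "'k poly" where
  "lin_poly = [:A3 E, A1 E:]"

definition cubic_poly :: "'k poly" where
  "cubic_poly = [:A6 E, A4 E, A2 E, 1:]"

text \<open>
  The pair \<open>(f, g)\<close> stands for the function \<open>f(x) + g(x) y\<close> on the affine curve
  \<open>y^2 + lin_poly(x) y = cubic_poly(x)\<close>.
\<close>
fun cr_mult :: "'k poly \<times> 'k poly \<Rightarrow> 'k poly \<times> 'k poly \<Rightarrow> 'k poly \<times> 'k poly" where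
  "cr_mult (f, g) (f', g') =
     (f * f' + g * g' * cubic_poly, f * g' + f' * g - g * g' * lin_poly)"

text \<open>The norm down to polynomials in x: the product of f + g y with its conjugate under y ->
  -y - \<open>lin_poly\<close>(x).\<close>

fun cr_norm :: "'k poly \<times> 'k poly \<Rightarrow> 'k poly" where
  "cr_norm (f, g) = f ^ 2 - f * g * lin_poly - g ^ 2 * cubic_poly"

fun cr_eval :: "'k \<Rightarrow> 'k \<Rightarrow> 'k poly \<times> 'k poly \<Rightarrow> 'k" where
  "cr_eval x y (f, g) = poly f x + poly g x * y"

lemma on_curve_Point:
  "on_curve E (Point x y) \<longleftrightarrow> y ^ 2 + poly lin_poly x * y = poly cubic_poly x"
  by (simp add: lin_poly_def cubic_poly_def algebra_simps power2_eq_square power3_eq_cube)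

lemma cr_norm_mult: "cr_norm (cr_mult u v) = cr_norm u * cr_norm v"
proof -
  obtain f g f' g' where uv: "u = (f, g)" "v = (f', g')" by (cases u; cases v)
  show ?thesis unfolding uv cr_mult.simps cr_norm.simps by Groebner_Basis.algebra
qed

lemma cr_eval_mult:
  assumes "on_curve E (Point x y)"
  shows "cr_eval x y (cr_mult u v) = cr_eval x y u * cr_eval x y v"
proof -
  obtain f g f' g' where uv: "u = (f, g)" "v = (f', g')" by (cases u; cases v)
  show ?thesis
    unfolding uv cr_mult.simps cr_eval.simps poly_add poly_mult poly_diff
    by (rule eq_if_diff_multiple[OF assms[unfolded on_curve_Point], of _ _ "- poly g x * poly g' x"])
      Groebner_Basis.algebra
qed

lemma degree_lin_poly_le: "degree lin_poly \<le> 1"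
  by (simp add: lin_poly_def)

lemma degree_cubic_poly: "degree cubic_poly = 3"
  by (simp add: cubic_poly_def)

text \<open>The squares contribute an even degree 2 deg f and an odd degree 2 deg g + 3, which
  cannot cancel, and the mixed term stays strictly below the larger one. The result is the pole
  order of f + g y at infinity, where x has order 2 and y order 3; the value 1 never occurs.\<close>

lemma degree_cr_norm:
  "degree (cr_norm (f, g)) = (if g = 0 then 2 * degree f else max (2 * degree f) (2 * degree g + 3))"
proof (cases "g = 0")
  case True
  then show ?thesis
    by (simp add: degree_power_eq power2_eq_square) (cases "f = 0"; simp add: degree_mult_eq)
next
  case False
  have gC: "degree (g ^ 2 * cubic_poly) = 2 * degree g + 3"
    using False degree_cubic_poly
    by (subst degree_mult_eq) (auto simp: power2_eq_square degree_mult_eq)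
  have ff: "degree (f ^ 2) = 2 * degree f"
    by (cases "f = 0") (auto simp: power2_eq_square degree_mult_eq)
  have fg: "degree (f * g * lin_poly) \<le> degree f + degree g + 1"
    using degree_mult_le[of "f * g" lin_poly] degree_mult_le[of f g] degree_lin_poly_le by linarith
  consider "degree f \<ge> degree g + 2" | "degree f \<le> degree g + 1" by linarith
  then show ?thesis
  proof cases
    case 1
    have "degree (f * g * lin_poly + g ^ 2 * cubic_poly) < degree (f ^ 2)"
      using 1 fg gC ff by (intro degree_add_less) auto
    then have "degree (f ^ 2 - (f * g * lin_poly + g ^ 2 * cubic_poly)) = degree (f ^ 2)"
      by (metis degree_add_eq_left degree_minus add_uminus_conv_diff)
    then show ?thesis
      using 1 False ff by (simp add: algebra_simps)
  next
    case 2
    have "degree (f ^ 2 - f * g * lin_poly) < degree (g ^ 2 * cubic_poly)"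
      using 2 fg gC ff by (intro degree_diff_less) auto
    then have "degree ((f ^ 2 - f * g * lin_poly) - g ^ 2 * cubic_poly) = degree (g ^ 2 * cubic_poly)"
      by (metis degree_add_eq_right degree_minus add_uminus_conv_diff)
    then show ?thesis
      using 2 False gC by (simp add: algebra_simps)
  qed
qed

lemma cr_norm_eq_0_iff: "cr_norm u = 0 \<longleftrightarrow> u = (0, 0)"
proof (cases u)
  case (Pair f g)
  show ?thesis
  proof
    assume 0: "cr_norm u = 0"
    with Pair have "degree (cr_norm (f, g)) = 0" by simp
    then have "g = 0" by (simp only: degree_cr_norm split: if_splits)
    with 0 Pair show "u = (0, 0)" by simp
  qed (use Pair in simp)
qed


section \<open>The function field\<close>

text \<open>
  The function field of the curve is realised inside the algebraic closure of the rational
  function field, so that its elements live in a type of class \<open>field\<close>.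
\<close>
definition em :: "'k poly \<Rightarrow> 'k poly fract alg_closure" where
  "em f = to_ac (to_fract f)"

definition eta :: "'k poly fract alg_closure" where
  "eta = (SOME h. h ^ 2 + em lin_poly * h = em cubic_poly)"

fun cr_rep :: "'k poly \<times> 'k poly \<Rightarrow> 'k poly fract alg_closure" where
  "cr_rep (f, g) = em f + em g * eta"

lemma em_simps:
  "em 0 = 0" "em 1 = 1" "em (f + g) = em f + em g" "em (f - g) = em f - em g"
  "em (- f) = - em f" "em (f * g) = em f * em g" "em f = em g \<longleftrightarrow> f = g"
  by (simp_all add: em_def)

lemma em_power: "em (f ^ n) = em f ^ n"
  by (induction n) (simp_all add: em_simps)

lemma eta_eq: "eta ^ 2 + em lin_poly * eta = em cubic_poly"
proof -
  have "\<exists>h. poly [:- em cubic_poly, em lin_poly, 1:] h = 0"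
    by (rule alg_closed_imp_poly_has_root) simp
  then have "\<exists>h. h ^ 2 + em lin_poly * h = em cubic_poly"
    by (auto simp: algebra_simps power2_eq_square add_eq_0_iff2)
  then show ?thesis unfolding eta_def by (rule someI_ex)
qed

lemma cr_rep_mult: "cr_rep (cr_mult u v) = cr_rep u * cr_rep v"
proof -
  obtain f g f' g' where uv: "u = (f, g)" "v = (f', g')" by (cases u; cases v)
  show ?thesis unfolding uv cr_mult.simps cr_rep.simps em_simps
    by (rule eq_if_diff_multiple[OF eta_eq, of _ _ "- em g * em g'"]) Groebner_Basis.algebra
qed

lemma cr_rep_add: "cr_rep (f + f', g + g') = cr_rep (f, g) + cr_rep (f', g')"
  by (simp add: em_simps algebra_simps)

text \<open>Multiplying by the conjugate gives the image of the norm, which vanishes only at zero.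
  Hence \<open>cr_rep\<close> embeds the coordinate ring, whichever root was chosen as
  \<open>eta\<close>.\<close>

lemma cr_rep_eq_0_iff: "cr_rep u = 0 \<longleftrightarrow> u = (0, 0)"
proof (cases u)
  case (Pair f g)
  have "cr_rep (f, g) * cr_rep (f - g * lin_poly, - g) = em (cr_norm (f, g))"
    unfolding cr_norm.simps cr_rep.simps em_simps em_power
    by (rule eq_if_diff_multiple[OF eta_eq, of _ _ "- (em g ^ 2)"]) Groebner_Basis.algebra
  then have "cr_rep u = 0 \<Longrightarrow> em (cr_norm u) = em 0"
    using Pair by (simp add: em_simps(1))
  then have "cr_rep u = 0 \<Longrightarrow> cr_norm u = 0" using em_simps(7) by blast
  then show ?thesis unfolding cr_norm_eq_0_iff by (auto simp: em_simps)
qed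

lemma cr_rep_inject: "cr_rep u = cr_rep v \<longleftrightarrow> u = v"
proof (cases u; cases v)
  fix f g f' g' assume uv: "u = (f, g)" "v = (f', g')"
  have "cr_rep (f - f', g - g') = cr_rep (f, g) - cr_rep (f', g')"
    by (simp add: em_simps algebra_simps)
  then show ?thesis using cr_rep_eq_0_iff[of "(f - f', g - g')"] uv by auto
qed


section \<open>Fractional ideals\<close>

text \<open>Fractional ideals are handled through generating sets: this is the module over the
  coordinate ring that \<open>S\<close> generates, and ideals are compared by comparing
  spans.\<close>

inductive_set cr_span :: "'k poly fract alg_closure set \<Rightarrow> 'k poly fract alg_closure set"
  for S where
  zero: "0 \<in> cr_span S"
| add_mult: "z \<in> cr_span S \<Longrightarrow> s \<in> S \<Longrightarrow> cr_rep u * s + z \<in> cr_span S"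

lemma cr_rep_1: "cr_rep (1, 0) = 1" and cr_rep_em: "cr_rep (f, 0) = em f"
  by (simp_all add: em_simps)

lemma cr_span_base: "s \<in> S \<Longrightarrow> s \<in> cr_span S"
  using cr_span.add_mult[OF cr_span.zero, of s S "(1, 0)"] by (simp only: cr_rep_1 mult_1 add_0_right)

lemma cr_span_add: "y \<in> cr_span S \<Longrightarrow> z \<in> cr_span S \<Longrightarrow> y + z \<in> cr_span S"
  by (induction rule: cr_span.induct) (simp_all add: add.assoc cr_span.add_mult)

lemma cr_span_mult: "z \<in> cr_span S \<Longrightarrow> cr_rep u * z \<in> cr_span S"
proof (induction rule: cr_span.induct)
  case (add_mult z s v)
  have "cr_rep u * (cr_rep v * s + z) = cr_rep (cr_mult u v) * s + cr_rep u * z"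
    by (simp only: cr_rep_mult algebra_simps)
  with add_mult show ?case by (simp only: cr_span.add_mult)
qed (simp add: cr_span.zero)

lemma cr_span_em_mult: "z \<in> cr_span S \<Longrightarrow> em f * z \<in> cr_span S"
  using cr_span_mult[of z S "(f, 0)"] by (simp only: cr_rep_em)

lemma cr_span_eta_mult: "z \<in> cr_span S \<Longrightarrow> eta * z \<in> cr_span S"
  using cr_span_mult[of z S "(0, 1)"] by (simp add: em_simps)

lemma cr_span_uminus: "z \<in> cr_span S \<Longrightarrow> - z \<in> cr_span S"
  using cr_span_em_mult[of z S "-1"] by (simp only: em_simps mult_minus_left mult_1)

lemma cr_span_diff: "y \<in> cr_span S \<Longrightarrow> z \<in> cr_span S \<Longrightarrow> y - z \<in> cr_span S"
  using cr_span_add[of y S "- z"] cr_span_uminus[of z S] by simp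

lemma cr_span_subset: "S \<subseteq> cr_span T \<Longrightarrow> cr_span S \<subseteq> cr_span T"
proof
  fix z assume "S \<subseteq> cr_span T" "z \<in> cr_span S"
  from this(2,1) show "z \<in> cr_span T"
    by induction (auto intro: cr_span.zero cr_span_add cr_span_mult)
qed

lemma cr_span_eqI: "S \<subseteq> cr_span T \<Longrightarrow> T \<subseteq> cr_span S \<Longrightarrow> cr_span S = cr_span T"
  using cr_span_subset by blast

lemma cr_span_image_mult: "cr_span ((*) a ` S) = (*) a ` cr_span S"
proof (intro equalityI subsetI)
  fix z assume "z \<in> cr_span ((*) a ` S)"
  then show "z \<in> (*) a ` cr_span S"
  proof induction
    case zero
    show ?case using cr_span.zero[of S] by (intro image_eqI[of _ _ 0]) auto
  next
    case (add_mult z s u)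
    then obtain z' s' where *: "z' \<in> cr_span S" "s' \<in> S" "z = a * z'" "s = a * s'" by auto
    show ?case
      by (rule image_eqI[of _ _ "cr_rep u * s' + z'"])
        (use * cr_span.add_mult[of z' S s' u] in \<open>auto simp: algebra_simps\<close>)
  qed
next
  fix z assume "z \<in> (*) a ` cr_span S"
  then obtain w where w: "w \<in> cr_span S" "z = a * w" by auto
  from w(1) have "a * w \<in> cr_span ((*) a ` S)"
  proof induction
    case (add_mult z s u)
    have "a * (cr_rep u * s + z) = cr_rep u * (a * s) + a * z" by (simp only: algebra_simps)
    moreover have "a * s \<in> (*) a ` S" using add_mult by blast
    ultimately show ?case using add_mult cr_span.add_mult by metis
  qed (simp add: cr_span.zero)
  with w show "z \<in> cr_span ((*) a ` S)" by simp
qed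

definition set_prod :: "'c :: comm_ring_1 set \<Rightarrow> 'c set \<Rightarrow> 'c set" where
  "set_prod S T = {s * t | s t. s \<in> S \<and> t \<in> T}"

lemma set_prod_commute: "set_prod S T = set_prod T S"
  unfolding set_prod_def by (auto simp: mult.commute) (metis mult.commute)+

lemma set_prod_assoc: "set_prod (set_prod S T) U = set_prod S (set_prod T U)"
  unfolding set_prod_def by (auto simp: mult.assoc) (metis mult.assoc)+

lemma set_prod_one: "set_prod {1} T = T"
  unfolding set_prod_def by auto

lemma set_prod_image_mult: "set_prod ((*) a ` S) T = (*) a ` set_prod S T"
  unfolding set_prod_def by (auto simp: image_iff mult.assoc) (metis mult.assoc)+

text \<open>Makes the product of ideals well defined: it may be computed on any generators.\<close>

lemma cr_span_set_prod_subset: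
  assumes "cr_span S \<subseteq> cr_span T"
  shows "cr_span (set_prod S U) \<subseteq> cr_span (set_prod T U)"
proof (rule cr_span_subset, rule subsetI)
  fix z assume "z \<in> set_prod S U"
  then obtain s u where su: "s \<in> S" "u \<in> U" "z = s * u" by (auto simp: set_prod_def)
  have "s \<in> cr_span T" using su cr_span_base assms by blast
  then have "s * u \<in> cr_span (set_prod T U)"
  proof induction
    case (add_mult z s v)
    have "(cr_rep v * s + z) * u = cr_rep v * (s * u) + z * u" by (simp only: algebra_simps)
    moreover have "s * u \<in> set_prod T U" using add_mult su by (auto simp: set_prod_def)
    ultimately show ?case using add_mult by (simp add: cr_span.add_mult)
  qed (simp add: cr_span.zero)
  with su show "z \<in> cr_span (set_prod T U)" by simp
qed

text \<open>Equality of ideal classes. Scaling both sides keeps the relation symmetric and free of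
  inverses.\<close>

definition ideal_equiv (infix \<open>\<approx>\<close> 50) where
  "S \<approx> T \<longleftrightarrow> (\<exists>a b. a \<noteq> 0 \<and> b \<noteq> 0 \<and> cr_span ((*) a ` S) = cr_span ((*) b ` T))"

lemma ideal_equiv_sym: "S \<approx> T \<Longrightarrow> T \<approx> S"
  unfolding ideal_equiv_def by metis

lemma image_mult_mult: "(*) a ` (*) b ` S = (*) (a * b :: 'c :: comm_ring_1) ` S"
  by (simp add: image_image mult.assoc)

lemma ideal_equiv_trans [trans]:
  assumes "S \<approx> T" "T \<approx> U"
  shows "S \<approx> U"
proof -
  obtain a b c d where *: "a \<noteq> 0" "b \<noteq> 0" "c \<noteq> 0" "d \<noteq> 0"
    "cr_span ((*) a ` S) = cr_span ((*) b ` T)" "cr_span ((*) c ` T) = cr_span ((*) d ` U)"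
    using assms unfolding ideal_equiv_def by blast
  have "cr_span ((*) (c * a) ` S) = (*) c ` cr_span ((*) a ` S)"
    by (simp only: cr_span_image_mult image_mult_mult)
  also have "\<dots> = (*) b ` cr_span ((*) c ` T)"
    unfolding *(5) by (simp only: cr_span_image_mult image_mult_mult mult.commute[of c b])
  also have "\<dots> = cr_span ((*) (b * d) ` U)"
    unfolding * by (simp only: cr_span_image_mult image_mult_mult)
  finally show ?thesis using * unfolding ideal_equiv_def by (metis mult_eq_0_iff)
qed

lemma ideal_equiv_set_prod:
  assumes "S \<approx> T"
  shows "set_prod S U \<approx> set_prod T U"
proof -
  obtain a b where *: "a \<noteq> 0" "b \<noteq> 0" "cr_span ((*) a ` S) = cr_span ((*) b ` T)"
    using assms unfolding ideal_equiv_def by blast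
  have "cr_span (set_prod ((*) a ` S) U) = cr_span (set_prod ((*) b ` T) U)"
    using * by (intro equalityI cr_span_set_prod_subset) simp_all
  with * show ?thesis unfolding ideal_equiv_def set_prod_image_mult by blast
qed

end

section \<open>The group law\<close>

locale smooth_weierstrass = weierstrass_curve E for E :: "'k :: field weierstrass" +
  assumes nonsingular: "on_curve E (Point x y) \<Longrightarrow> \<not> singular_at E x y"
begin

lemma ec_neg_ec_neg [simp]: "ec_neg E (ec_neg E P) = P"
  by (cases P) simp_all

lemma ec_neg_eq_Origin_iff [simp]: "ec_neg E P = Origin \<longleftrightarrow> P = Origin"
  by (cases P) simp_all

lemma ec_neg_eq_iff [simp]: "ec_neg E P = ec_neg E Q \<longleftrightarrow> P = Q"
  by (metis ec_neg_ec_neg)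

lemma ec_add_Origin_right [simp]: "ec_add E P Origin = P"
  by (cases P) simp_all

lemma on_curve_neg [simp]: "on_curve E (ec_neg E P) \<longleftrightarrow> on_curve E P"
proof (cases P)
  case (Point x y)
  have "(- y - A1 E * x - A3 E) ^ 2 + A1 E * x * (- y - A1 E * x - A3 E)
      + A3 E * (- y - A1 E * x - A3 E) = y ^ 2 + A1 E * x * y + A3 E * y"
    by Groebner_Basis.algebra
  then show ?thesis by (simp add: Point)
qed simp

lemma same_x_cases:
  assumes "on_curve E (Point x y1)" "on_curve E (Point x y2)"
  shows "y2 = y1 \<or> y1 + y2 + A1 E * x + A3 E = 0"
proof -
  have "(y2 - y1) * (y1 + y2 + A1 E * x + A3 E) = (y2 ^ 2 + A1 E * x * y2 + A3 E * y2)
    - (y1 ^ 2 + A1 E * x * y1 + A3 E * y1)"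
    by Groebner_Basis.algebra
  then have "(y2 - y1) * (y1 + y2 + A1 E * x + A3 E) = 0" using assms by simp
  then show ?thesis by simp
qed

lemma x_coord_eq_iff:
  assumes "on_curve E P" "on_curve E Q"
  shows "x_coord P = x_coord Q \<longleftrightarrow> Q = P \<or> Q = ec_neg E P"
proof (cases P; cases Q)
  fix x1 y1 x2 y2 assume P: "P = Point x1 y1" and Q: "Q = Point x2 y2"
  show ?thesis
  proof (cases "x1 = x2")
    case True
    with same_x_cases[of x1 y1 y2] assms P Q
    have "y2 = y1 \<or> y2 = - y1 - A1 E * x1 - A3 E" by (auto simp: algebra_simps eq_neg_iff_add_eq_0)
    with True P Q show ?thesis by auto
  qed (use P Q in auto)
qed auto

lemma ec_add_neg_right [simp]: "ec_add E P (ec_neg E P) = Origin"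
  by (cases P) (simp_all add: algebra_simps)

text \<open>
  The line \<open>y = c + s x\<close> meets the curve in the abscissae \<open>x1\<close>, \<open>x2\<close>, \<open>x3\<close>.
\<close>
lemma ec_add_line:
  assumes P: "on_curve E (Point x1 y1)" and Q: "on_curve E (Point x2 y2)"
    and noninv: "\<not> (x1 = x2 \<and> y1 + y2 + A1 E * x2 + A3 E = 0)"
  obtains s c x3 where
    "y1 = c + s * x1" "y2 = c + s * x2"
    "cubic_poly - [:c, s:] ^ 2 - lin_poly * [:c, s:] = [:- x1, 1:] * [:- x2, 1:] * [:- x3, 1:]"
    "ec_add E (Point x1 y1) (Point x2 y2) = Point x3 (- (c + s * x3) - A1 E * x3 - A3 E)"
    "x1 = x2 \<Longrightarrow> 2 * y1 + A1 E * x1 + A3 E \<noteq> 0"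
    "x1 = x2 \<Longrightarrow> s * (2 * y1 + A1 E * x1 + A3 E) = 3 * x1 ^ 2 + 2 * A2 E * x1 + A4 E - A1 E * y1"
proof -
  define s where "s = (if x1 = x2
     then (3 * x1 ^ 2 + 2 * A2 E * x1 + A4 E - A1 E * y1) / (2 * y1 + A1 E * x1 + A3 E)
     else (y2 - y1) / (x2 - x1))"
  define x3 where "x3 = s ^ 2 + A1 E * s - A2 E - x1 - x2"
  define c where "c = y1 - s * x1"
  have eqP: "y1 ^ 2 + A1 E * x1 * y1 + A3 E * y1 = x1 ^ 3 + A2 E * x1 ^ 2 + A4 E * x1 + A6 E"
    using P by simp
  have eqQ: "y2 ^ 2 + A1 E * x2 * y2 + A3 E * y2 = x2 ^ 3 + A2 E * x2 ^ 2 + A4 E * x2 + A6 E"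
    using Q by simp
  have y2: "x1 = x2 \<Longrightarrow> y2 = y1"
    using same_x_cases[of x1 y1 y2] P Q noninv by auto
  have D: "x1 = x2 \<Longrightarrow> 2 * y1 + A1 E * x1 + A3 E \<noteq> 0"
  proof
    assume x: "x1 = x2" and "2 * y1 + A1 E * x1 + A3 E = 0"
    then have "y1 + y2 + A1 E * x2 + A3 E = 0" unfolding y2[OF x] x mult_2 by blast
    with x noninv show False by simp
  qed
  have chord: "x1 \<noteq> x2 \<Longrightarrow> s * (x2 - x1) = y2 - y1"
    by (simp add: s_def)
  have tangent: "x1 = x2 \<Longrightarrow> s * (2 * y1 + A1 E * x1 + A3 E)
      = 3 * x1 ^ 2 + 2 * A2 E * x1 + A4 E - A1 E * y1"
    using D by (simp add: s_def)
  \<comment> \<open>The coefficient of x^2 holds by the choice of \<open>x3\<close>. The coefficient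
    of x is the difference of the two curve equations divided by \<open>x2 - x1\<close>, or the
    tangent condition if the abscissae agree; the constant coefficient is then the equation at the
    first point.\<close>
  have coeff1: "A4 E - 2 * s * c - A3 E * s - A1 E * c = x1 * x2 + x1 * x3 + x2 * x3"
  proof (cases "x1 = x2")
    case True
    show ?thesis unfolding True[symmetric] c_def x3_def
      by (rule eq_if_diff_multiple[OF tangent[OF True], of _ _ "-1"])
        (simp add: algebra_simps power2_eq_square flip: True)
  next
    case False
    have y2s: "y2 = y1 + s * (x2 - x1)" using chord[OF False] by simp
    have "(x2 - x1) * (A4 E - 2 * s * c - A3 E * s - A1 E * c - (x1 * x2 + x1 * x3 + x2 * x3))
      = (y1 ^ 2 + A1 E * x1 * y1 + A3 E * y1 - (x1 ^ 3 + A2 E * x1 ^ 2 + A4 E * x1 + A6 E))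
       - (y2 ^ 2 + A1 E * x2 * y2 + A3 E * y2 - (x2 ^ 3 + A2 E * x2 ^ 2 + A4 E * x2 + A6 E))"
      unfolding y2s c_def x3_def by Groebner_Basis.algebra
    also have "\<dots> = 0" using eqP eqQ by simp
    finally show ?thesis using False by simp
  qed
  have coeff0: "A6 E - c ^ 2 - A3 E * c = - (x1 * x2 * x3)"
  proof -
    have "A6 E - c ^ 2 - A3 E * c + x1 * x2 * x3 =
      - (y1 ^ 2 + A1 E * x1 * y1 + A3 E * y1 - (x1 ^ 3 + A2 E * x1 ^ 2 + A4 E * x1 + A6 E))
      - x1 * (A4 E - 2 * s * c - A3 E * s - A1 E * c - (x1 * x2 + x1 * x3 + x2 * x3))"
      unfolding c_def x3_def by (simp add: algebra_simps power2_eq_square power3_eq_cube)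
    with eqP coeff1 show ?thesis by (simp add: add_eq_0_iff2)
  qed
  have coeff2: "A2 E - s ^ 2 - A1 E * s = - x1 - x2 - x3"
    by (simp add: x3_def)
  show thesis
  proof (rule that)
    show "y1 = c + s * x1" by (simp add: c_def)
    show "y2 = c + s * x2"
      using y2 chord by (cases "x1 = x2") (auto simp: c_def algebra_simps)
    have "cubic_poly - [:c, s:] ^ 2 - lin_poly * [:c, s:] =
      [:A6 E - c ^ 2 - A3 E * c, A4 E - 2 * s * c - A3 E * s - A1 E * c, A2 E - s ^ 2 - A1 E * s, 1:]"
      by (simp add: cubic_poly_def lin_poly_def power2_eq_square algebra_simps)
    also have "\<dots> = [:- (x1 * x2 * x3), x1 * x2 + x1 * x3 + x2 * x3, - x1 - x2 - x3, 1:]"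
      by (simp only: coeff0 coeff1 coeff2)
    also have "\<dots> = [:- x1, 1:] * [:- x2, 1:] * [:- x3, 1:]"
      by (simp add: algebra_simps)
    finally show "cubic_poly - [:c, s:] ^ 2 - lin_poly * [:c, s:]
      = [:- x1, 1:] * [:- x2, 1:] * [:- x3, 1:]" .
    have *: "c + s * x3 = s * (x3 - x1) + y1" by (simp add: c_def algebra_simps)
    show "ec_add E (Point x1 y1) (Point x2 y2) = Point x3 (- (c + s * x3) - A1 E * x3 - A3 E)"
      unfolding * by (simp only: ec_add.simps noninv if_False Let_def x3_def s_def)
  qed (use D tangent in auto)
qed

lemma on_curve_if_line:
  assumes "cubic_poly - [:c, s:] ^ 2 - lin_poly * [:c, s:] = [:- x1, 1:] * [:- x2, 1:] * [:- x3, 1:]"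
  shows "on_curve E (Point x3 (- (c + s * x3) - A1 E * x3 - A3 E))"
proof -
  have "poly (cubic_poly - [:c, s:] ^ 2 - lin_poly * [:c, s:]) x3 = 0"
    unfolding assms by simp
  then have "on_curve E (Point x3 (c + s * x3))"
    unfolding on_curve_Point by (simp add: algebra_simps)
  then show ?thesis using on_curve_neg[of "Point x3 (c + s * x3)"] by simp
qed

lemma on_curve_add:
  assumes "on_curve E P" "on_curve E Q"
  shows "on_curve E (ec_add E P Q)"
proof (cases P; cases Q)
  fix x1 y1 x2 y2 assume PQ: "P = Point x1 y1" "Q = Point x2 y2"
  show ?thesis
  proof (cases "x1 = x2 \<and> y1 + y2 + A1 E * x2 + A3 E = 0")
    case False
    then obtain s c x3 where
      "cubic_poly - [:c, s:] ^ 2 - lin_poly * [:c, s:] = [:- x1, 1:] * [:- x2, 1:] * [:- x3, 1:]"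
      "ec_add E (Point x1 y1) (Point x2 y2) = Point x3 (- (c + s * x3) - A1 E * x3 - A3 E)"
      using ec_add_line[of x1 y1 x2 y2] assms PQ by metis
    then show ?thesis using on_curve_if_line[of c s x1 x2 x3] PQ by simp
  qed (use PQ in simp)
qed (use assms in auto)

section \<open>Ideal classes of points\<close>

text \<open>\<open>Origin\<close> does not lie on the affine curve, so it gets the unit ideal, the
  neutral class.\<close>

fun point_ideal :: "'k ec_point \<Rightarrow> 'k poly fract alg_closure set" where
  "point_ideal Origin = {1}"
| "point_ideal (Point x y) = {em [:- x, 1:], eta - em [:y:]}"

lemma cr_span_point_ideal:
  assumes "on_curve E (Point x y)" "z \<in> cr_span (point_ideal (Point x y))"
  shows "\<exists>u. z = cr_rep u \<and> cr_eval x y u = 0"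
  using assms(2)
proof induction
  case zero
  show ?case by (rule exI[of _ "(0, 0)"]) (simp add: em_simps)
next
  case (add_mult z s u)
  then obtain v where v: "z = cr_rep v" "cr_eval x y v = 0" by blast
  obtain w where w: "s = cr_rep w" "cr_eval x y w = 0"
  proof -
    have "eta - em [:y:] = cr_rep (- [:y:], 1)" by (simp add: em_simps(2,5) del: minus_pCons)
    moreover have "em [:- x, 1:] = cr_rep ([:- x, 1:], 0)" by (simp add: em_simps)
    moreover have "cr_eval x y (- [:y:], 1) = 0" "cr_eval x y ([:- x, 1:], 0) = 0" by simp_all
    ultimately show ?thesis
      using that[of "([:- x, 1:], 0)"] that[of "(- [:y:], 1)"] add_mult(2)
      by (metis insert_iff empty_iff point_ideal.simps(2))
  qed
  obtain f g f' g' where fg: "cr_mult u w = (f, g)" "v = (f', g')" by (cases "cr_mult u w"; cases v)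
  have "cr_rep u * s + z = cr_rep (f + f', g + g')"
    using w v fg cr_rep_mult[of u w] cr_rep_add[of f f' g g'] by simp
  moreover have "cr_eval x y (f + f', g + g') = cr_eval x y (cr_mult u w) + cr_eval x y v"
    using fg by (simp add: algebra_simps)
  ultimately show ?case
    using cr_eval_mult[OF assms(1), of u w] v w by (intro exI[of _ "(f + f', g + g')"]) simp
qed

lemma em_const_unit: "a \<noteq> 0 \<Longrightarrow> em [:inverse a:] * em [:a:] = 1"
  by (simp flip: em_simps(6) add: em_simps(2) one_pCons[symmetric])

lemma cr_span_unitI:
  assumes "em [:a:] * c \<in> cr_span S" "a \<noteq> 0"
  shows "c \<in> cr_span S"
proof -
  have "em [:inverse a:] * (em [:a:] * c) \<in> cr_span S"
    using assms cr_span_em_mult by blast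
  then show ?thesis using em_const_unit[OF assms(2)] by (simp flip: mult.assoc)
qed

lemma em_lin_nonzero: "em [:- x, 1:] \<noteq> 0"
  using em_simps(7)[of "[:- x, 1:]" 0] by (simp add: em_simps(1))

text \<open>The product is the principal ideal of x - x(P). All four products of generators are
  multiples of \<open>?X\<close>, and the cofactors generate the unit ideal: \<open>?Y' - ?Y\<close>
  is a nonzero constant unless P = -P, and in that case smoothness supplies a unit.\<close>

lemma point_ideal_neg:
  assumes "on_curve E P"
  shows "set_prod (point_ideal P) (point_ideal (ec_neg E P)) \<approx> {1}"
proof (cases P)
  case Origin
  then show ?thesis unfolding ideal_equiv_def
    by (intro exI[of _ 1]) (simp add: set_prod_one)
next
  case (Point x y)
  define y' where "y' = - y - A1 E * x - A3 E"
  let ?X = "em [:- x, 1:]" and ?Y = "eta - em [:y:]" and ?Y' = "eta - em [:y':]"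
  let ?S = "set_prod (point_ideal P) (point_ideal (ec_neg E P))"
  have S: "?S = {?X * ?X, ?X * ?Y', ?Y * ?X, ?Y * ?Y'}"
    unfolding Point set_prod_def y'_def by auto
  \<comment> \<open>The difference quotient of \<open>cubic_poly\<close> at
    \<open>x\<close>.\<close>
  define h where "h = [:x ^ 2 + A2 E * x + A4 E, x + A2 E, 1:]"
  have Ceq: "poly cubic_poly x = y ^ 2 + poly lin_poly x * y"
    using assms Point on_curve_Point by simp
  have YY: "?Y * ?Y' = ?X * (em h - em [:A1 E:] * eta)"
  proof -
    have 1: "cubic_poly - [:poly cubic_poly x:] = [:- x, 1:] * h"
      by (simp add: cubic_poly_def h_def algebra_simps power2_eq_square)
    have 2: "lin_poly + [:y + y':] = [:- x, 1:] * [:A1 E:]"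
      by (simp add: lin_poly_def y'_def)
    have 3: "[:y:] * [:y':] = - [:poly cubic_poly x:]"
      unfolding Ceq by (simp add: y'_def lin_poly_def algebra_simps power2_eq_square)
    have "?Y * ?Y' = (em cubic_poly - em [:poly cubic_poly x:]) - em (lin_poly + [:y + y':]) * eta"
    proof (rule eq_if_diff_multiple[OF eta_eq, of _ _ 1])
      have 4: "em [:y + y':] = em [:y:] + em [:y':]" by (simp flip: em_simps(3))
      have 5: "em [:poly cubic_poly x:] = - (em [:y:] * em [:y':])"
        using 3 by (simp only: em_simps(5,6)[symmetric]) simp
      show "?Y * ?Y' - ((em cubic_poly - em [:poly cubic_poly x:]) - em (lin_poly + [:y + y':]) * eta)
          = 1 * (eta ^ 2 + em lin_poly * eta - em cubic_poly)"
        unfolding 4 5 em_simps(3) by Groebner_Basis.algebra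
    qed
    also have "\<dots> = em ([:- x, 1:] * h) - em ([:- x, 1:] * [:A1 E:]) * eta"
      by (simp only: em_simps(4)[symmetric] 1 2)
    finally show ?thesis by (simp only: em_simps(6) algebra_simps)
  qed
  have "?S = (*) ?X ` {?X, ?Y', ?Y, em h - em [:A1 E:] * eta}"
    unfolding S YY by (auto simp: mult.commute)
  moreover have "cr_span {?X, ?Y', ?Y, em h - em [:A1 E:] * eta} = cr_span {1}"
  proof (rule cr_span_eqI)
    have 1: "1 \<in> cr_span {1}" by (rule cr_span_base) simp
    have em: "em f \<in> cr_span {1}" for f using cr_span_em_mult[OF 1, of f] by simp
    have eta: "em f * eta \<in> cr_span {1}" for f
      using cr_span_em_mult[OF cr_span_eta_mult[OF 1], of f] by simp
    have eta': "eta \<in> cr_span {1}" using eta[of 1] by (simp add: em_simps)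
    show "{?X, ?Y', ?Y, em h - em [:A1 E:] * eta} \<subseteq> cr_span {1}"
      using em eta eta' by (auto intro!: cr_span_diff)
    let ?T = "cr_span {?X, ?Y', ?Y, em h - em [:A1 E:] * eta}"
    have X: "?X \<in> ?T" and Y: "?Y \<in> ?T" and Y': "?Y' \<in> ?T"
      and H: "em h - em [:A1 E:] * eta \<in> ?T" by (auto intro: cr_span_base)
    have "1 \<in> ?T"
    proof (cases "y = y'")
      case False
      have "?Y' - ?Y \<in> ?T" using Y Y' by (rule cr_span_diff[rotated])
      also have "?Y' - ?Y = em [:y - y':] * 1" by (simp flip: em_simps(4))
      finally show ?thesis by (rule cr_span_unitI) (use False in simp)
    next
      case True
      have "2 * y + A1 E * x + A3 E = y - y'" by (simp add: y'_def)
      with True have "2 * y + A1 E * x + A3 E = 0" by simp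
      then have ns: "3 * x ^ 2 + 2 * A2 E * x + A4 E - A1 E * y \<noteq> 0"
        using nonsingular[of x y] assms Point by (auto simp: singular_at_def algebra_simps)
      \<comment> \<open>Reducing the last generator modulo \<open>?X\<close> and \<open>?Y\<close>
        evaluates it at P. The value is, up to sign, the partial derivative in x of the equation;
        the other partial derivative is already zero.\<close>
      have "(em h - em [:A1 E:] * eta) + em [:A1 E:] * ?Y - em [:2 * x + A2 E, 1:] * ?X \<in> ?T"
        by (intro cr_span_diff cr_span_add cr_span_em_mult H X Y)
      also have "(em h - em [:A1 E:] * eta) + em [:A1 E:] * ?Y - em [:2 * x + A2 E, 1:] * ?X
        = em (h - [:A1 E:] * [:y:] - [:2 * x + A2 E, 1:] * [:- x, 1:])"
        unfolding em_simps by Groebner_Basis.algebra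
      also have "h - [:A1 E:] * [:y:] - [:2 * x + A2 E, 1:] * [:- x, 1:] =
          [:3 * x ^ 2 + 2 * A2 E * x + A4 E - A1 E * y:]"
        by (simp add: h_def algebra_simps power2_eq_square)
      finally show ?thesis
        using cr_span_unitI[of _ 1, OF _ ns] by (simp only: mult_1_right)
    qed
    then show "{1} \<subseteq> ?T" by simp
  qed
  ultimately have "cr_span ((*) 1 ` ?S) = cr_span ((*) ?X ` {1})"
    by (simp only: cr_span_image_mult) simp
  then show ?thesis using em_lin_nonzero[of x] unfolding ideal_equiv_def by (intro exI[of _ 1] exI[of _ ?X]) simp
qed

text \<open>Let l be the line through P and Q and l' its negated conjugate, which vanishes at P + Q.
  From l l' = X1 X2 X3 and the descriptions (X1, l), (X2, l), (X3, l') of the three ideals it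
  follows that X3 times the product of the first two is l times the third.\<close>

lemma point_ideal_add:
  assumes "on_curve E P" "on_curve E Q"
  shows "set_prod (point_ideal P) (point_ideal Q) \<approx> point_ideal (ec_add E P Q)"
proof -
  have one_right: "set_prod S {1} = S" for S :: "'k poly fract alg_closure set"
    by (simp only: set_prod_commute[of S "{1}"] set_prod_one)
  have refl: "S \<approx> S" for S
    unfolding ideal_equiv_def by (intro exI[of _ 1]) simp
  consider "P = Origin" | "Q = Origin"
    | (affine) x1 y1 x2 y2 where "P = Point x1 y1" "Q = Point x2 y2"
    by (cases P; cases Q) auto
  then show ?thesis
  proof cases
    case affine
    note PQ = this
  show ?thesis
  proof (cases "x1 = x2 \<and> y1 + y2 + A1 E * x2 + A3 E = 0")
    case True
    then have "Q = ec_neg E P" using PQ by (auto simp: algebra_simps eq_neg_iff_add_eq_0)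
    then show ?thesis using point_ideal_neg[OF assms(1)] by simp
  next
    case False
    then obtain s c x3 where y1: "y1 = c + s * x1" and y2: "y2 = c + s * x2" and
      cub: "cubic_poly - [:c, s:] ^ 2 - lin_poly * [:c, s:] = [:- x1, 1:] * [:- x2, 1:] * [:- x3, 1:]"
      and add: "ec_add E P Q = Point x3 (- (c + s * x3) - A1 E * x3 - A3 E)"
      and D: "x1 = x2 \<Longrightarrow> 2 * y1 + A1 E * x1 + A3 E \<noteq> 0"
      using ec_add_line[of x1 y1 x2 y2] assms PQ by metis
    let ?X1 = "em [:- x1, 1:]" and ?X2 = "em [:- x2, 1:]" and ?X3 = "em [:- x3, 1:]"
    let ?l = "eta - em [:c, s:]" and ?l' = "eta + em lin_poly + em [:c, s:]"
    have ll: "?X1 * ?X2 * ?X3 = ?l * ?l'"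
    proof (rule eq_if_diff_multiple[OF eta_eq, of _ _ "-1"])
      have "?X1 * ?X2 * ?X3 = em cubic_poly - em [:c, s:] ^ 2 - em lin_poly * em [:c, s:]"
        using cub by (metis em_simps(4,6) em_power)
      show "?X1 * ?X2 * ?X3 - ?l * ?l' = - 1 * (eta ^ 2 + em lin_poly * eta - em cubic_poly)"
        unfolding \<open>?X1 * ?X2 * ?X3 = _\<close> by Groebner_Basis.algebra
    qed
    have span_line: "cr_span (point_ideal (Point x (c + s * x))) = cr_span {em [:- x, 1:], ?l}" for x
    proof -
      have *: "[:c, s:] = [:c + s * x:] + [:s:] * [:- x, 1:]" by simp
      have "eta - em [:c + s * x:] = ?l + em [:s:] * em [:- x, 1:]"
        unfolding * em_simps by simp
      moreover have "?l = (eta - em [:c + s * x:]) - em [:s:] * em [:- x, 1:]"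
        unfolding * em_simps by simp
      ultimately have
        "eta - em [:c + s * x:] \<in> cr_span {em [:- x, 1:], ?l}"
        "?l \<in> cr_span {em [:- x, 1:], eta - em [:c + s * x:]}"
        by (metis cr_span_add cr_span_em_mult cr_span_base insertI1 insertI2,
            metis cr_span_diff cr_span_em_mult cr_span_base insertI1 insertI2)
      then show ?thesis unfolding point_ideal.simps
        by (intro cr_span_eqI) (simp_all add: cr_span_base)
    qed
    have span_sum: "cr_span (point_ideal (ec_add E P Q)) = cr_span {?X3, ?l'}"
    proof -
      let ?y3 = "- (c + s * x3) - A1 E * x3 - A3 E"
      have "lin_poly + [:c, s:] = [:A1 E + s:] * [:- x3, 1:] - [:?y3:]"
        by (simp add: lin_poly_def algebra_simps)
      then have "em lin_poly + em [:c, s:] = em [:A1 E + s:] * ?X3 - em [:?y3:]"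
        by (simp only: em_simps(3,4,6)[symmetric])
      then have **: "?l' = eta - em [:?y3:] + em [:A1 E + s:] * ?X3"
        by (simp only: add.assoc add_diff_eq diff_add_eq)
      then have "eta - em [:?y3:] = ?l' - em [:A1 E + s:] * ?X3" by (simp only: add_diff_cancel_right')
      with ** have "eta - em [:?y3:] \<in> cr_span {?X3, ?l'}"
        "?l' \<in> cr_span {?X3, eta - em [:?y3:]}"
        by (metis cr_span_diff cr_span_em_mult cr_span_base insertI1 insertI2,
            metis cr_span_add cr_span_em_mult cr_span_base insertI1 insertI2)
      then show ?thesis unfolding add point_ideal.simps
        by (intro cr_span_eqI) (simp_all add: cr_span_base)
    qed
    let ?S = "set_prod {?X1, ?l} {?X2, ?l}"
    have "(*) ?X3 ` ?S = (*) ?l ` {?l', ?X1 * ?X3, ?X2 * ?X3, ?l * ?X3}"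
    proof -
      have "(*) ?X3 ` ?S = {?X3 * (?X1 * ?X2), ?X3 * (?X1 * ?l), ?X3 * (?l * ?X2), ?X3 * (?l * ?l)}"
        unfolding set_prod_def by auto
      also have "?X3 * (?X1 * ?X2) = ?l * ?l'" using ll by (simp add: mult_ac)
      finally show ?thesis by (simp add: mult_ac insert_commute)
    qed
    moreover have "cr_span {?l', ?X1 * ?X3, ?X2 * ?X3, ?l * ?X3} = cr_span {?X3, ?l'}"
    proof (rule cr_span_eqI)
      have X3: "?X3 \<in> cr_span {?X3, ?l'}" by (rule cr_span_base) simp
      have "?l * ?X3 \<in> cr_span {?X3, ?l'}"
        unfolding left_diff_distrib using cr_span_diff[OF cr_span_eta_mult[OF X3] cr_span_em_mult[OF X3]] .
      then show "{?l', ?X1 * ?X3, ?X2 * ?X3, ?l * ?X3} \<subseteq> cr_span {?X3, ?l'}"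
        using X3 by (auto intro: cr_span_em_mult cr_span_base)
      let ?T = "cr_span {?l', ?X1 * ?X3, ?X2 * ?X3, ?l * ?X3}"
      have 1: "?X1 * ?X3 \<in> ?T" "?X2 * ?X3 \<in> ?T" "?l * ?X3 \<in> ?T" "?l' \<in> ?T"
        by (auto intro: cr_span_base)
      have "?X3 \<in> ?T"
      proof (cases "x1 = x2")
        case False
        have "?X1 * ?X3 - ?X2 * ?X3 \<in> ?T" using 1 cr_span_diff by blast
        also have "?X1 * ?X3 - ?X2 * ?X3 = em [:x2 - x1:] * ?X3"
          by (simp flip: left_diff_distrib em_simps(4))
        finally show ?thesis by (rule cr_span_unitI) (use False in simp)
      next
        case True
        \<comment> \<open>\<open>?l' - ?l\<close> is a linear polynomial in x. Removing its multiple
          of x - \<open>x1\<close> leaves its value at \<open>x1\<close>, which is nonzero because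
          the tangent at P is not vertical.\<close>
        have "(?X3 * ?l' - ?l * ?X3) - em [:2 * s + A1 E:] * (?X1 * ?X3) \<in> ?T"
          by (rule cr_span_diff[OF cr_span_diff[OF cr_span_em_mult[OF 1(4)] 1(3)]
                cr_span_em_mult[OF 1(1)]])
        also have "(?X3 * ?l' - ?l * ?X3) - em [:2 * s + A1 E:] * (?X1 * ?X3) =
          em (lin_poly + [:c, s:] + [:c, s:] - [:2 * s + A1 E:] * [:- x1, 1:]) * ?X3"
          unfolding em_simps by Groebner_Basis.algebra
        also have "lin_poly + [:c, s:] + [:c, s:] - [:2 * s + A1 E:] * [:- x1, 1:] =
          [:2 * y1 + A1 E * x1 + A3 E:]"
          by (simp add: y1 lin_poly_def algebra_simps)
        finally show ?thesis using D[OF True] cr_span_unitI by blast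
      qed
      with 1 show "{?X3, ?l'} \<subseteq> ?T" by auto
    qed
    moreover have "cr_span (set_prod (point_ideal P) (point_ideal Q)) = cr_span ?S"
    proof -
      have P: "cr_span (point_ideal P) = cr_span {?X1, ?l}"
        and Q: "cr_span (point_ideal Q) = cr_span {?X2, ?l}"
        using span_line[of x1] span_line[of x2] y1 y2 PQ by simp_all
      have "cr_span (set_prod (point_ideal P) (point_ideal Q)) =
          cr_span (set_prod {?X1, ?l} (point_ideal Q))"
        using P by (intro equalityI cr_span_set_prod_subset) simp_all
      also have "\<dots> = cr_span ?S"
        using Q unfolding set_prod_commute[of "{?X1, ?l}"]
        by (intro equalityI cr_span_set_prod_subset) simp_all
      finally show ?thesis .
    qed
    ultimately have "cr_span ((*) ?X3 ` set_prod (point_ideal P) (point_ideal Q))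
        = cr_span ((*) ?l ` point_ideal (ec_add E P Q))"
      using span_sum by (metis cr_span_image_mult)
    moreover have "?l \<noteq> 0" using cr_rep_eq_0_iff[of "(- [:c, s:], 1)"]
      by (simp add: em_simps(2,5) del: minus_pCons)
    ultimately show ?thesis unfolding ideal_equiv_def using em_lin_nonzero by blast
  qed
qed (simp_all add: set_prod_one one_right refl)
qed

text \<open>A nonzero function with a zero is not constant, and nonconstant functions have pole
  order at least 2 at infinity.\<close>

lemma cr_rep_principal_degrees:
  assumes "cr_eval x y u = 0" "u \<noteq> (0, 0)"
  shows "degree (cr_norm u) \<ge> 2"
    and "degree (cr_norm u) = 2 \<Longrightarrow> \<exists>a. a \<noteq> 0 \<and> u = ([:- a * x, a:], 0)"
proof -
  obtain f g where u: "u = (f, g)" by (cases u)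
  have 0: "degree f \<noteq> 0" if "g = 0"
  proof
    assume "degree f = 0"
    then obtain a where "f = [:a:]" by (auto elim: degree_eq_zeroE)
    with that u assms show False by simp
  qed
  then show "degree (cr_norm u) \<ge> 2"
    unfolding u degree_cr_norm by auto
  assume deg: "degree (cr_norm u) = 2"
  then have g: "g = 0" unfolding u degree_cr_norm by (auto split: if_splits)
  with deg have "degree f = 1" unfolding u degree_cr_norm by simp
  then obtain b a where f: "f = [:b, a:]" "a \<noteq> 0"
    using degree1_coeffs by blast
  with assms g u have "b + x * a = 0" by simp
  then have "b = - a * x" by (simp add: add_eq_0_iff2 mult.commute)
  with f g u show "\<exists>a. a \<noteq> 0 \<and> u = ([:- a * x, a:], 0)" by blast
qed

lemma degree_cr_norm_neq_1: "degree (cr_norm u) \<noteq> 1"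
  by (cases u) (auto simp: degree_cr_norm simp del: cr_norm.simps)

lemma degree_cr_norm_mult:
  assumes "cr_rep w = cr_rep u * cr_rep v" "w \<noteq> (0, 0)"
  shows "degree (cr_norm w) = degree (cr_norm u) + degree (cr_norm v)"
proof -
  have w: "w = cr_mult u v" using assms(1) by (simp only: cr_rep_mult[symmetric] cr_rep_inject)
  with assms(2) have "cr_norm u \<noteq> 0" "cr_norm v \<noteq> 0"
    using cr_norm_eq_0_iff[of w] by (auto simp: cr_norm_mult simp del: cr_norm.simps)
  then show ?thesis unfolding w by (simp only: cr_norm_mult degree_mult_eq simp_thms)
qed

lemma cr_rep_linear: "em [:- x, 1:] = cr_rep ([:- x, 1:], 0)"
  "eta - em [:y:] = cr_rep (- [:y:], 1)"
  by (simp_all add: em_simps(1,2,5) del: minus_pCons)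

text \<open>A generator u would divide x - x(P), of degree 2, and y - y(P), of degree 3. Since u
  vanishes at P its degree is at least 2, hence equal to 2, and the second cofactor would have the
  impossible degree 1.\<close>

lemma point_ideal_equiv_Origin:
  assumes "on_curve E P" "point_ideal P \<approx> {1}"
  shows "P = Origin"
proof (rule ccontr)
  assume "P \<noteq> Origin"
  then obtain x y where P: "P = Point x y" by (cases P) auto
  obtain a b where ab: "a \<noteq> 0" "b \<noteq> 0" "(*) a ` cr_span (point_ideal P) = (*) b ` cr_span {1}"
    using assms(2) unfolding ideal_equiv_def cr_span_image_mult by blast
  have one: "1 \<in> cr_span {1}" by (simp add: cr_span_base)
  then have "b \<in> (*) a ` cr_span (point_ideal P)"
    unfolding ab(3) by (rule image_eqI[rotated]) simp
  then obtain w where w: "w \<in> cr_span (point_ideal P)" "b = a * w" by auto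
  then obtain u where u: "w = cr_rep u" "cr_eval x y u = 0"
    using cr_span_point_ideal[of x y w] assms(1) P by blast
  have u0: "u \<noteq> (0, 0)" using w u ab by (auto simp: em_simps)
  have mult: "\<exists>v. z = cr_rep u * cr_rep v" if "z \<in> point_ideal P" for z
  proof -
    have "a * z \<in> (*) b ` cr_span {1}"
      unfolding ab(3)[symmetric] using that by (intro imageI cr_span_base)
    then obtain r where r: "r \<in> cr_span {1}" "a * z = b * r" by auto
    from r(1) have "\<exists>v. r = cr_rep v"
    proof induction
      case zero
      show ?case by (rule exI[of _ "(0, 0)"]) (simp add: em_simps)
    next
      case (add_mult z s u)
      then obtain v where v: "z = cr_rep v" "s = 1" by auto
      obtain f g f' g' where fg: "u = (f, g)" "v = (f', g')" by (cases u; cases v)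
      have "cr_rep u * s + z = cr_rep (f + f', g + g')"
        unfolding v fg mult_1_right cr_rep_add ..
      then show ?case by (rule exI)
    qed
    then obtain v where v: "r = cr_rep v" ..
    have "a * z = a * (cr_rep u * cr_rep v)"
      using r(2) unfolding w(2) u(1) v by (simp only: mult.assoc)
    then have "z = cr_rep u * cr_rep v" using ab(1) by simp
    then show ?thesis by (rule exI)
  qed
  have "em [:- x, 1:] \<in> point_ideal P" "eta - em [:y:] \<in> point_ideal P"
    by (simp_all only: P point_ideal.simps insert_iff simp_thms)
  then obtain v v' where v: "cr_rep ([:- x, 1:], 0) = cr_rep u * cr_rep v"
    and v': "cr_rep (- [:y:], 1) = cr_rep u * cr_rep v'"
    unfolding cr_rep_linear using mult by metis
  have "degree (cr_norm ([:- x, 1:], 0)) = degree (cr_norm u) + degree (cr_norm v)"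
    using v by (rule degree_cr_norm_mult) simp
  moreover have "degree (cr_norm (- [:y:], 1)) = degree (cr_norm u) + degree (cr_norm v')"
    using v' by (rule degree_cr_norm_mult) simp
  ultimately have "degree (cr_norm u) + degree (cr_norm v) = 2"
    "degree (cr_norm u) + degree (cr_norm v') = 3"
    unfolding degree_cr_norm by (simp_all del: cr_norm.simps)
  with cr_rep_principal_degrees(1)[OF u(2) u0] degree_cr_norm_neq_1[of v'] show False by linarith
qed

lemma ec_add_eq_OriginD:
  assumes "ec_add E P Q = Origin"
  shows "Q = ec_neg E P"
proof (cases P; cases Q)
  fix x1 y1 x2 y2 assume PQ: "P = Point x1 y1" "Q = Point x2 y2"
  have "x1 = x2 \<and> y1 + y2 + A1 E * x2 + A3 E = 0"
  proof (rule ccontr)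
    assume "\<not> ?thesis"
    then have "ec_add E P Q \<noteq> Origin"
      by (simp only: PQ ec_add.simps if_False Let_def ec_point.distinct not_False_eq_True)
    with assms show False by simp
  qed
  then show ?thesis using PQ by (auto simp: algebra_simps eq_neg_iff_add_eq_0)
qed (use assms in auto)

text \<open>Multiplying by the class of -Q shows that P - Q has the trivial class, so it is
  \<open>Origin\<close>. Group laws can thus be read off from the commutative and associative
  product of ideals.\<close>

lemma ec_point_eqI:
  assumes "on_curve E P" "on_curve E Q" "point_ideal P \<approx> point_ideal Q"
  shows "P = Q"
proof -
  let ?n = "ec_neg E Q"
  have "point_ideal (ec_add E P ?n) \<approx> set_prod (point_ideal P) (point_ideal ?n)"
    using assms by (intro ideal_equiv_sym[OF point_ideal_add]) simp_all
  also have "\<dots> \<approx> set_prod (point_ideal Q) (point_ideal ?n)"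
    using assms(3) by (rule ideal_equiv_set_prod)
  also have "\<dots> \<approx> {1}"
    using assms(2) by (rule point_ideal_neg)
  finally have "point_ideal (ec_add E P ?n) \<approx> {1}" .
  then have "ec_add E P ?n = Origin"
    using assms by (intro point_ideal_equiv_Origin on_curve_add) simp_all
  then have "?n = ec_neg E P" by (rule ec_add_eq_OriginD)
  then show ?thesis by simp
qed

theorem ec_add_commute:
  assumes "on_curve E P" "on_curve E Q"
  shows "ec_add E P Q = ec_add E Q P"
proof (rule ec_point_eqI)
  show "point_ideal (ec_add E P Q) \<approx> point_ideal (ec_add E Q P)"
    using point_ideal_add[OF assms] point_ideal_add[OF assms(2,1)]
    by (metis ideal_equiv_sym ideal_equiv_trans set_prod_commute)
qed (use assms on_curve_add in auto)

theorem ec_add_assoc: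
  assumes "on_curve E P" "on_curve E Q" "on_curve E S"
  shows "ec_add E (ec_add E P Q) S = ec_add E P (ec_add E Q S)"
proof (rule ec_point_eqI)
  have "point_ideal (ec_add E (ec_add E P Q) S) \<approx>
      set_prod (point_ideal (ec_add E P Q)) (point_ideal S)"
    using assms by (intro ideal_equiv_sym[OF point_ideal_add] on_curve_add)
  also have "\<dots> \<approx> set_prod (set_prod (point_ideal P) (point_ideal Q)) (point_ideal S)"
    using assms by (intro ideal_equiv_set_prod ideal_equiv_sym[OF point_ideal_add])
  also have "set_prod (set_prod (point_ideal P) (point_ideal Q)) (point_ideal S)
      \<approx> set_prod (point_ideal (ec_add E Q S)) (point_ideal P)"
    unfolding set_prod_assoc unfolding
      set_prod_commute[of "point_ideal P" "set_prod (point_ideal Q) (point_ideal S)"]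
    using assms by (intro ideal_equiv_set_prod point_ideal_add)
  also have "\<dots> \<approx> point_ideal (ec_add E P (ec_add E Q S))"
    unfolding set_prod_commute[of _ "point_ideal P"]
    using assms by (intro point_ideal_add on_curve_add)
  finally
  show "point_ideal (ec_add E (ec_add E P Q) S) \<approx> point_ideal (ec_add E P (ec_add E Q S))" .
qed (use assms on_curve_add in auto)

section \<open>The abelian group of points\<close>

definition ec_group :: "'k ec_point monoid" where
  "ec_group = \<lparr>carrier = {P. on_curve E P}, monoid.mult = ec_add E, one = Origin\<rparr>"

lemma ec_group_simps [simp]:
  "carrier ec_group = {P. on_curve E P}" "P \<otimes>\<^bsub>ec_group\<^esub> Q = ec_add E P Q" "\<one>\<^bsub>ec_group\<^esub> = Origin"
  by (simp_all add: ec_group_def)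

lemma comm_group_ec_group: "comm_group ec_group"
proof (rule comm_groupI)
  fix P assume "P \<in> carrier ec_group"
  then show "\<exists>Q\<in>carrier ec_group. Q \<otimes>\<^bsub>ec_group\<^esub> P = \<one>\<^bsub>ec_group\<^esub>"
    by (intro bexI[of _ "ec_neg E P"]) (simp_all add: ec_add_commute)
next
  fix P Q assume "P \<in> carrier ec_group" "Q \<in> carrier ec_group"
  then show "P \<otimes>\<^bsub>ec_group\<^esub> Q = Q \<otimes>\<^bsub>ec_group\<^esub> P" by (simp add: ec_add_commute)
qed (simp_all add: on_curve_add ec_add_assoc)

sublocale ec: comm_group ec_group
  by (rule comm_group_ec_group)

lemma inv_ec_group [simp]: "on_curve E P \<Longrightarrow> inv\<^bsub>ec_group\<^esub> P = ec_neg E P"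
  by (intro ec.inv_equality) (simp_all add: ec_add_commute)

lemma ec_mult_eq_pow:
  assumes "on_curve E P"
  shows "ec_mult E n P = P [^]\<^bsub>ec_group\<^esub> n"
proof -
  have "(ec_add E P ^^ k) Origin = P [^]\<^bsub>ec_group\<^esub> k" for k
  proof (induction k)
    case (Suc k)
    then show ?case
      using ec_add_commute[OF assms, of "P [^]\<^bsub>ec_group\<^esub> k"] ec.nat_pow_closed[of P k] assms by simp
  qed simp
  moreover have "inv\<^bsub>ec_group\<^esub> (P [^]\<^bsub>ec_group\<^esub> k) = ec_neg E (P [^]\<^bsub>ec_group\<^esub> k)" for k :: nat
    using ec.nat_pow_closed[of P k] assms by (intro inv_ec_group) simp
  ultimately show ?thesis
    using assms by (cases n rule: int_cases2)
      (auto simp: ec_mult_def Let_def int_pow_int ec.int_pow_neg_int simp del: inv_ec_group)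
qed

end

section \<open>Sums and products of abscissae\<close>

text \<open>Homogeneous coordinates (S : Z) of a point of the projective line; both clauses exclude
  (0 : 0).\<close>

fun has_x :: "'c :: field P1 \<Rightarrow> 'c \<Rightarrow> 'c \<Rightarrow> bool" where
  "has_x Infinity S Z \<longleftrightarrow> Z = 0 \<and> S \<noteq> 0"
| "has_x (Affine t) S Z \<longleftrightarrow> Z \<noteq> 0 \<and> S = t * Z"

lemma has_x_nonzero: "has_x p S Z \<Longrightarrow> S \<noteq> 0 \<or> Z \<noteq> 0"
  by (cases p) auto

lemma has_x_scale: "c \<noteq> 0 \<Longrightarrow> has_x p (c * S) (c * Z) \<longleftrightarrow> has_x p S Z"
  by (cases p) auto

lemma has_x_proportional:
  assumes "has_x p S Z" "has_x p S' Z'"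
  obtains c where "c \<noteq> 0" "S' = c * S" "Z' = c * Z"
proof (cases p)
  case (Affine t)
  show ?thesis by (rule that[of "Z' / Z"]) (use assms Affine in auto)
next
  case Infinity
  show ?thesis by (rule that[of "S' / S"]) (use assms Infinity in auto)
qed

text \<open>This and the next three are the classical quantities b2, b4, b6, b8 attached to a
  Weierstrass equation.\<close>

definition inv_b2 :: "'c :: field weierstrass \<Rightarrow> 'c" where
  "inv_b2 E = A1 E ^ 2 + 4 * A2 E"
definition inv_b4 :: "'c :: field weierstrass \<Rightarrow> 'c" where
  "inv_b4 E = 2 * A4 E + A1 E * A3 E"
definition inv_b6 :: "'c :: field weierstrass \<Rightarrow> 'c" where
  "inv_b6 E = A3 E ^ 2 + 4 * A6 E"
definition inv_b8 :: "'c :: field weierstrass \<Rightarrow> 'c" where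
  "inv_b8 E = A1 E ^ 2 * A6 E + 4 * A2 E * A6 E - A1 E * A3 E * A4 E + A2 E * A3 E ^ 2 - A4 E ^ 2"

text \<open>
  If \<open>(S : Z)\<close> is the abscissa of \<open>Q\<close> and \<open>x\<close> that of \<open>P\<close>, then the three forms below are
  proportional to \<open>1\<close>, the sum and the product of the abscissae of \<open>Q + P\<close> and \<open>Q - P\<close>.
\<close>
definition kum0 :: "'c :: comm_ring_1 \<Rightarrow> 'c \<Rightarrow> 'c \<Rightarrow> 'c" where
  "kum0 S Z x = (S - x * Z) ^ 2"
definition kum1 :: "'c :: comm_ring_1 \<Rightarrow> 'c \<Rightarrow> 'c \<Rightarrow> 'c \<Rightarrow> 'c \<Rightarrow> 'c \<Rightarrow> 'c" where
  "kum1 b2 b4 b6 S Z x = 2 * x * S * (S + x * Z) + b2 * x * S * Z + b4 * (S + x * Z) * Z + b6 * Z ^ 2"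
definition kum2 :: "'c :: comm_ring_1 \<Rightarrow> 'c \<Rightarrow> 'c \<Rightarrow> 'c \<Rightarrow> 'c \<Rightarrow> 'c \<Rightarrow> 'c" where
  "kum2 b4 b6 b8 S Z x = x ^ 2 * S ^ 2 - b4 * x * S * Z - b6 * (S + x * Z) * Z - b8 * Z ^ 2"

context smooth_weierstrass
begin

abbreviation "k1 \<equiv> kum1 (inv_b2 E) (inv_b4 E) (inv_b6 E)"
abbreviation "k2 \<equiv> kum2 (inv_b4 E) (inv_b6 E) (inv_b8 E)"

text \<open>The first bracket is (x - x2)^2 x(Q + P) by the chord formula, and passing to
  \<open>y'\<close> replaces P by -P. The sum is unchanged when P or Q is negated, so the curve
  equations remove both ordinates.\<close>

lemma kummer_sum:
  assumes "on_curve E (Point x y)" "on_curve E (Point x2 y2)"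
  defines "y' \<equiv> - y - A1 E * x - A3 E"
  shows "((y - y2) ^ 2 + A1 E * (y - y2) * (x - x2) - (A2 E + x + x2) * (x - x2) ^ 2)
    + ((y' - y2) ^ 2 + A1 E * (y' - y2) * (x - x2) - (A2 E + x + x2) * (x - x2) ^ 2) = k1 x2 1 x"
    (is "?l = ?r")
proof -
  have P: "y ^ 2 + A1 E * x * y + A3 E * y = x ^ 3 + A2 E * x ^ 2 + A4 E * x + A6 E"
    and Q: "y2 ^ 2 + A1 E * x2 * y2 + A3 E * y2 = x2 ^ 3 + A2 E * x2 ^ 2 + A4 E * x2 + A6 E"
    using assms by simp_all
  have "?l - ?r = 2 * (y ^ 2 + A1 E * x * y + A3 E * y - (x ^ 3 + A2 E * x ^ 2 + A4 E * x + A6 E))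
     + 2 * (y2 ^ 2 + A1 E * x2 * y2 + A3 E * y2 - (x2 ^ 3 + A2 E * x2 ^ 2 + A4 E * x2 + A6 E))"
    unfolding y'_def kum1_def inv_b2_def inv_b4_def inv_b6_def
    by (simp add: algebra_simps power2_eq_square power3_eq_cube)
  then show ?thesis using P Q by simp
qed

lemma kummer_prod:
  assumes "on_curve E (Point x y)" "on_curve E (Point x2 y2)"
  defines "y' \<equiv> - y - A1 E * x - A3 E"
  shows "((y - y2) ^ 2 + A1 E * (y - y2) * (x - x2) - (A2 E + x + x2) * (x - x2) ^ 2)
    * ((y' - y2) ^ 2 + A1 E * (y' - y2) * (x - x2) - (A2 E + x + x2) * (x - x2) ^ 2)
    = (x - x2) ^ 2 * k2 x2 1 x"
proof -
  have P: "y ^ 2 + A1 E * x * y + A3 E * y = x ^ 3 + A2 E * x ^ 2 + A4 E * x + A6 E"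
    and Q: "y2 ^ 2 + A1 E * x2 * y2 + A3 E * y2 = x2 ^ 3 + A2 E * x2 ^ 2 + A4 E * x2 + A6 E"
    using assms by simp_all
  define D M p s where "D = x - x2" and "M = A2 E + x + x2"
    and "p = (y - y2) * (y' - y2)" and "s = (y - y2) + (y' - y2)"
  \<comment> \<open>\<open>h\<close> is the difference quotient of the cubic at \<open>x\<close> and
    \<open>x2\<close>. As \<open>p\<close> is the value at \<open>y2\<close> of the quadratic with
    roots \<open>y\<close> and \<open>y'\<close>, the two curve equations give it the factor
    \<open>D\<close>.\<close>
  define h where "h = x ^ 2 + x * x2 + x2 ^ 2 + A2 E * (x + x2) + A4 E"
  have s: "s = - (A1 E * x + A3 E) - 2 * y2"
    by (simp add: s_def y'_def)
  have "p - D * (A1 E * y2 - h) =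
    - (y ^ 2 + A1 E * x * y + A3 E * y - (x ^ 3 + A2 E * x ^ 2 + A4 E * x + A6 E))
    + (y2 ^ 2 + A1 E * x2 * y2 + A3 E * y2 - (x2 ^ 3 + A2 E * x2 ^ 2 + A4 E * x2 + A6 E))"
    unfolding p_def y'_def D_def h_def by (simp add: algebra_simps power2_eq_square power3_eq_cube)
  then have p: "p = D * (A1 E * y2 - h)" using P Q by simp
  have "((y - y2) ^ 2 + A1 E * (y - y2) * D - M * D ^ 2) * ((y' - y2) ^ 2 + A1 E * (y' - y2) * D - M * D ^ 2)
    = p ^ 2 + A1 E * D * p * s + A1 E ^ 2 * D ^ 2 * p - M * D ^ 2 * (s ^ 2 - 2 * p) - A1 E * D * M * D ^ 2 * s
      + M ^ 2 * D ^ 4"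
    unfolding p_def s_def by (simp add: algebra_simps power2_eq_square power4_eq_xxxx)
  also have "\<dots> = D ^ 2 * ((A1 E * y2 - h) ^ 2 + A1 E * (A1 E * y2 - h) * s + A1 E ^ 2 * D * (A1 E * y2 - h)
      - M * (s ^ 2 - 2 * (D * (A1 E * y2 - h))) - A1 E * D * M * s + M ^ 2 * D ^ 2)"
    unfolding p by (simp add: algebra_simps power2_eq_square power4_eq_xxxx)
  also have "(A1 E * y2 - h) ^ 2 + A1 E * (A1 E * y2 - h) * s + A1 E ^ 2 * D * (A1 E * y2 - h)
      - M * (s ^ 2 - 2 * (D * (A1 E * y2 - h))) - A1 E * D * M * s + M ^ 2 * D ^ 2 = k2 x2 1 x"
  proof (rule eq_if_diff_multiple[OF Q, of _ _ "- (A1 E ^ 2) - 4 * M"])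
    show "(A1 E * y2 - h) ^ 2 + A1 E * (A1 E * y2 - h) * s + A1 E ^ 2 * D * (A1 E * y2 - h)
      - M * (s ^ 2 - 2 * (D * (A1 E * y2 - h))) - A1 E * D * M * s + M ^ 2 * D ^ 2 - k2 x2 1 x
      = (- (A1 E ^ 2) - 4 * M) *
        (y2 ^ 2 + A1 E * x2 * y2 + A3 E * y2 - (x2 ^ 3 + A2 E * x2 ^ 2 + A4 E * x2 + A6 E))"
      unfolding kum2_def inv_b4_def inv_b6_def inv_b8_def s h_def M_def D_def
      by (simp add: algebra_simps power2_eq_square power3_eq_cube)
  qed
  finally show ?thesis unfolding D_def M_def .
qed

text \<open>The degenerate case Q = P: the values are the denominator and the numerator of x(2P) in
  the tangent formula.\<close>

lemma kummer_double:
  assumes "on_curve E (Point x y)"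
  shows "k1 x 1 x = (2 * y + A1 E * x + A3 E) ^ 2"
    and "k2 x 1 x = (3 * x ^ 2 + 2 * A2 E * x + A4 E - A1 E * y) ^ 2
      + A1 E * (3 * x ^ 2 + 2 * A2 E * x + A4 E - A1 E * y) * (2 * y + A1 E * x + A3 E)
      - (A2 E + 2 * x) * (2 * y + A1 E * x + A3 E) ^ 2"
proof -
  have P: "y ^ 2 + A1 E * x * y + A3 E * y = x ^ 3 + A2 E * x ^ 2 + A4 E * x + A6 E"
    using assms by simp
  show "k1 x 1 x = (2 * y + A1 E * x + A3 E) ^ 2"
    by (rule eq_if_diff_multiple[OF P, of _ _ "- 4"])
      (simp add: kum1_def inv_b2_def inv_b4_def inv_b6_def algebra_simps power2_eq_square power3_eq_cube)
  show "k2 x 1 x = (3 * x ^ 2 + 2 * A2 E * x + A4 E - A1 E * y) ^ 2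
      + A1 E * (3 * x ^ 2 + 2 * A2 E * x + A4 E - A1 E * y) * (2 * y + A1 E * x + A3 E)
      - (A2 E + 2 * x) * (2 * y + A1 E * x + A3 E) ^ 2"
    by (rule eq_if_diff_multiple[OF P, of _ _ "A1 E ^ 2 + 4 * A2 E + 8 * x"])
      (simp add: kum2_def inv_b4_def inv_b6_def inv_b8_def algebra_simps power2_eq_square power3_eq_cube)
qed

lemma slope_clear:
  fixes D t a b u v :: 'k
  shows "D ^ 2 * (t ^ 2 + a * t - b - u - v) = (D * t) ^ 2 + a * (D * t) * D - (b + v + u) * D ^ 2"
  by (simp add: algebra_simps power2_eq_square)

lemma kum_scale:
  "kum0 (x2 * Z) Z x = Z ^ 2 * kum0 x2 1 x"
  "kum1 b2 b4 b6 (x2 * Z) Z x = Z ^ 2 * kum1 b2 b4 b6 x2 1 x"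
  "kum2 b4 b6 b8 (x2 * Z) Z x = Z ^ 2 * kum2 b4 b6 b8 x2 1 x"
  unfolding kum0_def kum1_def kum2_def by (simp_all add: algebra_simps power2_eq_square)

lemma kummer:
  assumes P: "on_curve E (Point x y)" and Q: "on_curve E Q" and S: "has_x (x_coord Q) S Z"
  obtains c Xp Zp Xm Zm where "c \<noteq> 0"
    "has_x (x_coord (ec_add E Q (Point x y))) Xp Zp"
    "has_x (x_coord (ec_add E Q (ec_neg E (Point x y)))) Xm Zm"
    "kum0 S Z x = c * (Zm * Zp)" "k1 S Z x = c * (Xm * Zp + Xp * Zm)" "k2 S Z x = c * (Xm * Xp)"
proof (cases Q)
  case Origin
  with S have Z: "Z = 0" "S \<noteq> 0" by auto
  show ?thesis
    by (rule that[of "S ^ 2" x 1 x 1])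
      (use Z Origin in \<open>simp_all add: kum0_def kum1_def kum2_def power2_eq_square algebra_simps\<close>)
next
  case (Point x2 y2)
  with S have Z: "Z \<noteq> 0" "S = x2 * Z" by auto
  define y' where "y' = - y - A1 E * x - A3 E"
  have neg: "ec_neg E (Point x y) = Point x y'" by (simp add: y'_def)
  show ?thesis
  proof (cases "x = x2")
    case False
    define xp where "xp = ((y - y2) / (x - x2)) ^ 2 + A1 E * ((y - y2) / (x - x2)) - A2 E - x2 - x"
    define xm where "xm = ((y' - y2) / (x - x2)) ^ 2 + A1 E * ((y' - y2) / (x - x2)) - A2 E - x2 - x"
    have D: "x - x2 \<noteq> 0" using False by simp
    have xc: "x_coord (ec_add E Q (Point x y)) = Affine xp"
      "x_coord (ec_add E Q (Point x y')) = Affine xm"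
      using False unfolding Point by (simp_all add: Let_def xp_def xm_def)
    have xp: "(x - x2) ^ 2 * xp =
        (y - y2) ^ 2 + A1 E * (y - y2) * (x - x2) - (A2 E + x + x2) * (x - x2) ^ 2"
      unfolding xp_def slope_clear using D by simp
    have xm: "(x - x2) ^ 2 * xm =
        (y' - y2) ^ 2 + A1 E * (y' - y2) * (x - x2) - (A2 E + x + x2) * (x - x2) ^ 2"
      unfolding xm_def slope_clear using D by simp
    have sum: "k1 x2 1 x = (x - x2) ^ 2 * xp + (x - x2) ^ 2 * xm"
      unfolding xp xm using kummer_sum[OF P Q[unfolded Point]] by (simp only: y'_def)
    have "(x - x2) ^ 2 * k2 x2 1 x = ((x - x2) ^ 2 * xp) * ((x - x2) ^ 2 * xm)"
      unfolding xp xm using kummer_prod[OF P Q[unfolded Point]] by (simp only: y'_def)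
    then have prod: "k2 x2 1 x = xp * ((x - x2) ^ 2 * xm)"
      using D by simp
    have kum0: "kum0 x2 1 x = (x - x2) ^ 2"
      by (simp add: kum0_def power2_eq_square algebra_simps)
    show ?thesis
      by (rule that[of "Z ^ 2 * (x - x2) ^ 2" xp 1 xm 1])
        (use Z D xc in \<open>simp_all add: neg kum_scale kum0 sum prod del: ec_neg.simps\<close>,
         simp_all add: algebra_simps)
  next
    case True
    define D where "D = 2 * y + A1 E * x + A3 E"
    define n where "n = 3 * x ^ 2 + 2 * A2 E * x + A4 E - A1 E * y"
    have kum0: "kum0 x2 1 x = 0" using True by (simp add: kum0_def)
    have k1: "k1 x2 1 x = D ^ 2" and k2: "k2 x2 1 x = n ^ 2 + A1 E * n * D - (A2 E + x + x) * D ^ 2"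
      using kummer_double[OF P] True by (simp_all add: D_def n_def add.assoc)
    have Dy: "D = y - y'" by (simp add: D_def y'_def)
    have Q': "y2 = y \<or> y2 = y'"
      using same_x_cases[of x y y2] P Q Point True
      by (auto simp: y'_def algebra_simps eq_neg_iff_add_eq_0)
    show ?thesis
    proof (cases "D = 0")
      \<comment> \<open>Here Q = P = -P, both sums are \<open>Origin\<close>, and only
        \<open>k2\<close>, equal to \<open>n ^ 2\<close> up to scaling, survives; it is nonzero by
        smoothness.\<close>
      case D0: True
      then have n0: "n \<noteq> 0" using nonsingular[OF P] unfolding singular_at_def D_def n_def by auto
      have QP: "Q = Point x y" and yy: "y = y'" using Q' Dy D0 True Point by auto
      then have "Q = ec_neg E (Point x y)" using neg by simp
      then have O: "ec_add E Q (Point x y) = Origin" "ec_add E Q (ec_neg E (Point x y)) = Origin"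
        using QP by (metis ec_add_neg_right ec_neg_ec_neg, metis ec_add_neg_right)
      show ?thesis
        by (rule that[of "Z ^ 2" "n ^ 2" 0 1 0])
          (use Z n0 O in \<open>simp_all add: kum_scale kum0 k1 k2 D0 del: ec_neg.simps ec_add.simps\<close>)
    next
      case D0: False
      define xd where "xd = (n / D) ^ 2 + A1 E * (n / D) - A2 E - x - x"
      have xd: "D ^ 2 * xd = k2 x2 1 x"
        unfolding xd_def slope_clear k2 using D0 by (simp add: add.assoc)
      have double: "x_coord (ec_add E (Point x y) (Point x y)) = Affine xd"
      proof -
        have "y + y + A1 E * x + A3 E \<noteq> 0" using D0 unfolding D_def mult_2 .
        then show ?thesis by (simp add: Let_def xd_def n_def D_def)
      qed
      have double': "x_coord (ec_add E (Point x y') (Point x y')) = Affine xd"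
      proof -
        have "ec_add E (ec_neg E (Point x y)) (ec_neg E (Point x y)) =
            ec_neg E (ec_add E (Point x y) (Point x y))"
          using P ec.inv_mult_group[of "Point x y" "Point x y"]
          by (simp add: on_curve_add del: on_curve.simps ec_neg.simps ec_add.simps)
        then have "x_coord (ec_add E (Point x y') (Point x y')) =
            x_coord (ec_neg E (ec_add E (Point x y) (Point x y)))"
          unfolding neg by simp
        also have "x_coord (ec_neg E R) = x_coord R" for R by (cases R) auto
        finally show ?thesis using double by simp
      qed
      from Q' show ?thesis
      proof
        assume "y2 = y"
        with True Point have Q: "Q = Point x y" by simp
        show ?thesis
        proof (rule that[of "Z ^ 2" "D ^ 2 * xd" "D ^ 2" 1 0])
          show "has_x (x_coord (ec_add E Q (Point x y))) (D ^ 2 * xd) (D ^ 2)"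
            unfolding Q double using D0 by simp
          show "has_x (x_coord (ec_add E Q (ec_neg E (Point x y)))) 1 0"
            unfolding Q ec_add_neg_right by simp
        qed (use Z in \<open>simp_all add: kum_scale kum0 k1 xd\<close>)
      next
        assume "y2 = y'"
        with True Point neg have Q: "Q = ec_neg E (Point x y)" by simp
        show ?thesis
        proof (rule that[of "Z ^ 2" 1 0 "D ^ 2 * xd" "D ^ 2"])
          show "has_x (x_coord (ec_add E Q (Point x y))) 1 0"
            unfolding Q by (metis ec_add_neg_right ec_neg_ec_neg has_x.simps(1) x_coord.simps(1) one_neq_zero)
          show "has_x (x_coord (ec_add E Q (ec_neg E (Point x y)))) (D ^ 2 * xd) (D ^ 2)"
            unfolding Q neg double' using D0 by simp
        qed (use Z in \<open>simp_all add: kum_scale kum0 k1 xd\<close>)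
      qed
    qed
  qed
qed

lemma kummer_relation:
  assumes "on_curve E (Point x y)" "on_curve E Q" "has_x (x_coord Q) S Z"
    "has_x (x_coord (ec_add E Q (ec_neg E (Point x y)))) U V"
  shows "kum0 S Z x * U ^ 2 - k1 S Z x * U * V + k2 S Z x * V ^ 2 = 0"
proof -
  obtain c Xp Zp Xm Zm where *: "has_x (x_coord (ec_add E Q (ec_neg E (Point x y)))) Xm Zm"
    "kum0 S Z x = c * (Zm * Zp)" "k1 S Z x = c * (Xm * Zp + Xp * Zm)" "k2 S Z x = c * (Xm * Xp)"
    using kummer[OF assms(1-3)] by metis
  obtain e where e: "U = e * Xm" "V = e * Zm"
    using has_x_proportional[OF *(1) assms(4)] .
  show ?thesis unfolding * e by (simp add: algebra_simps power2_eq_square)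
qed

text \<open>Cancellation of a linear factor of a binary form: \<open>a\<close> and \<open>b\<close>
  measure the discrepancy between the proposed and the true second factor, and their product with
  the nonzero factor of Q - P vanishes.\<close>

lemma kummer_step:
  assumes "on_curve E (Point x y)" "on_curve E Q" "has_x (x_coord Q) S Z"
    "has_x (x_coord (ec_add E Q (ec_neg E (Point x y)))) U V"
    "kum0 S Z x = V * V'" "k1 S Z x = U * V' + U' * V" "k2 S Z x = U * U'"
  shows "has_x (x_coord (ec_add E Q (Point x y))) U' V'"
proof -
  obtain c Xp Zp Xm Zm where *: "c \<noteq> 0"
    "has_x (x_coord (ec_add E Q (Point x y))) Xp Zp"
    "has_x (x_coord (ec_add E Q (ec_neg E (Point x y)))) Xm Zm"
    "kum0 S Z x = c * (Zm * Zp)" "k1 S Z x = c * (Xm * Zp + Xp * Zm)" "k2 S Z x = c * (Xm * Xp)"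
    using kummer[OF assms(1-3)] by metis
  obtain e where e: "e \<noteq> 0" "U = e * Xm" "V = e * Zm"
    using has_x_proportional[OF *(3) assms(4)] .
  define a b where "a = e * V' - c * Zp" and "b = e * U' - c * Xp"
  have "Zm * a = V * V' - c * (Zm * Zp)" unfolding a_def e by (simp add: algebra_simps)
  then have "Zm * a = 0" using assms(5) * by simp
  moreover have "Xm * a + b * Zm = U * V' + U' * V - c * (Xm * Zp + Xp * Zm)"
    unfolding a_def b_def e by (simp add: algebra_simps)
  then have "Xm * a + b * Zm = 0" using assms(6) * by simp
  moreover have "Xm * b = U * U' - c * (Xm * Xp)" unfolding b_def e by (simp add: algebra_simps)
  then have "Xm * b = 0" using assms(7) * by simp
  ultimately have "a = 0 \<and> b = 0" using has_x_nonzero[OF *(3)] by auto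
  then have "e * V' = c * Zp" "e * U' = c * Xp" by (simp_all add: a_def b_def)
  then have "has_x (x_coord (ec_add E Q (Point x y))) (e * U') (e * V')"
    using has_x_scale[OF *(1)] *(2) by metis
  then show ?thesis using has_x_scale[OF e(1)] by blast
qed

end

section \<open>The polynomials of the Lattes maps\<close>

lemma infinite_UNIV_alg_closed: "infinite (UNIV :: 'c :: alg_closed_field set)"
proof
  assume fin: "finite (UNIV :: 'c set)"
  define p :: "'c poly" where "p = (\<Prod>a\<in>UNIV. [:- a, 1:])"
  have "degree p = card (UNIV :: 'c set)"
    unfolding p_def by (subst degree_prod_eq_sum_degree) auto
  then have deg: "degree p > 0" using fin by (simp add: card_gt_0_iff)
  then have "degree (p + 1) > 0" by (subst degree_add_eq_left) auto
  then obtain x where "poly (p + 1) x = 0" using alg_closed_imp_poly_has_root by blast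
  moreover have "poly p x = 0" unfolding p_def poly_prod using fin by (intro prod_zero) auto
  ultimately show False by simp
qed

section \<open>Evaluation in the algebraic closure and Bezout relations\<close>

definition peval :: "'a :: field poly \<Rightarrow> 'a alg_closure \<Rightarrow> 'a alg_closure" where
  "peval f t = poly (map_poly to_ac f) t"

lemma peval_0 [simp]: "peval 0 t = 0"
  by (simp add: peval_def)

lemma peval_pCons [simp]: "peval (pCons a f) t = to_ac a + t * peval f t"
  by (simp add: peval_def map_poly_pCons)

lemma peval_1 [simp]: "peval 1 t = 1"
  by (simp add: one_pCons)

lemma peval_add [simp]: "peval (f + g) t = peval f t + peval g t"
  by (induction f g rule: poly_induct2) (simp_all add: algebra_simps)

lemma peval_smult [simp]: "peval (smult c f) t = to_ac c * peval f t"
  by (induction f) (simp_all add: algebra_simps)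

lemma peval_mult [simp]: "peval (f * g) t = peval f t * peval g t"
  by (induction f) (simp_all add: algebra_simps)

lemma peval_uminus [simp]: "peval (- f) t = - peval f t"
  by (induction f) (simp_all add: algebra_simps)

lemma peval_diff [simp]: "peval (f - g) t = peval f t - peval g t"
  using peval_add[of f "- g" t] by (simp del: peval_add)

lemma peval_power [simp]: "peval (f ^ n) t = peval f t ^ n"
  by (induction n) simp_all

lemma peval_numeral [simp]: "peval (numeral n) t = numeral n"
  by (simp add: numeral_poly)

lemma degree_map_poly_to_ac [simp]: "degree (map_poly to_ac f) = degree f"
  by (rule degree_map_poly) simp

lemma peval_eq_0_imp:
  fixes f :: "'a :: field poly"
  assumes "\<And>t. peval f t = 0"
  shows "f = 0"
proof -
  have "{t. poly (map_poly to_ac f) t = 0} = UNIV" using assms by (simp add: peval_def)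
  then have "map_poly to_ac f = 0"
    using infinite_UNIV_alg_closed[where ?'c = "'a alg_closure"] poly_roots_finite by metis
  then show ?thesis by (simp add: map_poly_eq_0_iff)
qed

lemma poly_bezout:
  fixes f g :: "'a :: field poly"
  shows "\<exists>u v h. u * f + v * g = h \<and> h dvd f \<and> h dvd g"
proof (induction g arbitrary: f rule: measure_induct_rule[of "\<lambda>g. if g = 0 then 0 else Suc (degree g)"])
  case (less g)
  show ?case
  proof (cases "g = 0")
    case True
    then show ?thesis by (intro exI[of _ 1] exI[of _ 0] exI[of _ f]) simp
  next
    case False
    then have "(if f mod g = 0 then 0 else Suc (degree (f mod g))) < (if g = 0 then 0 else Suc (degree g))"
      using degree_mod_less[of g f] by auto
    from less[OF this, of g] obtain u v h where
      h: "u * g + v * (f mod g) = h" "h dvd g" "h dvd f mod g" by blast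
    have "v * f + (u - v * (f div g)) * g = u * g + v * (f - f div g * g)"
      by (simp add: algebra_simps)
    also have "\<dots> = h" unfolding minus_div_mult_eq_mod by (rule h(1))
    finally have "v * f + (u - v * (f div g)) * g = h" .
    moreover have "h dvd f" using h(2,3) dvd_mod_imp_dvd by blast
    ultimately show ?thesis using h(2) by blast
  qed
qed

text \<open>A common divisor has no root in the algebraic closure, so it is a nonzero
  constant.\<close>

lemma poly_bezout_if_no_common_root:
  fixes f g :: "'a :: field poly"
  assumes "\<And>t. peval f t \<noteq> 0 \<or> peval g t \<noteq> 0"
  shows "\<exists>u v. u * f + v * g = 1"
proof -
  obtain u v h where h: "u * f + v * g = h" "h dvd f" "h dvd g" using poly_bezout by blast
  have "peval h t \<noteq> 0" for t
    using assms[of t] h(2,3) by (auto simp: dvd_def)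
  then have "degree (map_poly to_ac h) = 0"
    using alg_closed_imp_poly_has_root[of "map_poly to_ac h"] unfolding peval_def by blast
  then obtain c where c: "h = [:c:]" by (auto elim: degree_eq_zeroE)
  moreover have "c \<noteq> 0" using c \<open>\<And>t. peval h t \<noteq> 0\<close>[of 0] by auto
  ultimately have "[:inverse c:] * h = 1" by (simp add: one_pCons)
  then have "([:inverse c:] * u) * f + ([:inverse c:] * v) * g = 1"
    unfolding h(1)[symmetric] by (simp only: distrib_left mult.assoc)
  then show ?thesis by blast
qed

lemma bezout_peval_nonzero:
  assumes "u * f + v * g = 1"
  shows "peval f t \<noteq> 0 \<or> peval g t \<noteq> 0"
proof -
  have "peval (u * f + v * g) t = 1" using assms by simp
  then show ?thesis by auto
qed

section \<open>Multiplication by n on abscissae\<close>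

locale ec_base =
  fixes E0 :: "'a :: field weierstrass"
  assumes elliptic: "elliptic_curve E0"

sublocale ec_base \<subseteq> smooth_weierstrass "base_change E0"
  by unfold_locales (use elliptic in \<open>simp add: elliptic_curve_def\<close>)

context ec_base
begin

abbreviation E :: "'a alg_closure weierstrass" where "E \<equiv> base_change E0"

lemma inv_b_base_change:
  "inv_b2 E = to_ac (inv_b2 E0)" "inv_b4 E = to_ac (inv_b4 E0)"
  "inv_b6 E = to_ac (inv_b6 E0)" "inv_b8 E = to_ac (inv_b8 E0)"
  by (simp_all add: inv_b2_def inv_b4_def inv_b6_def inv_b8_def weierstrass.map_sel)

lemma ex_point: "\<exists>y. on_curve E (Point x y)"
proof -
  have "\<exists>y. poly [:- poly cubic_poly x, poly lin_poly x, 1:] y = 0"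
    by (rule alg_closed_imp_poly_has_root) simp
  then show ?thesis unfolding on_curve_Point
    by (auto simp: algebra_simps power2_eq_square add_eq_0_iff2)
qed

abbreviation ptimes :: "'a alg_closure ec_point \<Rightarrow> nat \<Rightarrow> 'a alg_closure ec_point" where
  "ptimes P n \<equiv> P [^]\<^bsub>ec_group\<^esub> n"

lemma on_curve_ptimes: "on_curve E P \<Longrightarrow> on_curve E (ptimes P n)"
  using ec.nat_pow_closed[of P n] by simp

lemma ptimes_Suc: "ptimes P (Suc n) = ec_add E (ptimes P n) P"
  by simp

lemma ptimes_Suc_minus:
  assumes "on_curve E P"
  shows "ec_add E (ptimes P (Suc n)) (ec_neg E P) = ptimes P n"
  unfolding ptimes_Suc using assms
  by (simp add: ec_add_assoc on_curve_ptimes)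

text \<open>Certifies that F / G is multiplication by n on abscissae. The Bezout relation prevents
  common zeros over the closure; the degrees send infinity to infinity and bound the roots of G. The
  alternative \<open>G = 0\<close> accommodates n = 0, where F / G is constantly infinity.\<close>

definition lattes_pair :: "nat \<Rightarrow> 'a poly \<Rightarrow> 'a poly \<Rightarrow> bool" where
  "lattes_pair n F G \<longleftrightarrow>
     (\<exists>u v. u * F + v * G = 1) \<and> degree F = n ^ 2 \<and> lead_coeff F = 1 \<and>
     (G = 0 \<or> degree G < n ^ 2) \<and>
     (\<forall>x y. on_curve E (Point x y) \<longrightarrow>
        has_x (x_coord (ptimes (Point x y) n)) (peval F x) (peval G x))"

lemma lattes_pair_0: "lattes_pair 0 1 0"
  unfolding lattes_pair_def by auto

lemma lattes_pair_1: "lattes_pair 1 [:0, 1:] 1"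
  unfolding lattes_pair_def by (auto intro: exI[of _ 0] exI[of _ 1])

text \<open>The term x^2 F^2 dominates, since the others have degree at most 2 N.\<close>

lemma degree_kum2:
  fixes F G :: "'a poly" and b4 b6 b8 :: 'a
  assumes "degree F = N" "lead_coeff F = 1" "degree G < N"
  defines "B \<equiv> kum2 [:b4:] [:b6:] [:b8:] F G [:0, 1:]"
  shows "degree B = 2 * N + 2" "lead_coeff B = 1"
proof -
  let ?t = "[:0, 1 :: 'a:]"
  define R where "R = [:b4:] * ?t * F * G + [:b6:] * (F + ?t * G) * G + [:b8:] * G ^ 2"
  have le: "degree (p * q) \<le> a + b" if "degree p \<le> a" "degree q \<le> b" for p q :: "'a poly" and a b
    using degree_mult_le[of p q] that by linarith
  have "degree (?t * G) \<le> 1 + degree G" by (rule le) auto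
  then have "degree (F + ?t * G) \<le> N" using assms by (intro degree_add_le) auto
  then have "degree ([:b6:] * (F + ?t * G) * G) \<le> 0 + N + degree G" by (intro le) auto
  moreover have "degree ([:b4:] * ?t * F * G) \<le> 0 + 1 + N + degree G" using assms by (intro le) auto
  moreover have "degree ([:b8:] * G ^ 2) \<le> 0 + (degree G + degree G)"
    unfolding power2_eq_square by (intro le) auto
  ultimately have R: "degree R \<le> 2 * N"
    unfolding R_def using assms(3) by (intro degree_add_le) linarith+
  have F0: "F \<noteq> 0" using assms by auto
  have T: "degree (?t ^ 2 * F ^ 2) = 2 * N + 2"
    using F0 assms by (simp add: power2_eq_square degree_mult_eq)
  have lT: "lead_coeff (?t ^ 2 * F ^ 2) = 1"
    using assms by (simp add: lead_coeff_mult lead_coeff_power)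
  have B: "B = ?t ^ 2 * F ^ 2 - R"
    unfolding B_def R_def kum2_def by (simp only: diff_diff_eq)
  have "degree (- R) < degree (?t ^ 2 * F ^ 2)"
    unfolding T degree_minus using R by linarith
  then show deg: "degree B = 2 * N + 2"
    unfolding B diff_conv_add_uminus by (simp only: degree_add_eq_left T)
  have "coeff B (2 * N + 2) = coeff (?t ^ 2 * F ^ 2) (2 * N + 2) - coeff R (2 * N + 2)"
    unfolding B by simp
  also have "coeff R (2 * N + 2) = 0" using R by (intro coeff_eq_0) auto
  finally show "lead_coeff B = 1" using lT unfolding deg T by simp
qed

lemma degree_kum1:
  fixes F G :: "'a poly"
  assumes "degree F = N" "degree G < N"
  shows "degree (kum1 [:b2:] [:b4:] [:b6:] F G [:0, 1:]) \<le> 2 * N + 1"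
proof -
  let ?t = "[:0, 1 :: 'a:]"
  have le: "degree (p * q) \<le> a + b" if "degree p \<le> a" "degree q \<le> b" for p q :: "'a poly" and a b
    using degree_mult_le[of p q] that by linarith
  have "degree (?t * G) \<le> 1 + degree G" by (rule le) auto
  then have S: "degree (F + ?t * G) \<le> N" using assms by (intro degree_add_le) auto
  have "degree (2 * ?t * F * (F + ?t * G)) \<le> 0 + 1 + N + N"
    using S assms by (intro le) auto
  moreover have "degree ([:b2:] * ?t * F * G) \<le> 0 + 1 + N + degree G" using assms by (intro le) auto
  moreover have "degree ([:b4:] * (F + ?t * G) * G) \<le> 0 + N + degree G" using S by (intro le) auto
  moreover have "degree ([:b6:] * G ^ 2) \<le> 0 + (degree G + degree G)"
    unfolding power2_eq_square by (intro le) auto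
  ultimately show ?thesis
    unfolding kum1_def using assms(2) by (intro degree_add_le) linarith+
qed

text \<open>
  A coprime root \<open>(U : V)\<close> of the quadratic form with coefficients \<open>B0, B1, B2\<close> splits off,
  and the second root is given by Cramer's rule and the square of the Bezout relation.
\<close>
lemma split_off_root:
  fixes U V :: "'c :: comm_ring_1"
  assumes bez: "u * U + v * V = 1" and rel: "B0 * U ^ 2 - B1 * U * V + B2 * V ^ 2 = 0"
  obtains U' V' where "B0 = V * V'" "B1 = U * V' + U' * V" "B2 = U * U'"
proof
  let ?U' = "u ^ 2 * U * B2 + 2 * u * v * V * B2 + v ^ 2 * (V * B1 - U * B0)"
  let ?V' = "v ^ 2 * V * B0 + 2 * u * v * U * B0 + u ^ 2 * (U * B1 - V * B2)"
  have rel': "B0 * U ^ 2 = B1 * U * V - B2 * V ^ 2" using rel by (simp add: algebra_simps)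
  have sq: "(u * U + v * V) ^ 2 = 1" using bez by simp
  have "V * ?V' - B0 * (u * U + v * V) ^ 2 = - (u ^ 2) * (B0 * U ^ 2 - B1 * U * V + B2 * V ^ 2)"
    by (simp add: algebra_simps power2_eq_square)
  then show "B0 = V * ?V'" unfolding sq rel by simp
  have "U * ?U' - B2 * (u * U + v * V) ^ 2 = - (v ^ 2) * (B0 * U ^ 2 - B1 * U * V + B2 * V ^ 2)"
    by (simp add: algebra_simps power2_eq_square)
  then show "B2 = U * ?U'" unfolding sq rel by simp
  have "U * ?V' + ?U' * V - B1 * (u * U + v * V) ^ 2 =
      2 * u * v * (B0 * U ^ 2 - B1 * U * V + B2 * V ^ 2)"
    by (simp add: algebra_simps power2_eq_square)
  then show "B1 = U * ?V' + ?U' * V" unfolding sq rel by simp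
qed

text \<open>A point lies above every x of the closure, so the quadratic relation of x((m+1)P) and
  x(mP) is an identity of polynomials and the known root splits off. The new pair gives homogeneous
  coordinates of a point at every x, hence has no common root. Its degree comes from 2 (m+1)^2 + 2 =
  m^2 + (m+2)^2.\<close>

lemma lattes_pair_step:
  assumes m: "lattes_pair m Fm Gm" and n: "lattes_pair (Suc m) F G"
  shows "\<exists>F' G'. lattes_pair (Suc (Suc m)) F' G'"
proof -
  let ?t = "[:0, 1 :: 'a:]"
  define B0 B1 B2 where "B0 = kum0 F G ?t"
    and "B1 = kum1 [:inv_b2 E0:] [:inv_b4 E0:] [:inv_b6 E0:] F G ?t"
    and "B2 = kum2 [:inv_b4 E0:] [:inv_b6 E0:] [:inv_b8 E0:] F G ?t"
  have pB: "peval B0 x = kum0 (peval F x) (peval G x) x"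
    "peval B1 x = k1 (peval F x) (peval G x) x" "peval B2 x = k2 (peval F x) (peval G x) x" for x
    by (simp_all add: B0_def B1_def B2_def kum0_def kum1_def kum2_def inv_b_base_change algebra_simps)
  have hx: "has_x (x_coord (ptimes (Point x y) (Suc m))) (peval F x) (peval G x)"
    and hxm: "has_x (x_coord (ec_add E (ptimes (Point x y) (Suc m)) (ec_neg E (Point x y))))
      (peval Fm x) (peval Gm x)" if "on_curve E (Point x y)" for x y
    using m n that ptimes_Suc_minus[OF that] unfolding lattes_pair_def by metis+
  obtain u v where bez: "u * Fm + v * Gm = 1" using m unfolding lattes_pair_def by blast
  have "B0 * Fm ^ 2 - B1 * Fm * Gm + B2 * Gm ^ 2 = 0"
  proof (rule peval_eq_0_imp)
    fix x
    obtain y where y: "on_curve E (Point x y)" using ex_point by blast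
    show "peval (B0 * Fm ^ 2 - B1 * Fm * Gm + B2 * Gm ^ 2) x = 0"
      using kummer_relation[OF y on_curve_ptimes[OF y] hx[OF y] hxm[OF y]]
      by (simp add: pB)
  qed
  then obtain F' G' where *: "B0 = Gm * G'" "B1 = Fm * G' + F' * Gm" "B2 = Fm * F'"
    using split_off_root[OF bez] by metis
  have has: "has_x (x_coord (ptimes (Point x y) (Suc (Suc m)))) (peval F' x) (peval G' x)"
    if y: "on_curve E (Point x y)" for x y
    unfolding ptimes_Suc[of _ "Suc m"]
    by (rule kummer_step[OF y on_curve_ptimes[OF y] hx[OF y] hxm[OF y]])
      (simp_all add: pB[symmetric] *)
  have "peval F' t \<noteq> 0 \<or> peval G' t \<noteq> 0" for t
    using ex_point[of t] has has_x_nonzero by blast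
  then have bez': "\<exists>u v. u * F' + v * G' = 1" by (rule poly_bezout_if_no_common_root)
  have F: "degree F = Suc m ^ 2" "lead_coeff F = 1" "degree G < Suc m ^ 2"
    using n unfolding lattes_pair_def by auto
  have Fm: "degree Fm = m ^ 2" "lead_coeff Fm = 1" "Gm = 0 \<or> degree Gm < m ^ 2"
    using m unfolding lattes_pair_def by auto
  have B2: "degree B2 = 2 * Suc m ^ 2 + 2" "lead_coeff B2 = 1"
    unfolding B2_def using degree_kum2[OF F] by auto
  have F'0: "F' \<noteq> 0" and Fm0: "Fm \<noteq> 0" using B2 * Fm by auto
  have "degree Fm + degree F' = 2 * Suc m ^ 2 + 2"
    using B2(1) F'0 Fm0 unfolding * by (simp add: degree_mult_eq)
  then have degF': "degree F' = Suc (Suc m) ^ 2"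
    using Fm(1) by (simp add: power2_eq_square)
  have lF': "lead_coeff F' = 1" using B2(2) Fm(2) unfolding * by (simp add: lead_coeff_mult)
  have "degree G' < Suc (Suc m) ^ 2"
  proof (cases "G' = 0")
    case False
    have "degree (F' * Gm) \<le> 2 * Suc m ^ 2 + 1"
      using Fm(3) degree_mult_le[of F' Gm] degF' by (auto simp: power2_eq_square)
    moreover have "degree B1 \<le> 2 * Suc m ^ 2 + 1"
      unfolding B1_def using F by (intro degree_kum1) auto
    moreover have "Fm * G' = B1 - F' * Gm" using * by simp
    ultimately have "degree (Fm * G') \<le> 2 * Suc m ^ 2 + 1" by (simp add: degree_diff_le)
    then have "m ^ 2 + degree G' \<le> 2 * Suc m ^ 2 + 1"
      using Fm(1) Fm0 False by (simp add: degree_mult_eq)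
    then show ?thesis by (simp add: power2_eq_square)
  qed simp
  then show ?thesis
    unfolding lattes_pair_def using bez' degF' lF' has by blast
qed

theorem ex_lattes_pair: "\<exists>F G. lattes_pair n F G"
proof -
  have "(\<exists>F G. lattes_pair n F G) \<and> (\<exists>F G. lattes_pair (Suc n) F G)"
  proof (induction n)
    case 0
    show ?case using lattes_pair_0 lattes_pair_1 by auto
  qed (use lattes_pair_step in blast)
  then show ?thesis by blast
qed

lemma lattes_pair_nonzero:
  assumes "lattes_pair n F G" "n > 0"
  shows "G \<noteq> 0"
proof
  assume "G = 0"
  then obtain u where "u * F = 1" using assms unfolding lattes_pair_def by auto
  then have "degree F = 0" by (metis dvd_def is_unit_iff_degree mult.commute one_neq_zero mult_zero_right)
  then show False using assms unfolding lattes_pair_def by auto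
qed

text \<open>An affine point killed by n lies above one of the at most n^2 - 1 roots of G, with at
  most two points above each root; \<open>Origin\<close> adds one.\<close>

lemma card_torsion_le:
  assumes "n > 0"
  shows "finite {P. on_curve E P \<and> ptimes P n = Origin}"
    and "card {P. on_curve E P \<and> ptimes P n = Origin} \<le> 2 * n ^ 2 - 1"
proof -
  obtain F G where FG: "lattes_pair n F G" using ex_lattes_pair by blast
  have G0: "G \<noteq> 0" using lattes_pair_nonzero[OF FG assms] .
  define Z where "Z = {x. poly (map_poly to_ac G) x = 0}"
  have Z: "finite Z" "card Z \<le> n ^ 2 - 1"
  proof -
    have "map_poly to_ac G \<noteq> 0" using G0 by (simp add: map_poly_eq_0_iff)
    then show "finite Z" "card Z \<le> n ^ 2 - 1"
      using poly_roots_finite[of "map_poly to_ac G"] card_poly_roots_bound[of "map_poly to_ac G"] FG G0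
      unfolding Z_def lattes_pair_def by auto
  qed
  have fib: "finite {P. on_curve E P \<and> x_coord P = Affine x} \<and>
      card {P. on_curve E P \<and> x_coord P = Affine x} \<le> 2" for x
  proof -
    obtain y where y: "on_curve E (Point x y)" using ex_point by blast
    have sub: "{P. on_curve E P \<and> x_coord P = Affine x} \<subseteq> {Point x y, ec_neg E (Point x y)}"
    proof
      fix P assume "P \<in> {P. on_curve E P \<and> x_coord P = Affine x}"
      then have "P = Point x y \<or> P = ec_neg E (Point x y)"
        using x_coord_eq_iff[OF y, of P] by (simp del: ec_neg.simps)
      then show "P \<in> {Point x y, ec_neg E (Point x y)}" by blast
    qed
    have "card {Point x y, ec_neg E (Point x y)} \<le> 2" by (simp add: card_insert_if)
    with card_mono[OF _ sub] finite_subset[OF sub] show ?thesis by simp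
  qed
  let ?U = "\<Union>x\<in>Z. {P. on_curve E P \<and> x_coord P = Affine x}"
  have sub: "{P. on_curve E P \<and> ptimes P n = Origin} \<subseteq> insert Origin ?U"
  proof
    fix P assume P: "P \<in> {P. on_curve E P \<and> ptimes P n = Origin}"
    show "P \<in> insert Origin ?U"
    proof (cases P)
      case (Point x y)
      with P have "on_curve E (Point x y)" by simp
      with FG have "has_x (x_coord (ptimes (Point x y) n)) (peval F x) (peval G x)"
        unfolding lattes_pair_def by blast
      with P Point have "peval G x = 0" by simp
      then have "x \<in> Z" by (simp add: Z_def peval_def)
      with P Point show ?thesis by auto
    qed simp
  qed
  have finU: "finite ?U" using Z fib by blast
  have "card ?U \<le> (\<Sum>x\<in>Z. card {P. on_curve E P \<and> x_coord P = Affine x})"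
    using Z by (intro card_UN_le)
  also have "\<dots> \<le> (\<Sum>x\<in>Z. 2)" using fib by (intro sum_mono) blast
  also have "\<dots> \<le> 2 * (n ^ 2 - 1)" using Z by simp
  finally have "card (insert Origin ?U) \<le> Suc (2 * (n ^ 2 - 1))"
    using card_insert_le_m1[of "Suc (2 * (n ^ 2 - 1))" ?U] by simp
  moreover have "Suc (2 * (n ^ 2 - 1)) = 2 * n ^ 2 - 1"
    using assms by (cases "n ^ 2") auto
  ultimately show "finite {P. on_curve E P \<and> ptimes P n = Origin}"
    "card {P. on_curve E P \<and> ptimes P n = Origin} \<le> 2 * n ^ 2 - 1"
    using finite_subset[OF sub] card_mono[OF _ sub] finU by auto
qed

end

section \<open>Evaluation of rational functions and periodic points of the Lattes map\<close>

lemma x_coord_ec_neg [simp]: "x_coord (ec_neg W P) = x_coord P"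
  by (cases P) simp_all

lemma has_x_eq: "has_x p U V \<Longrightarrow> p = (if V = 0 then Infinity else Affine (U / V))"
  by (cases p) auto

lemma lowest_terms:
  fixes r :: "'a :: field poly fract"
  obtains f g where "lowest_terms r = (f, g)" "g \<noteq> 0" "r = Fract f g" "\<exists>u v. u * f + v * g = 1"
proof -
  obtain a b where r: "r = Fract a b" "b \<noteq> 0" by (cases r) auto
  obtain u v h where h: "u * a + v * b = h" "h dvd a" "h dvd b" using poly_bezout by blast
  obtain a' b' where ab: "a = h * a'" "b = h * b'" using h by (auto elim!: dvdE)
  have h0: "h \<noteq> 0" "b' \<noteq> 0" using ab r by auto
  have "h * (u * a' + v * b') = h * 1" using h(1) ab by (simp add: algebra_simps)
  then have bez: "u * a' + v * b' = 1" using h0 by (simp only: mult_cancel_left simp_thms)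
  have "coprime a' b'"
  proof (rule coprimeI)
    fix c assume "c dvd a'" "c dvd b'"
    then have "c dvd u * a' + v * b'" by simp
    with bez show "is_unit c" by simp
  qed
  moreover have "r = Fract a' b'" using r ab h0 by (simp add: eq_fract)
  ultimately have "case (a', b') of (f, g) \<Rightarrow> g \<noteq> 0 \<and> coprime f g \<and> r = Fract f g"
    using h0 by simp
  then have "case lowest_terms r of (f, g) \<Rightarrow> g \<noteq> 0 \<and> coprime f g \<and> r = Fract f g"
    unfolding lowest_terms_def by (rule someI)
  then obtain f g where fg: "lowest_terms r = (f, g)" "g \<noteq> 0" "coprime f g" "r = Fract f g"
    by (cases "lowest_terms r") auto
  obtain u' v' k where k: "u' * f + v' * g = k" "k dvd f" "k dvd g" using poly_bezout by blast
  with fg have "is_unit k" by (meson coprime_common_divisor)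
  then obtain k' where "1 = k * k'" by (auto elim: dvdE)
  then have "(k' * u') * f + (k' * v') * g = 1"
    unfolding k(1)[symmetric] by (simp add: algebra_simps)
  with fg that show thesis by blast
qed

text \<open>Makes the arbitrary choice in \<open>lowest_terms\<close> harmless: two coprime
  representations satisfy F g = f G, and neither pair vanishes simultaneously, so both give the same
  value.\<close>

lemma rat_eval_Affine:
  fixes F G :: "'a :: field poly"
  assumes bez: "u * F + v * G = 1" and "G \<noteq> 0"
  shows "rat_eval (Fract F G) (Affine t) =
    (if peval G t = 0 then Infinity else Affine (peval F t / peval G t))"
proof -
  obtain f g where fg: "lowest_terms (Fract F G) = (f, g)" "g \<noteq> 0" "Fract F G = Fract f g"
    "\<exists>u v. u * f + v * g = 1" using lowest_terms .
  have "F * g = f * G" using fg assms by (simp add: eq_fract)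
  then have "peval (F * g) t = peval (f * G) t" by simp
  then have eq: "peval F t * peval g t = peval f t * peval G t" by simp
  have nz: "peval F t \<noteq> 0 \<or> peval G t \<noteq> 0" "peval f t \<noteq> 0 \<or> peval g t \<noteq> 0"
    using bezout_peval_nonzero bez fg(4) by blast+
  then have "peval g t = 0 \<longleftrightarrow> peval G t = 0" using eq by auto
  then show ?thesis
    using eq unfolding rat_eval_def fg(1) by (auto simp: Let_def frac_eq_eq peval_def[symmetric])
qed

lemma rat_eval_Infinity:
  fixes F G :: "'a :: field poly"
  assumes "G \<noteq> 0" "degree F > degree G"
  shows "rat_eval (Fract F G) Infinity = Infinity"
proof -
  obtain f g where fg: "lowest_terms (Fract F G) = (f, g)" "g \<noteq> 0" "Fract F G = Fract f g"
    using lowest_terms .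
  have eq: "F * g = f * G" using fg assms by (simp add: eq_fract)
  have "F \<noteq> 0" using assms by auto
  then have "f \<noteq> 0" using eq fg assms by auto
  with \<open>F \<noteq> 0\<close> have "degree F + degree g = degree f + degree G"
    using arg_cong[OF eq, of degree] fg assms by (simp add: degree_mult_eq)
  then show ?thesis using assms unfolding rat_eval_def fg(1) by (simp add: Let_def)
qed

text \<open>Uniqueness behind the \<open>THE\<close> in \<open>lattes\<close>: the cross difference
  vanishes on the whole closure, which is infinite.\<close>

lemma rat_eval_inject:
  fixes L L' :: "'a :: field poly fract"
  assumes "\<And>t. rat_eval L (Affine t) = rat_eval L' (Affine t)"
  shows "L = L'"
proof -
  obtain f g where fg: "g \<noteq> 0" "L = Fract f g" "\<exists>u v. u * f + v * g = 1"
    using lowest_terms[of L] by metis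
  obtain f' g' where fg': "g' \<noteq> 0" "L' = Fract f' g'" "\<exists>u v. u * f' + v * g' = 1"
    using lowest_terms[of L'] by metis
  have "f * g' - f' * g = 0"
  proof (rule peval_eq_0_imp)
    fix t
    have "(if peval g t = 0 then Infinity else Affine (peval f t / peval g t)) =
        (if peval g' t = 0 then Infinity else Affine (peval f' t / peval g' t))"
      using assms[of t] rat_eval_Affine fg fg' by metis
    then show "peval (f * g' - f' * g) t = 0"
      by (auto split: if_splits simp: frac_eq_eq)
  qed
  then show ?thesis using fg fg' by (simp add: eq_fract)
qed

context ec_base
begin

lemma rational_points_UNIV: "rational_points E0 UNIV = {P. on_curve E P}"
  by (auto simp: rational_points_def)

lemma x_coord_ec_mult:
  assumes "on_curve E P"
  shows "x_coord (ec_mult E d P) = x_coord (ptimes P (nat \<bar>d\<bar>))"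
proof -
  have "inv\<^bsub>ec_group\<^esub> (ptimes P k) = ec_neg E (ptimes P k)" for k
    using on_curve_ptimes[OF assms] by (rule inv_ec_group)
  then show ?thesis
    unfolding ec_mult_eq_pow[OF assms] using assms
    by (cases d rule: int_cases2)
      (simp_all add: int_pow_int ec.int_pow_neg_int del: inv_ec_group)
qed

theorem rat_eval_lattes:
  assumes "d \<noteq> 0" "on_curve E P"
  shows "rat_eval (lattes E0 d) (x_coord P) = x_coord (ptimes P (nat \<bar>d\<bar>))"
proof -
  define n where "n = nat \<bar>d\<bar>"
  have n: "n > 0" using assms by (simp add: n_def)
  obtain F G where FG: "lattes_pair n F G" using ex_lattes_pair by blast
  have G0: "G \<noteq> 0" using lattes_pair_nonzero[OF FG n] .
  obtain u v where bez: "u * F + v * G = 1" using FG unfolding lattes_pair_def by blast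
  have ev: "rat_eval (Fract F G) (x_coord P) = x_coord (ec_mult E d P)" if P: "on_curve E P" for P
  proof (cases P)
    case Origin
    have "ptimes Origin n = Origin" using ec.nat_pow_one[of n] by simp
    moreover have "rat_eval (Fract F G) Infinity = Infinity"
      using FG G0 unfolding lattes_pair_def by (intro rat_eval_Infinity) auto
    ultimately show ?thesis using x_coord_ec_mult[OF P, of d] Origin by (simp add: n_def)
  next
    case (Point x y)
    then have "has_x (x_coord (ptimes P n)) (peval F x) (peval G x)"
      using P FG unfolding lattes_pair_def by blast
    from has_x_eq[OF this] show ?thesis
      using rat_eval_Affine[OF bez G0, of x] x_coord_ec_mult[OF P, of d] Point by (simp add: n_def)
  qed
  define Q where "Q L \<longleftrightarrow> (\<forall>P\<in>rational_points E0 UNIV. rat_eval L (x_coord P) = x_coord (ec_mult E d P))" for L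
  have "Q (Fract F G)" unfolding Q_def rational_points_UNIV using ev by simp
  moreover have "L = Fract F G" if "Q L" for L
  proof (rule rat_eval_inject)
    fix t
    obtain y where y: "on_curve E (Point t y)" using ex_point by blast
    then have "rat_eval L (x_coord (Point t y)) = rat_eval (Fract F G) (x_coord (Point t y))"
      using that ev[OF y] unfolding Q_def rational_points_UNIV
      by (simp del: on_curve.simps x_coord.simps)
    then show "rat_eval L (Affine t) = rat_eval (Fract F G) (Affine t)" by simp
  qed
  ultimately have "Q (THE L. Q L)" by (rule theI)
  then have "Q (lattes E0 d)" unfolding lattes_def Q_def .
  then show ?thesis
    unfolding Q_def rational_points_UNIV using assms(2) x_coord_ec_mult[OF assms(2)] by simp
qed

lemma rat_eval_lattes_funpow:
  assumes "d \<noteq> 0" "on_curve E P"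
  shows "(rat_eval (lattes E0 d) ^^ k) (x_coord P) = x_coord (ptimes P (nat \<bar>d\<bar> ^ k))"
proof (induction k)
  case 0
  then show ?case using assms by simp
next
  case (Suc k)
  have "ptimes (ptimes P (nat \<bar>d\<bar> ^ k)) (nat \<bar>d\<bar>) = ptimes P (nat \<bar>d\<bar> ^ k * nat \<bar>d\<bar>)"
    using assms by (intro ec.nat_pow_pow) simp
  with Suc rat_eval_lattes[OF assms(1) on_curve_ptimes[OF assms(2)]] show ?case
    by (simp add: mult.commute del: ptimes_Suc)
qed

text \<open>Equal abscissae mean d^k P = P or d^k P = -P; in the second case d^(2k) P = P.\<close>

lemma periodic_iff:
  assumes "d \<noteq> 0" "on_curve E P"
  shows "(\<exists>k\<ge>1. (rat_eval (lattes E0 d) ^^ k) (x_coord P) = x_coord P) \<longleftrightarrow>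
    (\<exists>k\<ge>1. ptimes P (nat \<bar>d\<bar> ^ k) = P)"
proof
  let ?n = "nat \<bar>d\<bar>"
  assume "\<exists>k\<ge>1. (rat_eval (lattes E0 d) ^^ k) (x_coord P) = x_coord P"
  then obtain k where k: "k \<ge> 1" "x_coord P = x_coord (ptimes P (?n ^ k))"
    using rat_eval_lattes_funpow[OF assms] by metis
  then consider "ptimes P (?n ^ k) = P" | "ptimes P (?n ^ k) = ec_neg E P"
    using x_coord_eq_iff[OF assms(2) on_curve_ptimes[OF assms(2)]] by auto
  then show "\<exists>k\<ge>1. ptimes P (?n ^ k) = P"
  proof cases
    case 2
    have "ptimes P (?n ^ (k + k)) = ptimes (ptimes P (?n ^ k)) (?n ^ k)"
      unfolding power_add using assms by (intro ec.nat_pow_pow[symmetric]) simp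
    also have "\<dots> = ptimes (inv\<^bsub>ec_group\<^esub> P) (?n ^ k)" using assms(2) 2 by simp
    also have "\<dots> = inv\<^bsub>ec_group\<^esub> (ptimes P (?n ^ k))"
      using assms(2) by (intro ec.nat_pow_inv) simp
    also have "\<dots> = P" using 2 assms(2) by simp
    finally show ?thesis using k by (intro exI[of _ "k + k"]) simp
  qed (use k in blast)
qed (use rat_eval_lattes_funpow[OF assms] in metis)

end

section \<open>Finite abelian groups\<close>

lemma (in group) cauchy_order:
  assumes "Factorial_Ring.prime (r :: nat)" "r dvd card (carrier G)" "finite (carrier G)"
  obtains x where "x \<in> carrier G" "x \<noteq> \<one>" "x [^] r = \<one>"
proof -
  obtain m where "card (carrier G) = r ^ 1 * m" using assms by auto
  then obtain H where H: "subgroup H G" "card H = r"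
    using sylow_thm[OF assms(1) is_group, of 1 m] assms(3) by (auto simp: Coset.order_def)
  then interpret H: group "G\<lparr>carrier := H\<rparr>" by (simp add: subgroup.subgroup_is_group)
  have fin: "finite H" using H assms(3) subgroup.subset finite_subset by blast
  have "card H > 1" using H assms(1) prime_gt_1_nat by simp
  then obtain x where x: "x \<in> H" "x \<noteq> \<one>"
    by (metis card_1_singleton_iff is_singletonI' is_singleton_altdef nat_less_le
        subgroup.one_closed[OF H(1)] empty_iff)
  have "x [^]\<^bsub>G\<lparr>carrier := H\<rparr>\<^esub> card H = \<one>"
    using H.pow_order_eq_1[of x] x by (simp add: Coset.order_def)
  then have "x [^] r = \<one>" using H nat_pow_consistent by metis
  with x H show thesis using that subgroup.mem_carrier by metis
qed

lemma multiplicity_of_nat_of_nat: "multiplicity (int l) (int N) = multiplicity l N"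
  unfolding multiplicity_def by (simp flip: of_nat_power)

lemma power_of_prime_if_only_divisor:
  assumes "n > 0" "\<And>r :: nat. Factorial_Ring.prime r \<Longrightarrow> r dvd n \<Longrightarrow> r = p"
  shows "\<exists>k. n = p ^ k"
  using assms
proof (induction n rule: less_induct)
  case (less n)
  show ?case
  proof (cases "n = 1")
    case False
    then obtain r where r: "Factorial_Ring.prime r" "r dvd n" using prime_factor_nat by blast
    with less have rp: "r = p" by blast
    obtain m where m: "n = p * m" using r rp by auto
    have m0: "m > 0" using m less.prems(1) by (cases m) simp_all
    have "1 < p" using prime_gt_1_nat[OF r(1)] rp by simp
    with m0 have mn: "m < n" unfolding m by (simp only: n_less_m_mult_n)
    have "r = p" if "Factorial_Ring.prime r" "r dvd m" for r
      using less.prems(2)[OF that(1)] that(2) m dvd_mult by blast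
    then have "\<exists>k. m = p ^ k" using less.IH[OF mn m0] by blast
    then obtain k where "m = p ^ k" ..
    with m show ?thesis by (intro exI[of _ "Suc k"]) simp
  qed (auto intro: exI[of _ 0])
qed

context comm_group
begin

lemma subgroup_torsion: "subgroup {x \<in> carrier G. x [^] (n :: nat) = \<one>} G"
  by (rule subgroupI) (auto simp: nat_pow_inv nat_pow_distrib)

text \<open>With u a + v b = 1, every x is the product of x^(v b), which is killed by a, and x^(u
  a), which is killed by b.\<close>

lemma card_torsion_split:
  assumes fin: "finite (carrier G)" and "card (carrier G) = a * b" "coprime a b"
  shows "card {x \<in> carrier G. x [^] a = \<one>} * card {x \<in> carrier G. x [^] b = \<one>} = card (carrier G)"
proof -
  let ?T = "{x \<in> carrier G. x [^] a = \<one>}" and ?H = "{x \<in> carrier G. x [^] b = \<one>}"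
  obtain u v :: int where uv: "u * int a + v * int b = 1"
    using bezout_int[of "int a" "int b"] assms(3) by auto
  have xab: "x = x [^] (u * int a) \<otimes> x [^] (v * int b)" if "x \<in> carrier G" for x
    using int_pow_mult[OF that, of "u * int a" "v * int b"] uv that by simp
  have pow: "x [^] (k * int n) = (x [^] n) [^] k" "x [^] (k * int n) = (x [^] k) [^] n"
    if "x \<in> carrier G" for x k n
    using that int_pow_pow[of x "int n" k] int_pow_pow[of x k "int n"]
    by (simp_all add: int_pow_int mult.commute)
  have one: "(x [^] a) [^] b = \<one>" "(x [^] b) [^] a = \<one>" if "x \<in> carrier G" for x
    using that pow_order_eq_1[OF that, unfolded Coset.order_def] assms(2) by (simp_all add: nat_pow_pow mult.commute)
  have "bij_betw (\<lambda>(s, t). s \<otimes> t) (?T \<times> ?H) (carrier G)"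
  proof (rule bij_betwI[of _ _ _ "\<lambda>x. (x [^] (v * int b), x [^] (u * int a))"])
    show "(\<lambda>(s, t). s \<otimes> t) \<in> ?T \<times> ?H \<rightarrow> carrier G" by auto
    show "(\<lambda>x. (x [^] (v * int b), x [^] (u * int a))) \<in> carrier G \<rightarrow> ?T \<times> ?H"
    proof
      fix x assume x: "x \<in> carrier G"
      have "(x [^] (v * int b)) [^] a = \<one>"
      proof -
        have "(x [^] (v * int b)) [^] a = ((x [^] b) [^] v) [^] a" using pow(1)[OF x, of v b] by simp
        also have "\<dots> = ((x [^] b) [^] a) [^] v" using pow[of "x [^] b" v a] x by simp
        finally show ?thesis using one[OF x] by simp
      qed
      moreover have "(x [^] (u * int a)) [^] b = \<one>"
      proof -
        have "(x [^] (u * int a)) [^] b = ((x [^] a) [^] u) [^] b" using pow(1)[OF x, of u a] by simp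
        also have "\<dots> = ((x [^] a) [^] b) [^] u" using pow[of "x [^] a" u b] x by simp
        finally show ?thesis using one[OF x] by simp
      qed
      ultimately show "(x [^] (v * int b), x [^] (u * int a)) \<in> ?T \<times> ?H" using x by simp
    qed
    fix x assume x: "x \<in> carrier G"
    show "(case (x [^] (v * int b), x [^] (u * int a)) of (s, t) \<Rightarrow> s \<otimes> t) = x"
      using xab[OF x] x by (simp add: m_comm)
  next
    fix st assume "st \<in> ?T \<times> ?H"
    then obtain s t where st: "st = (s, t)" "s \<in> carrier G" "t \<in> carrier G" "s [^] a = \<one>" "t [^] b = \<one>"
      by auto
    have s: "s [^] (u * int a) = \<one>" and t: "t [^] (v * int b) = \<one>"
      using pow(1)[OF st(2), of u a] pow(1)[OF st(3), of v b] st by simp_all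
    have "(s \<otimes> t) [^] (v * int b) = s" "(s \<otimes> t) [^] (u * int a) = t"
      using xab[OF st(2)] xab[OF st(3)] s t st(2,3) by (simp_all add: int_pow_distrib)
    then show "(case (case st of (s, t) \<Rightarrow> s \<otimes> t) of x \<Rightarrow> (x [^] (v * int b), x [^] (u * int a))) = st"
      using st by simp
  qed
  then show ?thesis
    by (simp add: bij_betw_same_card flip: card_cartesian_product)
qed

text \<open>Cauchy's theorem in the torsion subgroup gives an element of order r that is killed by
  n.\<close>

lemma card_torsion_prime_divisor:
  assumes "finite {x \<in> carrier G. x [^] (n :: nat) = \<one>}" "Factorial_Ring.prime r"
    "r dvd card {x \<in> carrier G. x [^] n = \<one>}"
  shows "r dvd n"
proof -
  let ?H = "{x \<in> carrier G. x [^] n = \<one>}"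
  have H: "subgroup ?H G" by (rule subgroup_torsion)
  then interpret H: group "G\<lparr>carrier := ?H\<rparr>" by (rule subgroup.subgroup_is_group) (rule is_group)
  obtain x where x: "x \<in> ?H" "x \<noteq> \<one>" "x [^]\<^bsub>G\<lparr>carrier := ?H\<rparr>\<^esub> r = \<one>"
    using H.cauchy_order[of r] assms by auto
  then have xr: "x [^] r = \<one>" using nat_pow_consistent by metis
  show "r dvd n"
  proof (rule ccontr)
    assume "\<not> r dvd n"
    then have "coprime r n" using assms(2) prime_imp_coprime by blast
    moreover have "ord x dvd r" "ord x dvd n" using x xr pow_eq_id[of x] by auto
    ultimately have "ord x = 1" using coprime_common_divisor_nat by blast
    then show False using x ord_eq_1[of x] by auto
  qed
qed

section \<open>Splitting off the n-primary part\<close>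

definition periodic_part :: "nat \<Rightarrow> 'a set" where
  "periodic_part n = {x \<in> carrier G. \<exists>k\<ge>1. x [^] (n ^ k) = x}"

definition nilpotent_part :: "nat \<Rightarrow> 'a set" where
  "nilpotent_part n = {x \<in> carrier G. \<exists>k. x [^] (n ^ k) = \<one>}"

lemma periodic_iff_coprime_ord:
  assumes "finite (carrier G)" "x \<in> carrier G"
  shows "(\<exists>k\<ge>1. x [^] (n ^ k) = x) \<longleftrightarrow> coprime n (ord x)"
proof
  have o: "ord x > 0" using assms ord_ge_1[of x] by simp
  assume "\<exists>k\<ge>1. x [^] (n ^ k) = x"
  then obtain k where k: "k \<ge> 1" "x [^] (n ^ k) = x [^] (1 :: nat)" using assms by auto
  then have "int (ord x) dvd int (n ^ k) - int 1"
    using iffD1[OF int_pow_eq[OF assms(2), of "int 1" "int (n ^ k)", unfolded int_pow_int]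
        k(2)[symmetric]] by blast
  then have "[n ^ k = 1] (mod ord x)"
    using cong_int_iff cong_iff_dvd_diff by blast
  then have "coprime (n ^ k) (ord x)" by (metis cong_imp_coprime cong_sym coprime_1_left)
  then show "coprime n (ord x)" using k by simp
next
  assume c: "coprime n (ord x)"
  have o: "ord x > 0" using assms ord_ge_1[of x] by simp
  have "[n ^ totient (ord x) = 1] (mod ord x)" using c by (rule euler_theorem)
  then have "int (ord x) dvd int (n ^ totient (ord x)) - int 1"
    using cong_int_iff cong_iff_dvd_diff by blast
  then have "x [^] (n ^ totient (ord x)) = x [^] (1 :: nat)"
    using iffD2[OF int_pow_eq[OF assms(2), of "int 1" "int (n ^ totient (ord x))", unfolded int_pow_int]]
    by metis
  then show "\<exists>k\<ge>1. x [^] (n ^ k) = x"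
    using o assms by (intro exI[of _ "totient (ord x)"]) (auto simp: Suc_le_eq)
qed

text \<open>Write N = a b with a made of primes dividing n and b coprime to n. The periodic elements
  are those killed by b, the nilpotent ones those killed by a. By Cauchy the nilpotent part carries
  exactly the primes of N that divide n, so \<open>pi_prod\<close> computes its order.\<close>

lemma card_periodic_part:
  assumes fin: "finite (carrier G)" and n: "n > 0"
  shows "card (periodic_part n) * card (nilpotent_part n) = card (carrier G)"
    and "pi_prod (int n) (int (card (carrier G))) = int (card (nilpotent_part n))"
proof -
  define N where "N = card (carrier G)"
  have N: "N > 0" using fin by (auto simp: N_def card_gt_0_iff)
  \<comment> \<open>The exponent N exceeds the multiplicity of every prime in N, so this gcd
    contains each prime dividing n to its full power in N.\<close>
  define a where "a = gcd N (n ^ N)"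
  define b where "b = N div a"
  have ab: "N = a * b" by (simp add: a_def b_def)
  then have ab0: "a > 0" "b > 0" using N by auto
  have mult_lt: "multiplicity r N < N" if "Factorial_Ring.prime r" for r :: nat
  proof -
    have "multiplicity r N < 2 ^ multiplicity r N" by (rule less_exp)
    also have "\<dots> \<le> r ^ multiplicity r N" using prime_ge_2_nat[OF that] by (intro power_mono) auto
    also have "\<dots> \<le> N" using N by (intro dvd_imp_le multiplicity_dvd)
    finally show ?thesis .
  qed
  have bn: "coprime b n"
  proof (rule ccontr)
    assume "\<not> coprime b n"
    then obtain r where r: "Factorial_Ring.prime r" "r dvd b" "r dvd n"
      by (metis gcd_dvd1 gcd_dvd2 coprime_iff_gcd_eq_1 prime_factor_nat dvd_trans)
    obtain c where c: "b = r * c" using r by auto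
    define e where "e = multiplicity r a"
    have "r ^ e dvd a" by (simp add: e_def multiplicity_dvd)
    then have 1: "r ^ Suc e dvd N" unfolding ab c by (metis mult_dvd_mono dvd_triv_left mult.left_commute power_Suc2 mult.assoc)
    then have "Suc e \<le> multiplicity r N" using N r
      by (intro multiplicity_geI) (auto simp: prime_gt_1_nat)
    then have "Suc e \<le> N" using mult_lt[OF r(1)] by linarith
    then have "r ^ Suc e dvd n ^ N" using r by (meson dvd_power_same le_imp_power_dvd dvd_trans)
    with 1 have "r ^ Suc e dvd a" unfolding a_def by simp
    then have "Suc e \<le> multiplicity r a" using ab0 r
      by (intro multiplicity_geI) (auto simp: prime_gt_1_nat)
    then show False by (simp add: e_def)
  qed
  have "a dvd n ^ N" by (simp add: a_def)
  then have "coprime a b" using bn coprime_divisors[of a "n ^ N" b b]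
    by (metis coprime_commute coprime_power_right_iff dvd_refl)
  note split = card_torsion_split[OF fin, of a b, folded N_def, OF ab this]
  have ordN: "ord x dvd N" if "x \<in> carrier G" for x
    using that fin by (simp add: N_def ord_dvd_group_order[unfolded Coset.order_def])
  have per: "periodic_part n = {x \<in> carrier G. x [^] b = \<one>}"
  proof -
    have "coprime n (ord x) \<longleftrightarrow> x [^] b = \<one>" if x: "x \<in> carrier G" for x
    proof
      assume "coprime n (ord x)"
      then have "coprime (ord x) a" using \<open>a dvd n ^ N\<close>
        by (metis coprime_commute coprime_divisors coprime_power_right_iff dvd_refl)
      then have "ord x dvd b" using ordN[OF x] unfolding ab by (simp add: coprime_dvd_mult_right_iff)
      then show "x [^] b = \<one>" using pow_eq_id[OF x] by simp
    next
      assume "x [^] b = \<one>"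
      then have "ord x dvd b" using pow_eq_id[OF x] by simp
      then show "coprime n (ord x)" using bn by (metis coprime_commute coprime_divisors dvd_refl)
    qed
    then show ?thesis
      unfolding periodic_part_def using periodic_iff_coprime_ord[OF fin] by blast
  qed
  have nil: "nilpotent_part n = {x \<in> carrier G. x [^] a = \<one>}"
  proof -
    have "(\<exists>k. x [^] (n ^ k) = \<one>) \<longleftrightarrow> x [^] a = \<one>" if x: "x \<in> carrier G" for x
    proof
      assume "\<exists>k. x [^] (n ^ k) = \<one>"
      then obtain k where "ord x dvd n ^ k" using pow_eq_id[OF x] by auto
      then have "coprime (ord x) b" using bn
        by (metis coprime_commute coprime_divisors coprime_power_right_iff dvd_refl)
      then have "ord x dvd a" using ordN[OF x] unfolding ab by (simp add: coprime_dvd_mult_left_iff)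
      then show "x [^] a = \<one>" using pow_eq_id[OF x] by simp
    next
      assume "x [^] a = \<one>"
      then have "ord x dvd n ^ N" using pow_eq_id[OF x] \<open>a dvd n ^ N\<close> dvd_trans by blast
      then show "\<exists>k. x [^] (n ^ k) = \<one>" using pow_eq_id[OF x] by blast
    qed
    then show ?thesis unfolding nilpotent_part_def by blast
  qed
  show 1: "card (periodic_part n) * card (nilpotent_part n) = card (carrier G)"
    using split unfolding per nil N_def by (simp add: mult.commute)
  define c where "c = card (nilpotent_part n)"
  define h where "h = card (periodic_part n)"
  have hc: "N = h * c" using 1 unfolding h_def c_def N_def by simp
  with N have hc: "N = h * c" "h > 0" "c > 0" by auto
  have tf: "finite {x \<in> carrier G. x [^] (k :: nat) = \<one>}" for k using fin by simp
  have primes_c: "r dvd n" if "Factorial_Ring.prime r" "r dvd c" for r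
    using card_torsion_prime_divisor[OF tf that(1), of a] that \<open>a dvd n ^ N\<close>
    unfolding c_def nil using prime_dvd_power dvd_trans by blast
  have primes_h: "\<not> r dvd n" if "Factorial_Ring.prime r" "r dvd h" for r
    using card_torsion_prime_divisor[OF tf that(1), of b] that bn
    unfolding h_def per using coprime_common_divisor_nat not_prime_1 by metis
  have "pi_prod (int n) (int N) = (\<Prod>l\<in>{l. Factorial_Ring.prime l \<and> l dvd int n}. l ^ multiplicity l (int N))"
    by (simp add: pi_prod_def)
  also have "\<dots> = (\<Prod>l\<in>{l. Factorial_Ring.prime l \<and> l dvd n}. int l ^ multiplicity (int l) (int N))"
    by (rule prod.reindex_bij_witness[of _ int nat])
      (auto simp: prime_nat_iff_prime prime_ge_0_int nat_dvd_iff simp flip: int_dvd_int_iff)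
  also have "\<dots> = int (\<Prod>l\<in>{l. Factorial_Ring.prime l \<and> l dvd n}. l ^ multiplicity l N)"
    by (simp add: multiplicity_of_nat_of_nat)
  also have "(\<Prod>l\<in>{l. Factorial_Ring.prime l \<and> l dvd n}. l ^ multiplicity l N) = (\<Prod>l\<in>{l. Factorial_Ring.prime l \<and> l dvd n}. l ^ multiplicity l c)"
  proof (rule prod.cong[OF refl])
    fix l assume l: "l \<in> {l. Factorial_Ring.prime l \<and> l dvd n}"
    then have "multiplicity l h = 0" using primes_h by (metis mem_Collect_eq not_dvd_imp_multiplicity_0)
    then show "l ^ multiplicity l N = l ^ multiplicity l c"
      using l hc by (simp add: prime_elem_multiplicity_mult_distrib)
  qed
  also have "\<dots> = (\<Prod>l\<in>prime_factors c. l ^ multiplicity l c)"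
  proof (rule prod.mono_neutral_right)
    show "finite {l. Factorial_Ring.prime l \<and> l dvd n}" using n by (simp add: finite_divisors_nat)
    show "prime_factors c \<subseteq> {l. Factorial_Ring.prime l \<and> l dvd n}"
      using primes_c hc by (auto simp: prime_factors_dvd)
    show "\<forall>l\<in>{l. Factorial_Ring.prime l \<and> l dvd n} - prime_factors c. l ^ multiplicity l c = 1"
      using hc by (auto simp: prime_factors_dvd not_dvd_imp_multiplicity_0)
  qed
  also have "\<dots> = c" using hc prod_prime_factors[of c] by (simp add: Multiset.prod_mset_def)
  finally show "pi_prod (int n) (int (card (carrier G))) = int (card (nilpotent_part n))"
    unfolding N_def c_def .
qed

end

section \<open>Endomorphisms acting on torsion subgroups\<close>

lemma funpow_eq_self_dvd:
  assumes "(f ^^ s) x = x" "s dvd n"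
  shows "(f ^^ n) x = x"
proof -
  obtain k where k: "n = s * k" using assms by auto
  have "((f ^^ s) ^^ k) x = x" using assms(1) by (induction k) simp_all
  then show ?thesis by (simp add: k funpow_mult mult.commute)
qed

text \<open>All orbits have the same length, which therefore divides \<open>card W\<close>.\<close>
lemma free_orbits:
  assumes fin: "finite W" and f: "f ` W \<subseteq> W" and inj: "inj_on f W"
    and free: "\<And>k x y. (f ^^ k) x = x \<Longrightarrow> x \<in> W \<Longrightarrow> y \<in> W \<Longrightarrow> (f ^^ k) y = y"
    and x: "x \<in> W"
  shows "(f ^^ card W) x = x"
proof -
  have cl: "(f ^^ k) y \<in> W" if "y \<in> W" for k y
    using that f by (induction k) auto
  have cancel: "a = b" if "(f ^^ k) a = (f ^^ k) b" "a \<in> W" "b \<in> W" for k a b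
    using that
  proof (induction k)
    case (Suc k)
    then show ?case using inj_onD[OF inj] cl by (metis comp_apply funpow.simps(2))
  qed simp
  have "\<exists>s>0. (f ^^ s) x = x"
  proof -
    have "\<not> inj_on (\<lambda>k. (f ^^ k) x) (UNIV :: nat set)"
    proof
      assume "inj_on (\<lambda>k. (f ^^ k) x) (UNIV :: nat set)"
      then have "infinite ((\<lambda>k. (f ^^ k) x) ` (UNIV :: nat set))" using finite_imageD infinite_UNIV_nat by blast
      moreover have "(\<lambda>k. (f ^^ k) x) ` (UNIV :: nat set) \<subseteq> W" using cl x by auto
      ultimately show False using fin finite_subset by blast
    qed
    then obtain i j where ij: "i < j" "(f ^^ i) x = (f ^^ j) x"
      unfolding inj_on_def by (metis linorder_neqE_nat)
    then have "(f ^^ i) ((f ^^ (j - i)) x) = (f ^^ i) x"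
      by (metis comp_apply funpow_add le_add_diff_inverse less_imp_le)
    then have "(f ^^ (j - i)) x = x" using cancel cl x by blast
    with ij show ?thesis by (intro exI[of _ "j - i"]) simp
  qed
  then obtain s where s: "s > 0" "(f ^^ s) x = x" and least: "\<And>k. k > 0 \<Longrightarrow> (f ^^ k) x = x \<Longrightarrow> s \<le> k"
    using exists_least_iff[of "\<lambda>s. s > 0 \<and> (f ^^ s) x = x"] by (metis not_less)
  have id: "(f ^^ s) y = y" if "y \<in> W" for y using free s x that by blast
  have least': "s \<le> k" if "k > 0" "(f ^^ k) y = y" "y \<in> W" for k y
    using least free that x by blast
  \<comment> \<open>The orbit of \<open>y\<close>. The least period \<open>s\<close> of
    \<open>x\<close> is the least period of every element, because a power of f fixing one element
    fixes all.\<close>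
  define O' where "O' y = (\<lambda>i. (f ^^ i) y) ` {..<s}" for y
  have mod: "(f ^^ i) y = (f ^^ (i mod s)) y" if "y \<in> W" for i y
    using funpow_mod_eq[OF id[OF that], of i] by simp
  have O_all: "O' y = range (\<lambda>i. (f ^^ i) y)" if "y \<in> W" for y
    unfolding O'_def using mod[OF that] s(1) by (auto intro!: image_eqI[of _ _ "_ mod s"])
  have cardO: "card (O' y) = s" if y: "y \<in> W" for y
  proof -
    have "inj_on (\<lambda>i. (f ^^ i) y) {..<s}"
    proof (rule linorder_inj_onI)
      fix i j assume ij: "i < j" "i \<in> {..<s}" "j \<in> {..<s}"
      show "(f ^^ i) y \<noteq> (f ^^ j) y"
      proof
        assume "(f ^^ i) y = (f ^^ j) y"
        then have "(f ^^ i) ((f ^^ (j - i)) y) = (f ^^ i) y"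
          using ij by (metis comp_apply funpow_add le_add_diff_inverse less_imp_le)
        then have "(f ^^ (j - i)) y = y" using cancel cl y by blast
        then have "s \<le> j - i" using least'[of "j - i" y] ij y by simp
        then show False using ij by simp
      qed
    qed auto
    then show ?thesis unfolding O'_def by (simp add: card_image)
  qed
  have sub: "O' z \<subseteq> O' y" if zy: "z \<in> O' y" and y: "y \<in> W" for y z
  proof
    fix w assume "w \<in> O' z"
    then obtain j where w: "w = (f ^^ j) z" unfolding O'_def by blast
    obtain i where z: "z = (f ^^ i) y" using zy unfolding O'_def by blast
    have "w = (f ^^ (j + i)) y" unfolding w z funpow_add by simp
    then show "w \<in> O' y" unfolding O_all[OF y] by blast
  qed
  have eq: "O' z = O' y" if "z \<in> O' y" "y \<in> W" for y z
  proof (rule card_subset_eq)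
    show "finite (O' y)" by (simp add: O'_def)
    show "O' z \<subseteq> O' y" using sub that .
    have "z \<in> W" using that cl by (auto simp: O'_def)
    then show "card (O' z) = card (O' y)" using cardO that by simp
  qed
  have "s dvd card (\<Union> (O' ` W))"
  proof (rule dvd_partition)
    have "\<Union> (O' ` W) \<subseteq> W" using cl by (auto simp: O'_def)
    then show "finite (\<Union> (O' ` W))" using fin finite_subset by blast
    show "\<forall>c\<in>O' ` W. s dvd card c" using cardO by auto
    show "\<forall>c1\<in>O' ` W. \<forall>c2\<in>O' ` W. c1 \<noteq> c2 \<longrightarrow> c1 \<inter> c2 = {}"
    proof (intro ballI impI)
      fix c1 c2 assume c: "c1 \<in> O' ` W" "c2 \<in> O' ` W" "c1 \<noteq> c2"
      show "c1 \<inter> c2 = {}"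
      proof (rule ccontr)
        assume "c1 \<inter> c2 \<noteq> {}"
        then obtain z where "z \<in> c1" "z \<in> c2" by blast
        then have "c1 = O' z" "c2 = O' z" using c eq by auto
        with c show False by simp
      qed
    qed
  qed
  also have "\<Union> (O' ` W) = W"
  proof
    show "\<Union> (O' ` W) \<subseteq> W" using cl by (auto simp: O'_def)
    have "y \<in> O' y" if "y \<in> W" for y
      using O_all[OF that] by (metis funpow_0 rangeI)
    then show "W \<subseteq> \<Union> (O' ` W)" by blast
  qed
  finally show ?thesis using funpow_eq_self_dvd s(2) by metis
qed

text \<open>Abstracts Frobenius on the infinite group of all points; on a finite invariant subgroup
  injectivity makes it a permutation.\<close>

locale group_mono_endo = comm_group G for G (structure) +
  fixes \<phi> :: "'a \<Rightarrow> 'a"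
  assumes endo_closed: "x \<in> carrier G \<Longrightarrow> \<phi> x \<in> carrier G"
    and endo_mult: "x \<in> carrier G \<Longrightarrow> y \<in> carrier G \<Longrightarrow> \<phi> (x \<otimes> y) = \<phi> x \<otimes> \<phi> y"
    and endo_inj: "inj_on \<phi> (carrier G)"
begin

lemma endo_one: "\<phi> \<one> = \<one>"
proof -
  have "\<phi> \<one> \<otimes> \<phi> \<one> = \<one> \<otimes> \<phi> \<one>"
    using endo_mult[OF one_closed one_closed] endo_closed[OF one_closed] by simp
  then show ?thesis using endo_closed[OF one_closed] by (simp only: r_cancel one_closed)
qed

lemma endo_inv:
  assumes "x \<in> carrier G"
  shows "\<phi> (inv x) = inv (\<phi> x)"
proof (rule inv_equality[symmetric])
  show "\<phi> (inv x) \<otimes> \<phi> x = \<one>"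
    using assms endo_mult[OF inv_closed[OF assms] assms] endo_one by simp
qed (use assms endo_closed in simp_all)

lemma endo_pow: "x \<in> carrier G \<Longrightarrow> \<phi> (x [^] (n :: nat)) = \<phi> x [^] n"
  by (induction n) (simp_all add: endo_one endo_mult endo_closed)

lemma mono_endo_funpow: "group_mono_endo G (\<phi> ^^ k)"
proof (induction k)
  case 0
  show ?case by unfold_locales auto
next
  case (Suc k)
  then interpret k: group_mono_endo G "\<phi> ^^ k" .
  show ?case
  proof
    show "inj_on (\<phi> ^^ Suc k) (carrier G)"
      unfolding funpow.simps(2) using endo_inj k.endo_inj k.endo_closed
      by (auto simp: inj_on_def)
  qed (auto simp: endo_closed k.endo_closed endo_mult k.endo_mult)
qed

abbreviation tors :: "nat \<Rightarrow> 'a set" where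
  "tors n \<equiv> {x \<in> carrier G. x [^] n = \<one>}"

lemma endo_tors: "x \<in> tors n \<Longrightarrow> \<phi> x \<in> tors n"
  using endo_pow[of x n] endo_closed[of x] endo_one by simp

lemma subgroup_fixpoints:
  assumes "subgroup H G"
  shows "subgroup {x \<in> H. \<phi> x = x} G"
proof (rule subgroupI)
  interpret H: subgroup H G by fact
  show "{x \<in> H. \<phi> x = x} \<subseteq> carrier G" using H.subset by auto
  show "{x \<in> H. \<phi> x = x} \<noteq> {}" using H.one_closed endo_one by blast
  show "inv x \<in> {x \<in> H. \<phi> x = x}" if "x \<in> {x \<in> H. \<phi> x = x}" for x
    using that endo_inv[OF H.mem_carrier, of x] H.m_inv_closed[of x] by simp
  show "x \<otimes> y \<in> {x \<in> H. \<phi> x = x}"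
    if "x \<in> {x \<in> H. \<phi> x = x}" "y \<in> {x \<in> H. \<phi> x = x}" for x y
    using that endo_mult[OF H.mem_carrier H.mem_carrier, of x y] by simp
qed

lemma card_subgroup_dvd:
  assumes "subgroup H G" "subgroup K G" "H \<subseteq> K"
  shows "card H dvd card K"
proof -
  interpret K: group "G\<lparr>carrier := K\<rparr>" using assms(2) by (rule subgroup.subgroup_is_group) (rule is_group)
  have "subgroup H (G\<lparr>carrier := K\<rparr>)" using assms subgroup_incl by blast
  from K.lagrange[OF this] have "card (rcosets\<^bsub>G\<lparr>carrier := K\<rparr>\<^esub> H) * card H = card K"
    by (simp add: Coset.order_def)
  then show ?thesis by (metis dvd_triv_right)
qed

text \<open>If a power of the map fixes one nontrivial element of H, its fixed subgroup is
  nontrivial and hence all of H. So the nontrivial elements form orbits of equal length, which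
  divides card H - 1.\<close>

lemma endo_irreducible:
  assumes H: "subgroup H G" "finite H" and inv: "\<phi> ` H \<subseteq> H"
    and irr: "\<And>k. card {x \<in> H. (\<phi> ^^ k) x = x} = 1 \<or> card {x \<in> H. (\<phi> ^^ k) x = x} = card H"
    and x: "x \<in> H"
  shows "(\<phi> ^^ (card H - 1)) x = x"
proof -
  interpret H: subgroup H G by fact
  have one: "(\<phi> ^^ k) \<one> = \<one>" for k by (induction k) (simp_all add: endo_one)
  have "(\<phi> ^^ card (H - {\<one>})) x = x"
  proof (cases "x = \<one>")
    case True
    with one show ?thesis by simp
  next
    case False
    show ?thesis
    proof (rule free_orbits)
      show "finite (H - {\<one>})" using H by simp
      show "inj_on \<phi> (H - {\<one>})" using endo_inj H.subset by (meson Diff_subset inj_on_subset)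
      have "\<phi> z \<noteq> \<one>" if "z \<in> H - {\<one>}" for z
      proof
        assume "\<phi> z = \<one>"
        then have "\<phi> z = \<phi> \<one>" by (simp only: endo_one)
        then have "z = \<one>" by (rule inj_onD[OF endo_inj]) (use that H.mem_carrier in auto)
        with that show False by simp
      qed
      then show "\<phi> ` (H - {\<one>}) \<subseteq> H - {\<one>}"
        using inv by (intro image_subsetI) auto
      show "x \<in> H - {\<one>}" using x False by simp
      fix k y z assume y: "(\<phi> ^^ k) y = y" "y \<in> H - {\<one>}" and z: "z \<in> H - {\<one>}"
      let ?F = "{x \<in> H. (\<phi> ^^ k) x = x}"
      have "{\<one>, y} \<subseteq> ?F" using y one by auto
      then have "card {\<one>, y} \<le> card ?F" using H(2) by (intro card_mono) auto
      then have "card ?F \<noteq> 1" using y by auto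
      then have "card ?F = card H" using irr by blast
      then have "?F = H" using H(2) by (intro card_subset_eq) auto
      then show "(\<phi> ^^ k) z = z" using z by blast
    qed
  qed
  then show ?thesis using H(2) by simp
qed

lemma dvd_prime_square_cases:
  assumes "Factorial_Ring.prime (l :: nat)" "n dvd l ^ 2"
  shows "n = 1 \<or> n = l \<or> n = l ^ 2"
proof -
  obtain i where "i \<le> 2" "n = l ^ i" using assms divides_primepow_nat by metis
  then show ?thesis by (auto simp: le_Suc_eq numeral_2_eq_2)
qed

text \<open>A group of prime order has no proper nontrivial subgroup that could be a fixed
  subgroup.\<close>

lemma subgroup_prime_endo:
  assumes l: "Factorial_Ring.prime l" and H: "subgroup H G" "card H = l" and inv: "\<phi> ` H \<subseteq> H"
    and x: "x \<in> H"
  shows "(\<phi> ^^ (l - 1)) x = x"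
proof -
  have fin: "finite H" using H(2) l by (metis card.infinite not_prime_0)
  have "(\<phi> ^^ (card H - 1)) x = x"
  proof (rule endo_irreducible[OF H(1) fin inv _ x])
    fix k
    interpret k: group_mono_endo G "\<phi> ^^ k" by (rule mono_endo_funpow)
    have "card {x \<in> H. (\<phi> ^^ k) x = x} dvd l"
      using card_subgroup_dvd[OF k.subgroup_fixpoints[OF H(1)] H(1)] H(2) by auto
    then show "card {x \<in> H. (\<phi> ^^ k) x = x} = 1 \<or> card {x \<in> H. (\<phi> ^^ k) x = x} = card H"
      using l H(2) prime_nat_iff by metis
  qed
  then show ?thesis using H(2) by simp
qed

text \<open>
  In a basis of the plane \<open>tors l\<close> that extends a generator of the line \<open>L\<close>, \<open>\<phi>\<close> is triangular
  with diagonal \<open>a, b\<close>, so \<open>\<phi> ^ (l - 1)\<close> is unipotent by Fermat.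
\<close>
lemma endo_reducible:
  assumes l: "Factorial_Ring.prime l" and L: "subgroup L G" "card L = l" "L \<subseteq> tors l" "\<phi> ` L \<subseteq> L"
    and V: "finite (tors l)" "card (tors l) = l ^ 2" and x: "x \<in> tors l"
  shows "(\<phi> ^^ (l - 1)) x \<otimes> inv x \<in> L"
proof (cases "x \<in> L")
  case True
  then show ?thesis
    using subgroup_prime_endo[OF l L(1,2,4)] subgroup.one_closed[OF L(1)] x by simp
next
  case False
  interpret L: subgroup L G by fact
  have xc: "x \<in> carrier G" "x [^] l = \<one>" using x by auto
  have finL: "finite L" using L(2) l by (metis card.infinite not_prime_0)
  \<comment> \<open>The subgroup generated by \<open>x\<close> and \<open>L\<close> has more than l
    elements and an order dividing l^2, so it is all of \<open>tors l\<close>. This provides the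
    coordinates in \<open>split\<close>.\<close>
  let ?H = "generate G {x} <#> L"
  have gen: "generate G {x} = {x [^] k | k. k \<in> (UNIV :: int set)}"
    using generate_pow[OF xc(1)] .
  have subg: "subgroup (generate G {x}) G" using xc by (intro generate_is_subgroup) simp
  have H: "subgroup ?H G" using mult_subgroups[OF subg L(1)] .
  have powl: "x [^] (k :: int) = x [^] (nat (k mod int l))" for k
  proof -
    have lpos: "int l > 0" using l prime_gt_0_nat by simp
    have "x [^] k = x [^] (int l * (k div int l) + int (nat (k mod int l)))"
      using lpos by simp
    also have "\<dots> = x [^] (int l * (k div int l)) \<otimes> x [^] (nat (k mod int l))"
      using xc by (simp only: int_pow_mult int_pow_int)
    also have "x [^] (int l * (k div int l)) = \<one>"
      using xc int_pow_pow[OF xc(1), of "int l" "k div int l"] by (simp add: int_pow_int)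
    finally show ?thesis using xc by simp
  qed
  have "?H \<subseteq> tors l"
  proof
    fix z assume "z \<in> ?H"
    then obtain i y where z: "z = x [^] (nat i) \<otimes> y" "y \<in> L"
      unfolding set_mult_def gen using powl by auto
    have "(x [^] (nat i)) [^] l = \<one>"
      using xc by (simp add: nat_pow_pow mult.commute) (metis nat_pow_one nat_pow_pow)
    then show "z \<in> tors l" using z L(3) xc by (auto simp: nat_pow_distrib)
  qed
  then have "card ?H dvd l ^ 2"
    using card_subgroup_dvd[OF H subgroup_torsion[of l]] V by simp
  moreover have "insert x L \<subseteq> ?H"
  proof -
    have "x \<in> generate G {x}" by (simp add: generate.incl)
    then have "x \<otimes> \<one> \<in> ?H" unfolding set_mult_def using L.one_closed by blast
    moreover have "\<one> \<otimes> y \<in> ?H" if "y \<in> L" for y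
      unfolding set_mult_def using that generate.one[of G "{x}"] by blast
    ultimately show ?thesis using xc L.mem_carrier by auto
  qed
  then have "card (insert x L) \<le> card ?H"
    using \<open>?H \<subseteq> tors l\<close> V finite_subset by (intro card_mono) auto
  then have "Suc l \<le> card ?H" using False finL L(2) by simp
  then have "card ?H \<noteq> 1" "card ?H \<noteq> l" using prime_gt_1_nat[OF l] by linarith+
  ultimately have "card ?H = l ^ 2"
    using dvd_prime_square_cases[OF l, of "card ?H"] by blast
  then have HV: "?H = tors l" using V \<open>?H \<subseteq> tors l\<close> by (intro card_subset_eq) auto
  have split: "\<exists>i y. y \<in> L \<and> z = x [^] (i :: nat) \<otimes> y" if z: "z \<in> tors l" for z
  proof -
    obtain g y where g: "g \<in> generate G {x}" "y \<in> L" "z = g \<otimes> y"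
      using z unfolding HV[symmetric] set_mult_def by blast
    then obtain k :: int where gk: "g = x [^] k" unfolding gen by blast
    have "g = x [^] (nat (k mod int l))" using gk powl[of k] by (rule trans)
    with g(2,3) show ?thesis by blast
  qed
  obtain b y where b: "y \<in> L" "\<phi> x = x [^] (b :: nat) \<otimes> y"
    using split[OF endo_tors[OF x]] by blast
  have surj: "\<phi> ` L = L"
  proof (rule card_subset_eq[OF finL L(4)])
    show "card (\<phi> ` L) = card L"
      by (rule card_image[OF inj_on_subset[OF endo_inj L.subset]])
  qed
  \<comment> \<open>Otherwise the image of \<open>x\<close> would lie in \<open>L\<close>, which is
    its own image, against injectivity.\<close>
  have "\<not> l dvd b"
  proof
    assume "l dvd b"
    then obtain c where "b = l * c" by auto
    then have "x [^] b = \<one>" using xc by (simp flip: nat_pow_pow)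
    then have "\<phi> x \<in> L" using b L.mem_carrier by simp
    then obtain y' where "y' \<in> L" "\<phi> x = \<phi> y'" using surj by (metis imageE)
    then have "x = y'" using endo_inj xc L.mem_carrier by (auto dest: inj_onD)
    with \<open>y' \<in> L\<close> False show False by simp
  qed
  then have "coprime b l" using l by (metis coprime_commute prime_imp_coprime)
  \<comment> \<open>Modulo \<open>L\<close> the map raises \<open>x\<close> to the power b, and
    Fermat makes b^(l-1) trivial.\<close>
  have iter: "\<exists>y\<in>L. (\<phi> ^^ k) x = x [^] (b ^ k) \<otimes> y" for k
  proof (induction k)
    case 0
    show ?case using xc L.one_closed by (intro bexI[of _ \<one>]) auto
  next
    case (Suc k)
    then obtain y' where y': "y' \<in> L" "(\<phi> ^^ k) x = x [^] (b ^ k) \<otimes> y'" by blast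
    have c: "y \<in> carrier G" "y' \<in> carrier G" "\<phi> y' \<in> carrier G" "\<phi> x \<in> carrier G"
      using b y' xc L.mem_carrier endo_closed by auto
    have "(\<phi> ^^ Suc k) x = \<phi> x [^] (b ^ k) \<otimes> \<phi> y'"
      using y' c xc by (simp add: endo_mult endo_pow)
    also have "\<dots> = (x [^] b \<otimes> y) [^] (b ^ k) \<otimes> \<phi> y'" by (simp only: b(2))
    also have "\<dots> = x [^] (b ^ Suc k) \<otimes> (y [^] (b ^ k) \<otimes> \<phi> y')"
      using c xc by (simp add: nat_pow_distrib nat_pow_pow m_assoc)
    finally have "(\<phi> ^^ Suc k) x = x [^] (b ^ Suc k) \<otimes> (y [^] (b ^ k) \<otimes> \<phi> y')" .
    moreover have "y [^] (b ^ k) \<otimes> \<phi> y' \<in> L"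
    proof (rule L.m_closed)
      show "y [^] (j :: nat) \<in> L" for j
        using b(1) by (induction j) simp_all
      show "\<phi> y' \<in> L" using L(4) y'(1) by blast
    qed
    ultimately show ?case by blast
  qed
  obtain y' where y': "y' \<in> L" "(\<phi> ^^ (l - 1)) x = x [^] (b ^ (l - 1)) \<otimes> y'" using iter by blast
  have "[b ^ (l - 1) = 1] (mod l)" using fermat_theorem[OF l \<open>\<not> l dvd b\<close>] .
  then have "int (b ^ (l - 1)) mod int l = int 1 mod int l"
    unfolding cong_def by (metis of_nat_mod)
  then have "x [^] (b ^ (l - 1)) = x"
    using powl[of "int (b ^ (l - 1))"] powl[of "int 1"] xc
    by (metis int_pow_int nat_pow_eone)
  then have "(\<phi> ^^ (l - 1)) x \<otimes> inv x = y'"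
    using y' xc L.mem_carrier[of y'] by (simp add: m_comm[of x y'] m_assoc)
  then show ?thesis using y' by simp
qed

text \<open>Additively the map is 1 + M with M x = t and M t = 0, so its k-th power adds k
  t.\<close>

lemma unipotent_pow:
  assumes "x \<in> carrier G" "t \<in> carrier G" "\<phi> x = x \<otimes> t" "\<phi> t = t"
  shows "(\<phi> ^^ k) x = x \<otimes> t [^] k"
proof (induction k)
  case (Suc k)
  have "(\<phi> ^^ Suc k) x = \<phi> (x \<otimes> t [^] k)" using Suc by simp
  also have "\<dots> = x \<otimes> (t \<otimes> t [^] k)"
    using assms by (simp add: endo_mult endo_pow m_assoc)
  finally show ?case using assms by (simp add: m_comm)
qed (use assms in simp)

text \<open>By Cauchy the order is a power of l, and the exponent is below 3.\<close>

lemma card_tors_prime: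
  assumes l: "Factorial_Ring.prime l" and fin: "finite (tors l)" and le: "card (tors l) < l ^ 3"
  shows "card (tors l) = 1 \<or> card (tors l) = l \<or> card (tors l) = l ^ 2"
proof -
  have "card (tors l) > 0" using fin by (auto simp: card_gt_0_iff)
  moreover have "r = l" if "Factorial_Ring.prime r" "r dvd card (tors l)" for r
    using card_torsion_prime_divisor[OF fin that] l that(1) primes_dvd_imp_eq by blast
  ultimately obtain k where k: "card (tors l) = l ^ k"
    using power_of_prime_if_only_divisor by blast
  then have "k < 3" using le l prime_gt_1_nat power_less_imp_less_exp by metis
  then have "k = 0 \<or> k = 1 \<or> k = 2" by linarith
  with k show ?thesis by auto
qed

text \<open>If some line is invariant, the (l-1)-th power is unipotent and a further l-th power is
  trivial. If none is, the fixed subgroups of all powers, being invariant themselves, are trivial or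
  everything, so all nontrivial orbits have the same length. The exponent is a common multiple of
  both cases.\<close>

theorem endo_tors_prime:
  assumes l: "Factorial_Ring.prime l" and fin: "finite (tors l)" and le: "card (tors l) < l ^ 3"
    and x: "x \<in> tors l"
  shows "(\<phi> ^^ ((l ^ 2 - 1) * l)) x = x"
proof -
  have V: "subgroup (tors l) G" by (rule subgroup_torsion)
  have l1: "l > 1" using l prime_gt_1_nat by blast
  have "l ^ 2 - 1 = (l - 1) * (l + 1)"
    by (simp add: power2_eq_square algebra_simps)
  then have factor: "l - 1 dvd l ^ 2 - 1" by (simp only: dvd_triv_left)
  show ?thesis
  proof (cases "\<exists>L. subgroup L G \<and> L \<subseteq> tors l \<and> card L = l \<and> \<phi> ` L \<subseteq> L")
    case True
    then obtain L where L: "subgroup L G" "card L = l" "L \<subseteq> tors l" "\<phi> ` L \<subseteq> L" by blast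
    show ?thesis
    proof (cases "card (tors l) = l ^ 2")
      case True
      interpret \<psi>: group_mono_endo G "\<phi> ^^ (l - 1)" by (rule mono_endo_funpow)
      define t where "t = (\<phi> ^^ (l - 1)) x \<otimes> inv x"
      have t: "t \<in> L" unfolding t_def using endo_reducible[OF l L fin True x] .
      have c: "x \<in> carrier G" "t \<in> carrier G" "t [^] l = \<one>" "(\<phi> ^^ (l - 1)) x \<in> carrier G"
        using x t L(3) \<psi>.endo_closed by auto
      have "(\<phi> ^^ (l - 1)) x = x \<otimes> t"
        unfolding t_def using c by (simp add: m_comm[of x] m_assoc)
      moreover have "(\<phi> ^^ (l - 1)) t = t" using subgroup_prime_endo[OF l L(1,2,4) t] .
      ultimately have "((\<phi> ^^ (l - 1)) ^^ l) x = x"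
        using \<psi>.unipotent_pow[OF c(1,2), of l] c by simp
      then have "(\<phi> ^^ ((l - 1) * l)) x = x" by (simp add: funpow_mult mult.commute)
      then show ?thesis by (rule funpow_eq_self_dvd) (rule mult_dvd_mono[OF factor dvd_refl])
    next
      case False
      have "card L dvd card (tors l)" using card_subgroup_dvd[OF L(1) V L(3)] .
      then have "card (tors l) = l"
        using card_tors_prime[OF l fin le] False L(2) l1 by auto
      then have "L = tors l" using L fin by (intro card_subset_eq) auto
      then have "(\<phi> ^^ (l - 1)) x = x" using subgroup_prime_endo[OF l L(1,2,4)] x by blast
      then show ?thesis by (rule funpow_eq_self_dvd) (rule dvd_mult2[OF factor])
    qed
  next
    case False
    have "(\<phi> ^^ (card (tors l) - 1)) x = x"
    proof (rule endo_irreducible[OF V fin _ _ x])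
      show "\<phi> ` tors l \<subseteq> tors l" using endo_tors by blast
      fix k
      interpret k: group_mono_endo G "\<phi> ^^ k" by (rule mono_endo_funpow)
      let ?F = "{x \<in> tors l. (\<phi> ^^ k) x = x}"
      have F: "subgroup ?F G" using k.subgroup_fixpoints[OF V] .
      have "\<phi> y \<in> ?F" if "y \<in> ?F" for y
        using that endo_tors[of y l] funpow_swap1[of \<phi> k y] by auto
      then have "card ?F \<noteq> l" using False F by blast
      moreover have "card ?F dvd card (tors l)" using card_subgroup_dvd[OF F V] by blast
      ultimately have F: "card ?F \<noteq> l" "card ?F dvd card (tors l)" .
      from card_tors_prime[OF l fin le] show "card ?F = 1 \<or> card ?F = card (tors l)"
      proof (elim disjE)
        assume c: "card (tors l) = 1"
        show ?thesis using F(2) unfolding c by simp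
      next
        assume c: "card (tors l) = l"
        show ?thesis using F l unfolding c prime_nat_iff by blast
      next
        assume c: "card (tors l) = l ^ 2"
        show ?thesis using F dvd_prime_square_cases[OF l, of "card ?F"] unfolding c by blast
      qed
    qed
    \<comment> \<open>For trivial torsion the left side is 0, which does not divide the exponent;
      then \<open>x\<close> is the identity.\<close>
    moreover have "card (tors l) - 1 dvd (l ^ 2 - 1) * l \<or> x = \<one>"
    proof (cases "card (tors l) = 1")
      case True
      then obtain a where a: "tors l = {a}" by (rule card_1_singletonE)
      moreover have "\<one> \<in> tors l" by simp
      ultimately show ?thesis using x by (metis singletonD)
    next
      case False
      then show ?thesis using card_tors_prime[OF l fin le] dvd_mult2[OF factor, of l] by auto
    qed
    moreover have "(\<phi> ^^ k) \<one> = \<one>" for k by (induction k) (simp_all add: endo_one)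
    ultimately show ?thesis using funpow_eq_self_dvd by metis
  qed
qed

text \<open>Write M = l M'. By induction the M'-th power of the map fixes l x, so it moves x by some
  t with l t = 0. As t is fixed, l iterations move x by l t = 0.\<close>

lemma endo_tors_lift:
  assumes "M > 0" "\<And>l y. Factorial_Ring.prime l \<Longrightarrow> l dvd M \<Longrightarrow> y \<in> tors l \<Longrightarrow> \<phi> y = y"
    and "x \<in> tors M"
  shows "(\<phi> ^^ M) x = x"
  using assms
proof (induction M arbitrary: x rule: less_induct)
  case (less M)
  show ?case
  proof (cases "M = 1")
    case True
    have "x \<in> carrier G" "x [^] (1 :: nat) = \<one>" using less.prems(3) unfolding True by blast+
    then have "x = \<one>" by (metis nat_pow_eone)
    then show ?thesis using True endo_one by simp
  next
    case False
    then obtain l where l: "Factorial_Ring.prime l" "l dvd M" using prime_factor_nat by blast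
    then obtain M' where M': "M = l * M'" by auto
    have M'0: "M' > 0" using M' less.prems(1) by (cases M') simp_all
    have lt: "M' < M" unfolding M' using M'0 prime_gt_1_nat[OF l(1)] by (simp only: n_less_m_mult_n)
    have fix': "(\<phi> ^^ M') y = y" if "y \<in> tors M'" for y
      using less.IH[OF lt M'0 _ that] less.prems(2) M' by (metis dvd_mult)
    interpret \<chi>: group_mono_endo G "\<phi> ^^ M'" by (rule mono_endo_funpow)
    have xc: "x \<in> carrier G" "x [^] (l * M') = \<one>" using less.prems M' by auto
    then have "x [^] l \<in> tors M'" by (simp add: nat_pow_pow)
    then have fl: "(\<phi> ^^ M') (x [^] l) = x [^] l" by (rule fix')
    define t where "t = (\<phi> ^^ M') x \<otimes> inv x"
    have tc: "t \<in> carrier G" unfolding t_def using xc \<chi>.endo_closed by simp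
    have "t [^] l = ((\<phi> ^^ M') x) [^] l \<otimes> inv (x [^] l)"
      unfolding t_def using xc \<chi>.endo_closed by (simp add: nat_pow_distrib nat_pow_inv)
    also have "\<dots> = \<one>" using fl xc by (simp add: \<chi>.endo_pow)
    finally have tl: "t \<in> tors l" using tc by simp
    then have "\<phi> t = t" using less.prems(2)[OF l] by blast
    then have "(\<phi> ^^ M') t = t" by (induction M') simp_all
    moreover have "(\<phi> ^^ M') x = x \<otimes> t"
      unfolding t_def using xc \<chi>.endo_closed[OF xc(1)] by (simp add: m_comm[of x] m_assoc)
    ultimately have "((\<phi> ^^ M') ^^ l) x = x"
      using \<chi>.unipotent_pow[OF xc(1) tc, of l] tl xc by simp
    then show ?thesis by (simp only: funpow_mult M' mult.commute[of l M'])
  qed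
qed

text \<open>The exponent C n is a multiple of (l^2 - 1) l for every prime l dividing n, so it acts
  trivially on all l-torsion; lifting from there to n^e-torsion costs the further factor
  n^e.\<close>

theorem endo_tors_power:
  assumes n: "n > 0"
    and C: "\<And>l. Factorial_Ring.prime l \<Longrightarrow> l dvd n \<Longrightarrow> l ^ 2 - 1 dvd C"
    and fin: "\<And>l. Factorial_Ring.prime l \<Longrightarrow> l dvd n \<Longrightarrow> finite (tors l) \<and> card (tors l) < l ^ 3"
    and x: "x \<in> tors (n ^ e)"
  shows "(\<phi> ^^ (C * n ^ (e + 1))) x = x"
proof -
  interpret \<psi>: group_mono_endo G "\<phi> ^^ (C * n)" by (rule mono_endo_funpow)
  have "((\<phi> ^^ (C * n)) ^^ (n ^ e)) x = x"
  proof (rule \<psi>.endo_tors_lift[OF _ _ x])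
    fix l y assume l: "Factorial_Ring.prime l" "l dvd n ^ e" and y: "y \<in> tors l"
    then have ln: "l dvd n" using prime_dvd_power by blast
    have "(\<phi> ^^ ((l ^ 2 - 1) * l)) y = y"
      using endo_tors_prime[OF l(1)] fin[OF l(1) ln] y by blast
    then show "(\<phi> ^^ (C * n)) y = y"
      by (rule funpow_eq_self_dvd) (use C[OF l(1) ln] ln in \<open>simp add: mult_dvd_mono\<close>)
  qed (use n in simp)
  then show ?thesis by (simp add: funpow_mult mult_ac)
qed

end

section \<open>Frobenius\<close>

text \<open>For a prime r dividing the order, Cauchy in the additive group yields a nonzero x with r
  x = 0, so r vanishes in the field and is the characteristic.\<close>

lemma card_finite_field_power_CHAR: "\<exists>e. CARD('a :: finite_field) = CHAR('a) ^ e"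
proof (rule power_of_prime_if_only_divisor)
  show "CARD('a) > 0" by (simp add: card_gt_0_iff)
  fix r :: nat assume r: "Factorial_Ring.prime r" "r dvd CARD('a)"
  define G :: "'a monoid" where "G = \<lparr>carrier = UNIV, monoid.mult = (+), one = 0\<rparr>"
  have "group G"
    by (rule groupI) (auto simp: G_def add.assoc intro: exI[of _ "- _"])
  then interpret G: group G .
  have pow: "x [^]\<^bsub>G\<^esub> n = of_nat n * x" for x and n :: nat
    by (induction n) (simp_all add: G_def nat_pow_def algebra_simps)
  have "\<exists>x. x \<noteq> \<one>\<^bsub>G\<^esub> \<and> x [^]\<^bsub>G\<^esub> r = \<one>\<^bsub>G\<^esub>"
  proof -
    have "r dvd card (carrier G)" "finite (carrier G)" using r by (simp_all add: G_def)
    from G.cauchy_order[OF r(1) this] show ?thesis by metis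
  qed
  then obtain x where x: "x \<noteq> \<one>\<^bsub>G\<^esub>" "x [^]\<^bsub>G\<^esub> r = \<one>\<^bsub>G\<^esub>" by blast
  then have "x \<noteq> 0" "of_nat r * x = 0"
    unfolding pow by (simp_all add: G_def)
  then have "of_nat r = (0 :: 'a)" by simp
  then have "CHAR('a) dvd r" by (simp add: of_nat_eq_0_iff_char_dvd)
  moreover have "Factorial_Ring.prime CHAR('a)" by simp
  ultimately show "r = CHAR('a)" using r(1) primes_dvd_imp_eq by metis
qed

lemma card_finite_field_ge_2: "CARD('a :: finite_field) \<ge> 2"
proof -
  have "card {0, 1 :: 'a} \<le> CARD('a)" by (intro card_mono) auto
  then show ?thesis by simp
qed

lemma frob_add:
  fixes x y :: "'a :: finite_field alg_closure"
  shows "(x + y) ^ (CARD('a) ^ m) = x ^ (CARD('a) ^ m) + y ^ (CARD('a) ^ m)"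
proof -
  obtain e where "CARD('a) = CHAR('a) ^ e" using card_finite_field_power_CHAR by blast
  then have "CARD('a) ^ m = CHAR('a alg_closure) ^ (e * m)" by (simp add: power_mult)
  moreover have "Factorial_Ring.prime CHAR('a alg_closure)" by simp
  ultimately show ?thesis by (intro freshmans_dream')
qed

lemma frob_uminus:
  fixes x :: "'a :: finite_field alg_closure"
  shows "(- x) ^ (CARD('a) ^ m) = - (x ^ (CARD('a) ^ m))"
proof -
  have "x ^ (CARD('a) ^ m) + (- x) ^ (CARD('a) ^ m) = (x + - x) ^ (CARD('a) ^ m)"
    by (simp only: frob_add)
  also have "\<dots> = 0" by simp
  finally show ?thesis by (simp add: eq_neg_iff_add_eq_0 add.commute)
qed

lemma frob_diff:
  fixes x y :: "'a :: finite_field alg_closure"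
  shows "(x - y) ^ (CARD('a) ^ m) = x ^ (CARD('a) ^ m) - y ^ (CARD('a) ^ m)"
  using frob_add[of x "- y" m] frob_uminus[of y m] by simp

lemma frob_sum:
  fixes f :: "'b \<Rightarrow> 'a :: finite_field alg_closure"
  shows "(\<Sum>i\<in>I. f i) ^ (CARD('a) ^ m) = (\<Sum>i\<in>I. f i ^ (CARD('a) ^ m))"
  by (induction I rule: infinite_finite_induct) (simp_all add: frob_add)

lemma frob_to_ac: "to_ac (x :: 'a :: finite_field) ^ (CARD('a) ^ m) = to_ac x"
  using finite_field_power_card_power_eq_same[of "CARD('a) ^ m" m x] by (simp flip: to_ac_power)

lemma frob_numeral: "(numeral n :: 'a :: finite_field alg_closure) ^ (CARD('a) ^ m) = numeral n"
  using frob_to_ac[of "numeral n" m] by simp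

lemma frob_inject:
  fixes x y :: "'a :: finite_field alg_closure"
  shows "x ^ (CARD('a) ^ m) = y ^ (CARD('a) ^ m) \<longleftrightarrow> x = y"
proof -
  have "x ^ (CARD('a) ^ m) = y ^ (CARD('a) ^ m) \<longleftrightarrow> (x - y) ^ (CARD('a) ^ m) = 0"
    unfolding frob_diff by simp
  then show ?thesis by simp
qed

lemma size_proots_alg_closed:
  fixes p :: "'c :: alg_closed_field poly"
  assumes "p \<noteq> 0"
  shows "size (proots p) = degree p"
proof -
  obtain M where M: "size M = degree p" "p = smult (lead_coeff p) (\<Prod>x\<in>#M. [:- x, 1:])"
    using alg_closed_imp_factorization[OF assms] by blast
  have "proots p = proots (smult (lead_coeff p) (\<Prod>x\<in>#M. [:- x, 1:]))"
    using M(2) by (rule arg_cong)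
  also have "\<dots> = proots (\<Prod>x\<in>#M. [:- x, 1:])"
    using assms by (intro proots_smult) simp
  also have "\<dots> = M"
  proof -
    have nz: "(\<Prod>x\<in>#A. [:- x, 1:]) \<noteq> 0" for A :: "'c multiset"
      by (simp only: prod_mset_zero_iff) auto
    show ?thesis
    proof (induction M)
      case (add x M)
      have "proots ([:- x, 1:] * (\<Prod>x\<in>#M. [:- x, 1:])) = proots [:- x, 1:] + proots (\<Prod>x\<in>#M. [:- x, 1:])"
        by (rule proots_mult) (simp_all only: nz pCons_eq_0_iff one_neq_zero simp_thms not_False_eq_True)
      with add show ?case by simp
    qed simp
  qed
  finally show ?thesis using M(1) by simp
qed

text \<open>The polynomial X^Q - X has derivative -1, hence Q simple roots in the algebraic
  closure.\<close>

lemma card_GF: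
  assumes "m \<ge> 1"
  shows "card (GF (CARD('a :: finite_field) ^ m) :: 'a alg_closure set) = CARD('a) ^ m"
    and "finite (GF (CARD('a) ^ m) :: 'a alg_closure set)"
proof -
  let ?Q = "CARD('a) ^ m"
  let ?p = "monom 1 ?Q - [:0, 1:] :: 'a alg_closure poly"
  obtain e where e: "CARD('a) = CHAR('a) ^ e" using card_finite_field_power_CHAR by blast
  have card_gt: "CARD('a) > 1"
    using card_finite_field_ge_2[where ?'a = 'a] by simp
  then have e0: "e > 0" using e by (cases e) auto
  have Q: "?Q > 1" using card_gt by (rule one_less_power) (use assms in simp)
  have "CHAR('a) dvd ?Q"
    unfolding e power_mult[symmetric] by (rule dvd_power) (use e0 assms in simp)
  then have Q0: "of_nat ?Q = (0 :: 'a alg_closure)"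
    by (simp only: of_nat_eq_0_iff_char_dvd CHAR_alg_closure)
  have deg: "degree ?p = ?Q"
  proof -
    have "degree (- [:0, 1 :: 'a alg_closure:]) < degree (monom (1 :: 'a alg_closure) ?Q)"
      using Q by (simp add: degree_monom_eq)
    then have "degree (monom 1 ?Q + - [:0, 1 :: 'a alg_closure:]) = degree (monom (1 :: 'a alg_closure) ?Q)"
      by (rule degree_add_eq_left)
    then show ?thesis
      unfolding diff_conv_add_uminus by (simp only: degree_monom_eq one_neq_zero not_False_eq_True)
  qed
  then have p0: "?p \<noteq> 0" using Q by auto
  have "pderiv ?p = -1"
    by (simp only: pderiv_diff pderiv_monom Q0) (simp add: pderiv_pCons one_pCons)
  note d = this
  have order: "order x ?p = 1" if "poly ?p x = 0" for x
  proof -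
    have "\<not> 2 \<le> order x ?p"
    proof
      assume "2 \<le> order x ?p"
      then have "[:- x, 1:] ^ 2 dvd ?p" by (rule order_divides[THEN iffD2, OF disjI2])
      then obtain r where "?p = [:- x, 1:] * ([:- x, 1:] * r)"
        unfolding power2_eq_square mult.assoc[symmetric] by (rule dvdE)
      then have "poly (pderiv ?p) x = 0" by (simp only: pderiv_mult poly_add poly_mult) simp
      then show False using d by simp
    qed
    moreover have "order x ?p \<noteq> 0" using that p0 order_root by blast
    ultimately show ?thesis by linarith
  qed
  have roots: "(GF ?Q :: 'a alg_closure set) = {x. poly ?p x = 0}"
    by (simp add: GF_def poly_monom)
  show fin: "finite (GF ?Q :: 'a alg_closure set)"
    unfolding roots using p0 by (rule poly_roots_finite)
  have "?Q = size (proots ?p)"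
    using size_proots_alg_closed[OF p0] deg by simp
  also have "\<dots> = (\<Sum>x\<in>set_mset (proots ?p). count (proots ?p) x)"
    by (rule size_multiset_overloaded_eq)
  also have "\<dots> = (\<Sum>x\<in>set_mset (proots ?p). 1)"
    using p0 order by (intro sum.cong) auto
  also have "\<dots> = card (GF ?Q :: 'a alg_closure set)"
    using p0 by (simp add: roots)
  finally show "card (GF ?Q :: 'a alg_closure set) = ?Q" by simp
qed

lemma card_P1_over_GF:
  assumes "m \<ge> 1"
  shows "card (P1_over (GF (CARD('a :: finite_field) ^ m) :: 'a alg_closure set)) = CARD('a) ^ m + 1"
    and "finite (P1_over (GF (CARD('a) ^ m) :: 'a alg_closure set))"
proof -
  have "inj_on Affine (GF (CARD('a) ^ m) :: 'a alg_closure set)" by (auto simp: inj_on_def)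
  then show "card (P1_over (GF (CARD('a) ^ m) :: 'a alg_closure set)) = CARD('a) ^ m + 1"
    unfolding P1_over_def using card_GF[OF assms, where ?'a = 'a]
    by (subst card_insert_disjoint) (auto simp: card_image)
  show "finite (P1_over (GF (CARD('a) ^ m) :: 'a alg_closure set))"
    unfolding P1_over_def using card_GF[OF assms, where ?'a = 'a] by simp
qed

lemma ec_add_map_ec_point:
  fixes h :: "'c :: field \<Rightarrow> 'c"
  assumes h: "\<And>x y. h (x + y) = h x + h y" "\<And>x y. h (x - y) = h x - h y" "\<And>x. h (- x) = - h x"
    "\<And>x y. h (x * y) = h x * h y" "\<And>x y. h (x / y) = h x / h y" "\<And>x n. h (x ^ n) = h x ^ n"
    "\<And>n. h (numeral n) = numeral n" "\<And>x. h x = 0 \<longleftrightarrow> x = 0" "\<And>x y. h x = h y \<longleftrightarrow> x = y"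
    and E: "h (A1 E) = A1 E" "h (A2 E) = A2 E" "h (A3 E) = A3 E" "h (A4 E) = A4 E"
  shows "ec_add E (map_ec_point h P) (map_ec_point h Q) = map_ec_point h (ec_add E P Q)"
proof (cases P; cases Q)
  fix x1 y1 x2 y2 assume PQ: "P = Point x1 y1" "Q = Point x2 y2"
  have "h y1 + h y2 + A1 E * h x2 + A3 E = h (y1 + y2 + A1 E * x2 + A3 E)"
    by (simp only: h E)
  then have "h y1 + h y2 + A1 E * h x2 + A3 E = 0 \<longleftrightarrow> y1 + y2 + A1 E * x2 + A3 E = 0"
    by (simp only: h(8))
  moreover have "h x1 = h x2 \<longleftrightarrow> x1 = x2" by (rule h(9))
  ultimately show ?thesis unfolding PQ by (auto simp: Let_def h E)
qed auto

locale ec_finite = ec_base E0 for E0 :: "'a :: finite_field weierstrass"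
begin

definition frob_point :: "nat \<Rightarrow> 'a alg_closure ec_point \<Rightarrow> 'a alg_closure ec_point" where
  "frob_point m = map_ec_point (\<lambda>x. x ^ (CARD('a) ^ m))"

lemma frob_point_simps [simp]:
  "frob_point m Origin = Origin"
  "frob_point m (Point x y) = Point (x ^ (CARD('a) ^ m)) (y ^ (CARD('a) ^ m))"
  by (simp_all add: frob_point_def)

lemma frob_coeffs:
  "A1 E ^ (CARD('a) ^ m) = A1 E" "A2 E ^ (CARD('a) ^ m) = A2 E" "A3 E ^ (CARD('a) ^ m) = A3 E"
  "A4 E ^ (CARD('a) ^ m) = A4 E" "A6 E ^ (CARD('a) ^ m) = A6 E"
  by (simp_all add: weierstrass.map_sel frob_to_ac)

lemma frob_point_add: "ec_add E (frob_point m P) (frob_point m Q) = frob_point m (ec_add E P Q)"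
  unfolding frob_point_def
  by (rule ec_add_map_ec_point)
    (simp_all add: frob_add frob_diff frob_uminus power_mult_distrib power_divide frob_numeral
      frob_inject frob_coeffs flip: power_mult, simp add: mult.commute)

lemma on_curve_frob_point: "on_curve E P \<Longrightarrow> on_curve E (frob_point m P)"
proof (cases P)
  case (Point x y)
  assume "on_curve E P"
  then have "(y ^ 2 + A1 E * x * y + A3 E * y) ^ (CARD('a) ^ m) =
      (x ^ 3 + A2 E * x ^ 2 + A4 E * x + A6 E) ^ (CARD('a) ^ m)"
    using Point by simp
  then show ?thesis
    by (simp add: Point frob_add power_mult_distrib frob_coeffs flip: power_mult)
      (simp add: mult.commute)
qed simp

lemma inj_frob_point: "frob_point m P = frob_point m Q \<longleftrightarrow> P = Q"
  by (cases P; cases Q) (simp_all add: frob_inject)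

sublocale frob: group_mono_endo ec_group "frob_point m"
  by unfold_locales (auto simp: on_curve_frob_point frob_point_add inj_frob_point inj_on_def)

lemma frob_point_funpow: "frob_point (m * k) = frob_point m ^^ k"
proof
  fix P show "frob_point (m * k) P = (frob_point m ^^ k) P"
  proof (induction k)
    case (Suc k)
    have "frob_point (m * Suc k) P = frob_point m (frob_point (m * k) P)"
      by (cases P) (simp_all add: power_add flip: power_mult, simp_all add: mult.commute)
    with Suc show ?case by simp
  qed (cases P; simp)
qed

lemma frob_point_add_exp: "frob_point (m + k) P = frob_point m (frob_point k P)"
  by (cases P) (simp_all add: power_add mult.commute flip: power_mult)

definition fix_pos :: "nat \<Rightarrow> 'a alg_closure ec_point set" where
  "fix_pos m = {P. on_curve E P \<and> frob_point m P = P}"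
text \<open>Over the field of order q^m this is a model of the rational points of the quadratic
  twist, inside the same group.\<close>

definition fix_neg :: "nat \<Rightarrow> 'a alg_closure ec_point set" where
  "fix_neg m = {P. on_curve E P \<and> frob_point m P = ec_neg E P}"

lemma rational_points_eq: "rational_points E0 (GF (CARD('a) ^ m)) = fix_pos m"
proof -
  have "on_curve E P \<and> (\<forall>x y. P = Point x y \<longrightarrow> x \<in> GF (CARD('a) ^ m) \<and> y \<in> GF (CARD('a) ^ m))
    \<longleftrightarrow> on_curve E P \<and> frob_point m P = P" for P
    by (cases P) (simp_all add: GF_def)
  then show ?thesis unfolding rational_points_def fix_pos_def by blast
qed

lemma frob_neg: "on_curve E P \<Longrightarrow> frob_point m (ec_neg E P) = ec_neg E (frob_point m P)"
  using frob.endo_inv[of P m] on_curve_frob_point[of P m] by simp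

lemma subgroup_fix_pos: "subgroup (fix_pos m) ec_group"
  using frob.subgroup_fixpoints[OF ec.subgroup_self, of m] by (simp add: fix_pos_def)

lemma subgroup_fix_neg: "subgroup (fix_neg m) ec_group"
proof (rule ec.subgroupI)
  show "fix_neg m \<noteq> {}" by (auto simp: fix_neg_def intro!: exI[of _ Origin])
  fix P assume P: "P \<in> fix_neg m"
  then show "inv\<^bsub>ec_group\<^esub> P \<in> fix_neg m" by (simp add: fix_neg_def frob_neg)
  fix Q assume Q: "Q \<in> fix_neg m"
  have "ec_neg E (ec_add E P Q) = ec_add E (ec_neg E P) (ec_neg E Q)"
    using ec.inv_mult[of P Q] P Q by (simp add: fix_neg_def on_curve_add)
  then show "P \<otimes>\<^bsub>ec_group\<^esub> Q \<in> fix_neg m"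
    using P Q by (simp add: fix_neg_def on_curve_add flip: frob_point_add)
qed (auto simp: fix_neg_def)

text \<open>Frobenius maps the points P, -P above a rational abscissa to points above it, so it
  fixes or exchanges them. If P = -P, as at infinity, the single point lies in both sets and is
  counted twice.\<close>

lemma fibre_count:
  assumes a: "a \<in> P1_over (GF (CARD('a) ^ m))"
  shows "card {P \<in> fix_pos m. x_coord P = a} + card {P \<in> fix_neg m. x_coord P = a} = 2"
proof (cases a)
  case Infinity
  have p: "P \<in> fix_pos m \<and> x_coord P = Infinity \<longleftrightarrow> P = Origin" for P
    by (cases P) (simp_all add: fix_pos_def)
  have n: "P \<in> fix_neg m \<and> x_coord P = Infinity \<longleftrightarrow> P = Origin" for P
    by (cases P) (simp_all add: fix_neg_def)
  show ?thesis unfolding Infinity p n by simp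
next
  case (Affine x)
  then have xQ: "x ^ (CARD('a) ^ m) = x" using a by (auto simp: P1_over_def GF_def)
  obtain y where y: "on_curve E (Point x y)" using ex_point by blast
  define P where "P = Point x y"
  have P: "on_curve E P" "x_coord P = a" using y Affine by (simp_all add: P_def)
  have all: "on_curve E R \<and> x_coord R = a \<longleftrightarrow> R = P \<or> R = ec_neg E P" for R
    using x_coord_eq_iff[OF P(1), of R] P by auto
  have fP: "frob_point m P = P \<or> frob_point m P = ec_neg E P"
  proof -
    have "x_coord (frob_point m P) = a" by (simp add: P_def Affine xQ)
    then show ?thesis using all[of "frob_point m P"] on_curve_frob_point[OF P(1)] by blast
  qed
  have fN: "frob_point m (ec_neg E P) = ec_neg E (frob_point m P)" using frob_neg P by blast
  have pos: "{R \<in> fix_pos m. x_coord R = a} = {R \<in> {P, ec_neg E P}. frob_point m R = R}"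
  proof -
    have "{R \<in> fix_pos m. x_coord R = a} = {R. (on_curve E R \<and> x_coord R = a) \<and> frob_point m R = R}"
      unfolding fix_pos_def by blast
    then show ?thesis unfolding all by blast
  qed
  have neg: "{R \<in> fix_neg m. x_coord R = a} = {R \<in> {P, ec_neg E P}. frob_point m R = ec_neg E R}"
  proof -
    have "{R \<in> fix_neg m. x_coord R = a} =
        {R. (on_curve E R \<and> x_coord R = a) \<and> frob_point m R = ec_neg E R}"
      unfolding fix_neg_def by blast
    then show ?thesis unfolding all by blast
  qed
  show ?thesis
  proof (cases "ec_neg E P = P")
    case True
    then have f: "frob_point m P = P" using fP by simp
    have "{R \<in> {P, ec_neg E P}. frob_point m R = R} = {P}"
      "{R \<in> {P, ec_neg E P}. frob_point m R = ec_neg E R} = {P}"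
      using True f by auto
    then show ?thesis unfolding pos neg by simp
  next
    case False
    from fP show ?thesis
    proof
      assume f: "frob_point m P = P"
      have "{R \<in> {P, ec_neg E P}. frob_point m R = R} = {P, ec_neg E P}"
        "{R \<in> {P, ec_neg E P}. frob_point m R = ec_neg E R} = {}"
        using False f fN by auto
      then show ?thesis unfolding pos neg using False by simp
    next
      assume f: "frob_point m P = ec_neg E P"
      have "{R \<in> {P, ec_neg E P}. frob_point m R = R} = {}"
        "{R \<in> {P, ec_neg E P}. frob_point m R = ec_neg E R} = {P, ec_neg E P}"
        using False f fN by auto
      then show ?thesis unfolding pos neg using False by simp
    qed
  qed
qed

lemma x_coord_in_P1_over:
  assumes "P \<in> fix_pos m \<union> fix_neg m"
  shows "x_coord P \<in> P1_over (GF (CARD('a) ^ m))"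
  using assms by (cases P) (auto simp: fix_pos_def fix_neg_def P1_over_def GF_def)

lemma fibre_count_set:
  assumes "m \<ge> 1" and S: "S \<subseteq> P1_over (GF (CARD('a) ^ m))"
  shows "card {P \<in> fix_pos m. x_coord P \<in> S} + card {P \<in> fix_neg m. x_coord P \<in> S} = 2 * card S"
    and "finite {P \<in> fix_pos m. x_coord P \<in> S}" "finite {P \<in> fix_neg m. x_coord P \<in> S}"
proof -
  have finS: "finite S" using S card_P1_over_GF(2)[OF assms(1), where ?'a = 'a] finite_subset by blast
  have fin: "finite {P. on_curve E P \<and> x_coord P = a}" for a
  proof (cases "\<exists>R. on_curve E R \<and> x_coord R = a")
    case True
    then obtain R where R: "on_curve E R" "x_coord R = a" by blast
    have "{P. on_curve E P \<and> x_coord P = a} \<subseteq> {R, ec_neg E R}"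
    proof
      fix P assume "P \<in> {P. on_curve E P \<and> x_coord P = a}"
      then have P: "on_curve E P" "x_coord R = x_coord P" using R(2) by simp_all
      then have "P = R \<or> P = ec_neg E R" using x_coord_eq_iff[OF R(1) P(1)] by blast
      then show "P \<in> {R, ec_neg E R}" by blast
    qed
    then show ?thesis using finite_subset by blast
  next
    case False
    then have "{P. on_curve E P \<and> x_coord P = a} = {}" by blast
    then show ?thesis by (simp only: finite.emptyI)
  qed
  have finp: "finite {P \<in> fix_pos m. x_coord P = a}" for a
    by (rule finite_subset[OF _ fin[of a]]) (unfold fix_pos_def, blast)
  have finn: "finite {P \<in> fix_neg m. x_coord P = a}" for a
    by (rule finite_subset[OF _ fin[of a]]) (unfold fix_neg_def, blast)
  have U: "{P \<in> T. x_coord P \<in> S} = (\<Union>a\<in>S. {P \<in> T. x_coord P = a})" for T by auto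
  show "finite {P \<in> fix_pos m. x_coord P \<in> S}" "finite {P \<in> fix_neg m. x_coord P \<in> S}"
    unfolding U using finS finp finn by auto
  have c: "card {P \<in> T. x_coord P \<in> S} = (\<Sum>a\<in>S. card {P \<in> T. x_coord P = a})"
    if "\<And>a. finite {P \<in> T. x_coord P = a}" for T
    unfolding U using finS that by (intro card_UN_disjoint) auto
  have "card {P \<in> fix_pos m. x_coord P \<in> S} + card {P \<in> fix_neg m. x_coord P \<in> S} =
      (\<Sum>a\<in>S. card {P \<in> fix_pos m. x_coord P = a} + card {P \<in> fix_neg m. x_coord P = a})"
    using c[OF finp] c[OF finn] by (simp add: sum.distrib)
  also have "\<dots> = (\<Sum>a\<in>S. 2)" using S fibre_count by (intro sum.cong) auto
  finally show "card {P \<in> fix_pos m. x_coord P \<in> S} + card {P \<in> fix_neg m. x_coord P \<in> S} = 2 * card S"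
    by simp
qed

lemma card_fix_pos_neg:
  assumes "m \<ge> 1"
  shows "card (fix_pos m) + card (fix_neg m) = 2 * (CARD('a) ^ m + 1)"
    and "finite (fix_pos m)" "finite (fix_neg m)"
proof -
  have *: "{P \<in> fix_pos m. x_coord P \<in> P1_over (GF (CARD('a) ^ m))} = fix_pos m"
    "{P \<in> fix_neg m. x_coord P \<in> P1_over (GF (CARD('a) ^ m))} = fix_neg m"
    using x_coord_in_P1_over by auto
  show "card (fix_pos m) + card (fix_neg m) = 2 * (CARD('a) ^ m + 1)"
    "finite (fix_pos m)" "finite (fix_neg m)"
    using fibre_count_set[OF assms order.refl] card_P1_over_GF(1)[OF assms, where ?'a = 'a]
    unfolding * by simp_all
qed

lemma card_fix_frob_trace:
  assumes "m \<ge> 1"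
  shows "int (CARD('a)) ^ m + 1 - frob_trace E0 m = int (card (fix_pos m))"
    and "int (CARD('a)) ^ m + 1 + frob_trace E0 m = int (card (fix_neg m))"
proof -
  have "int (card (fix_pos m)) + int (card (fix_neg m)) = 2 * (int (CARD('a)) ^ m + 1)"
    using arg_cong[OF card_fix_pos_neg(1)[OF assms], of int] by simp
  then show "int (CARD('a)) ^ m + 1 - frob_trace E0 m = int (card (fix_pos m))"
    "int (CARD('a)) ^ m + 1 + frob_trace E0 m = int (card (fix_neg m))"
    unfolding frob_trace_def rational_points_eq by simp_all
qed

end

section \<open>Counting points by an auxiliary function\<close>

text \<open>Elimination: the equation \<open>k\<close> is solved for an unknown \<open>j0\<close>
  with nonzero coefficient, and \<open>b\<close> is the system after substitution.\<close>

lemma nontrivial_solution: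
  fixes a :: "'i \<Rightarrow> 'j \<Rightarrow> 'k :: field"
  assumes "finite I" "finite J" "card I < card J"
  shows "\<exists>c. (\<exists>j\<in>J. c j \<noteq> 0) \<and> (\<forall>i\<in>I. (\<Sum>j\<in>J. c j * a i j) = 0)"
  using assms
proof (induction I arbitrary: J a rule: finite_induct)
  case empty
  then have "J \<noteq> {}" by auto
  then show ?case by (intro exI[of _ "\<lambda>_. 1"]) auto
next
  case (insert k I)
  show ?case
  proof (cases "\<forall>j\<in>J. a k j = 0")
    case True
    have "card I < card J" using insert by simp
    from insert.IH[OF insert.prems(1) this] obtain c where
      c: "\<exists>j\<in>J. c j \<noteq> 0" "\<forall>i\<in>I. (\<Sum>j\<in>J. c j * a i j) = 0" by blast
    moreover have "(\<Sum>j\<in>J. c j * a k j) = 0" using True by (intro sum.neutral) simp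
    ultimately show ?thesis by (intro exI[of _ c]) simp
  next
    case False
    then obtain j0 where j0: "j0 \<in> J" "a k j0 \<noteq> 0" by blast
    define J' where "J' = J - {j0}"
    define b where "b i j = a i j - a i j0 * (a k j / a k j0)" for i j
    have J': "finite J'" "card I < card J'" "J = insert j0 J'" "j0 \<notin> J'"
      using insert j0 by (auto simp: J'_def)
    obtain c where c: "\<exists>j\<in>J'. c j \<noteq> 0" "\<forall>i\<in>I. (\<Sum>j\<in>J'. c j * b i j) = 0"
      using insert.IH[OF J'(1,2), of b] by blast
    define e where "e = (\<Sum>j\<in>J'. c j * (a k j / a k j0))"
    define c' where "c' j = (if j = j0 then - e else c j)" for j
    have sum: "(\<Sum>j\<in>J. c' j * a i j) = - e * a i j0 + (\<Sum>j\<in>J'. c j * a i j)" for i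
    proof -
      have "(\<Sum>j\<in>J. c' j * a i j) = c' j0 * a i j0 + (\<Sum>j\<in>J'. c' j * a i j)"
        using J' by simp
      also have "(\<Sum>j\<in>J'. c' j * a i j) = (\<Sum>j\<in>J'. c j * a i j)"
        using J'(4) by (intro sum.cong) (auto simp: c'_def)
      finally show ?thesis by (simp add: c'_def)
    qed
    have "(\<Sum>j\<in>J. c' j * a i j) = (\<Sum>j\<in>J'. c j * b i j)" for i
    proof -
      have "(\<Sum>j\<in>J'. c j * b i j) = (\<Sum>j\<in>J'. c j * a i j - c j * (a k j / a k j0) * a i j0)"
        by (intro sum.cong refl) (simp add: b_def algebra_simps)
      also have "\<dots> = (\<Sum>j\<in>J'. c j * a i j) - e * a i j0"
        unfolding e_def by (simp only: sum_subtractf sum_distrib_right)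
      finally show ?thesis unfolding sum by simp
    qed
    then have "\<forall>i\<in>I. (\<Sum>j\<in>J. c' j * a i j) = 0" using c by simp
    moreover have "(\<Sum>j\<in>J. c' j * a k j) = 0"
    proof -
      have "e * a k j0 = (\<Sum>j\<in>J'. c j * a k j)"
        unfolding e_def sum_distrib_right using j0 by (intro sum.cong) auto
      then show ?thesis unfolding sum by simp
    qed
    moreover have "\<exists>j\<in>J. c' j \<noteq> 0"
    proof -
      obtain j where "j \<in> J'" "c j \<noteq> 0" using c by blast
      then show ?thesis using J' by (intro bexI[of _ j]) (auto simp: c'_def)
    qed
    ultimately show ?thesis by (intro exI[of _ c']) simp
  qed
qed

section \<open>Functions graded by their pole order at infinity\<close>

context weierstrass_curve
begin

abbreviation cr_deg :: "'k poly \<times> 'k poly \<Rightarrow> nat" where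
  "cr_deg u \<equiv> degree (cr_norm u)"

lemma cr_deg_le_iff: "cr_deg (f, g) \<le> n \<longleftrightarrow> 2 * degree f \<le> n \<and> (g = 0 \<or> 2 * degree g + 3 \<le> n)"
  unfolding degree_cr_norm by auto

lemma cr_deg_mult:
  assumes "u \<noteq> (0, 0)" "v \<noteq> (0, 0)"
  shows "cr_deg (cr_mult u v) = cr_deg u + cr_deg v" "cr_mult u v \<noteq> (0, 0)"
proof -
  have "cr_norm u \<noteq> 0" "cr_norm v \<noteq> 0" using assms cr_norm_eq_0_iff by blast+
  then show "cr_deg (cr_mult u v) = cr_deg u + cr_deg v" "cr_mult u v \<noteq> (0, 0)"
    using cr_norm_eq_0_iff[of "cr_mult u v"] unfolding cr_norm_mult by (simp_all add: degree_mult_eq)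
qed

lemma cr_deg_mult_le: "cr_deg (cr_mult u v) \<le> cr_deg u + cr_deg v"
  unfolding cr_norm_mult by (rule degree_mult_le)

fun cr_conj :: "'k poly \<times> 'k poly \<Rightarrow> 'k poly \<times> 'k poly" where
  "cr_conj (f, g) = (f - g * lin_poly, - g)"

lemma cr_norm_conj: "cr_norm (cr_conj u) = cr_norm u"
proof -
  obtain f g where u: "u = (f, g)" by (cases u)
  show ?thesis unfolding u cr_conj.simps cr_norm.simps by (simp add: algebra_simps power2_eq_square)
qed

lemma cr_eval_conj: "cr_eval x y (cr_conj u) = cr_eval x (- y - A1 E * x - A3 E) u"
proof -
  obtain f g where u: "u = (f, g)" by (cases u)
  show ?thesis unfolding u by (simp add: lin_poly_def algebra_simps)
qed

lemma cr_norm_eval: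
  assumes "on_curve E (Point x y)"
  shows "poly (cr_norm u) x = cr_eval x y u * cr_eval x y (cr_conj u)"
proof -
  obtain f g where u: "u = (f, g)" by (cases u)
  show ?thesis unfolding u
    by (rule eq_if_diff_multiple[OF assms[unfolded on_curve_Point], of _ _ "poly g x ^ 2"])
      (simp add: algebra_simps power2_eq_square)
qed

fun cr_power :: "'k poly \<times> 'k poly \<Rightarrow> nat \<Rightarrow> 'k poly \<times> 'k poly" where
  "cr_power u 0 = (1, 0)"
| "cr_power u (Suc n) = cr_mult u (cr_power u n)"

lemma cr_eval_power:
  assumes "on_curve E (Point x y)"
  shows "cr_eval x y (cr_power u n) = cr_eval x y u ^ n"
proof (induction n)
  case (Suc n)
  then show ?case using cr_eval_mult[OF assms] by simp
qed simp

lemma cr_deg_power: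
  assumes "u \<noteq> (0, 0)"
  shows "cr_deg (cr_power u n) = n * cr_deg u" "cr_power u n \<noteq> (0, 0)"
proof (induction n)
  case (Suc n)
  have "cr_deg (cr_power u (Suc n)) = cr_deg u + cr_deg (cr_power u n)"
    "cr_power u (Suc n) \<noteq> (0, 0)"
    unfolding cr_power.simps using cr_deg_mult[OF assms Suc(2)] by blast+
  then show "cr_deg (cr_power u (Suc n)) = Suc n * cr_deg u" "cr_power u (Suc n) \<noteq> (0, 0)"
    using Suc(1) by (simp_all del: cr_norm.simps cr_power.simps)
qed simp_all

definition cr_sum :: "('j \<Rightarrow> 'k) \<Rightarrow> ('j \<Rightarrow> 'k poly \<times> 'k poly) \<Rightarrow> 'j set \<Rightarrow> 'k poly \<times> 'k poly" where
  "cr_sum c V J = (\<Sum>j\<in>J. smult (c j) (fst (V j)), \<Sum>j\<in>J. smult (c j) (snd (V j)))"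

lemma cr_eval_sum: "cr_eval x y (cr_sum c V J) = (\<Sum>j\<in>J. c j * cr_eval x y (V j))"
proof -
  have "cr_eval x y (V j) = poly (fst (V j)) x + poly (snd (V j)) x * y" for j
    by (cases "V j") simp
  then show ?thesis
    by (simp add: cr_sum_def poly_sum sum_distrib_right sum_distrib_left sum.distrib distrib_left mult_ac)
qed

lemma cr_deg_sum_le:
  assumes "\<And>j. j \<in> J \<Longrightarrow> cr_deg (V j) \<le> n"
  shows "cr_deg (cr_sum c V J) \<le> n"
proof -
  have *: "2 * degree (fst (V j)) \<le> n" "snd (V j) = 0 \<or> 2 * degree (snd (V j)) + 3 \<le> n"
    if "j \<in> J" for j
    using assms[OF that] cr_deg_le_iff[of "fst (V j)" "snd (V j)" n] by simp_all
  have "degree (smult (c j) (fst (V j))) \<le> n div 2" if "j \<in> J" for j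
    using *(1)[OF that] degree_smult_le[of "c j" "fst (V j)"] by linarith
  then have 1: "degree (\<Sum>j\<in>J. smult (c j) (fst (V j))) \<le> n div 2"
    by (cases "finite J") (auto intro: degree_sum_le)
  show ?thesis
  proof (cases "n < 3")
    case True
    then have "snd (V j) = 0" if "j \<in> J" for j using *(2)[OF that] by linarith
    then have "(\<Sum>j\<in>J. smult (c j) (snd (V j))) = 0" by (intro sum.neutral) simp
    then show ?thesis unfolding cr_sum_def cr_deg_le_iff using 1 by simp
  next
    case False
    have "degree (smult (c j) (snd (V j))) \<le> (n - 3) div 2" if "j \<in> J" for j
    proof (cases "snd (V j) = 0")
      case nz: False
      then have "degree (snd (V j)) \<le> (n - 3) div 2" using *(2)[OF that] False by linarith
      then show ?thesis using degree_smult_le le_trans by blast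
    qed simp
    then have "degree (\<Sum>j\<in>J. smult (c j) (snd (V j))) \<le> (n - 3) div 2"
      by (cases "finite J") (auto intro: degree_sum_le)
    then show ?thesis unfolding cr_sum_def cr_deg_le_iff using 1 False by linarith
  qed
qed

text \<open>Different pole orders force independence: otherwise the term of largest order among
  those with nonzero coefficient would be a combination of functions of smaller order.\<close>

lemma cr_sum_nonzero:
  fixes V :: "'j \<Rightarrow> 'k poly \<times> 'k poly"
  assumes fin: "finite J" and c: "\<exists>j\<in>J. c j \<noteq> 0" and V: "\<And>j. j \<in> J \<Longrightarrow> V j \<noteq> (0, 0)"
    and inj: "inj_on (\<lambda>j. cr_deg (V j)) J"
  shows "cr_sum c V J \<noteq> (0, 0)"
proof
  assume 0: "cr_sum c V J = (0, 0)"
  define J1 where "J1 = {j \<in> J. c j \<noteq> 0}"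
  have J1: "finite J1" "J1 \<noteq> {}" using fin c by (auto simp: J1_def)
  have "Max ((\<lambda>j. cr_deg (V j)) ` J1) \<in> (\<lambda>j. cr_deg (V j)) ` J1"
    using J1 by (intro Max_in) simp_all
  then obtain j0 where j0: "j0 \<in> J1" "Max ((\<lambda>j. cr_deg (V j)) ` J1) = cr_deg (V j0)"
    by (rule imageE)
  have max: "cr_deg (V j) \<le> cr_deg (V j0)" if "j \<in> J1" for j
    unfolding j0(2)[symmetric] using J1 that by (intro Max_ge finite_imageI imageI)
  define J2 where "J2 = J1 - {j0}"
  define d where "d = cr_deg (V j0)"
  have lt: "cr_deg (V j) < d" if "j \<in> J2" for j
  proof -
    have "cr_deg (V j) \<noteq> cr_deg (V j0)"
      using inj_onD[OF inj, of j j0] that j0(1) unfolding J1_def J2_def by blast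
    moreover have "cr_deg (V j) \<le> cr_deg (V j0)" using max that unfolding J2_def by blast
    ultimately show ?thesis unfolding d_def by linarith
  qed
  have "cr_sum c V J = cr_sum c V J1"
    unfolding cr_sum_def J1_def using fin
    by (auto intro!: sum.mono_neutral_right)
  then have J1_0: "cr_sum c V J1 = (0, 0)" using 0 by simp
  have ins: "J1 = insert j0 J2" "j0 \<notin> J2" "finite J2" using j0(1) J1 by (auto simp: J2_def)
  obtain f g where fg: "V j0 = (f, g)" by (cases "V j0")
  have c0: "c j0 \<noteq> 0" "j0 \<in> J" using j0(1) by (auto simp: J1_def)
  define c' where "c' j = - c j / c j0" for j
  have "smult (c j0) f + (\<Sum>j\<in>J2. smult (c j) (fst (V j))) = 0"
    "smult (c j0) g + (\<Sum>j\<in>J2. smult (c j) (snd (V j))) = 0"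
    using J1_0 ins fg by (simp_all add: cr_sum_def)
  then have "smult (c j0) f = (\<Sum>j\<in>J2. - smult (c j) (fst (V j)))"
    "smult (c j0) g = (\<Sum>j\<in>J2. - smult (c j) (snd (V j)))"
    by (simp_all add: sum_negf add_eq_0_iff2)
  then have eq: "smult (inverse (c j0)) (smult (c j0) f) = smult (inverse (c j0)) (\<Sum>j\<in>J2. - smult (c j) (fst (V j)))"
    "smult (inverse (c j0)) (smult (c j0) g) = smult (inverse (c j0)) (\<Sum>j\<in>J2. - smult (c j) (snd (V j)))"
    by simp_all
  have sm: "smult a (\<Sum>i\<in>A. h i) = (\<Sum>i\<in>A. smult a (h i))"
    for a :: 'k and h :: "'j \<Rightarrow> 'k poly" and A
    by (induction A rule: infinite_finite_induct) (simp_all add: smult_add_right)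
  have "V j0 = cr_sum c' V J2"
    using eq c0(1) unfolding fg cr_sum_def c'_def sm
    by (simp add: divide_inverse mult.commute)
  \<comment> \<open>The bound \<open>d - 1\<close> below needs a genuine predecessor. If
    \<open>d\<close> were 0, no term could be smaller, and \<open>V j0\<close> would be the empty
    sum.\<close>
  moreover have "d > 0 \<or> J2 = {}" using lt by auto
  moreover have "cr_sum c' V J2 = (0, 0)" if "J2 = {}" using that by (simp add: cr_sum_def)
  ultimately have "d > 0" using V[OF c0(2)] by auto
  have "cr_deg (cr_sum c' V J2) \<le> d - 1"
  proof (rule cr_deg_sum_le)
    show "cr_deg (V j) \<le> d - 1" if "j \<in> J2" for j using lt[OF that] by linarith
  qed
  with \<open>d > 0\<close> show False unfolding \<open>V j0 = cr_sum c' V J2\<close>[symmetric] d_def by linarith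
qed

text \<open>The coefficient at the monomial of pole order n: a power of x for even n, a power of x
  times y for odd n. Order 1 is a gap, where natural subtraction would repeat the index 3, so later
  index sets omit 1.\<close>

definition cr_coeff :: "nat \<Rightarrow> 'k poly \<times> 'k poly \<Rightarrow> 'k" where
  "cr_coeff n u = (if even n then coeff (fst u) (n div 2) else coeff (snd u) ((n - 3) div 2))"

lemma cr_eq_0_if_coeffs:
  assumes deg: "cr_deg u \<le> n" and 0: "\<And>k. k \<le> n \<Longrightarrow> k \<noteq> 1 \<Longrightarrow> cr_coeff k u = 0"
  shows "u = (0, 0)"
proof -
  obtain f g where u: "u = (f, g)" by (cases u)
  have f: "2 * degree f \<le> n" and g: "g = 0 \<or> 2 * degree g + 3 \<le> n"
    using deg unfolding u cr_deg_le_iff by auto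
  have "lead_coeff f = 0" using 0[of "2 * degree f"] f by (simp add: cr_coeff_def u)
  then have "f = 0" by simp
  moreover have "g = 0"
  proof (rule ccontr)
    assume "g \<noteq> 0"
    then have "2 * degree g + 3 \<le> n" using g by simp
    then have "lead_coeff g = 0" using 0[of "2 * degree g + 3"] by (simp add: cr_coeff_def u)
    with \<open>g \<noteq> 0\<close> show False by simp
  qed
  ultimately show ?thesis by (simp add: u)
qed

lemma cr_coeff_sum: "cr_coeff k (cr_sum c V J) = (\<Sum>j\<in>J. c j * cr_coeff k (V j))"
  by (simp add: cr_coeff_def cr_sum_def coeff_sum)

definition cr_basis :: "nat \<Rightarrow> 'k poly \<times> 'k poly" where
  "cr_basis i = (if even i then (monom 1 (i div 2), 0) else (0, monom 1 ((i - 3) div 2)))"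

lemma cr_deg_basis:
  assumes "i \<noteq> 1"
  shows "cr_deg (cr_basis i) = i" "cr_basis i \<noteq> (0, 0)"
proof -
  show "cr_basis i \<noteq> (0, 0)" by (simp add: cr_basis_def)
  show "cr_deg (cr_basis i) = i"
  proof (cases "even i")
    case True
    then show ?thesis unfolding cr_basis_def by (simp add: degree_cr_norm degree_monom_eq del: cr_norm.simps)
  next
    case False
    then obtain k where "i = 2 * k + 1" by (auto elim: oddE)
    then obtain k' where "i = 2 * k' + 3" using assms by (cases k) auto
    then show ?thesis unfolding cr_basis_def by (simp add: degree_cr_norm degree_monom_eq del: cr_norm.simps)
  qed
qed

text \<open>Zeros are counted through roots of the norm. If both points above a root are zeros, then
  f and g both vanish there, and the norm has a double root; so the multiplicity of each root covers
  the zeros above it.\<close>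

lemma card_curve_zeros_le:
  assumes u: "u \<noteq> (0, 0)"
    and S: "\<And>P. P \<in> S \<Longrightarrow> \<exists>x y. P = Point x y \<and> on_curve E P \<and> cr_eval x y u = 0"
  shows "finite S \<and> card S \<le> cr_deg u"
proof -
  let ?N = "cr_norm u"
  have N0: "?N \<noteq> 0" using u cr_norm_eq_0_iff by blast
  define F where "F x = {P \<in> S. x_coord P = Affine x}" for x
  have F: "finite (F x) \<and> card (F x) \<le> count (proots ?N) x" for x
  proof (cases "F x = {}")
    case False
    then obtain P where P: "P \<in> S" "x_coord P = Affine x" by (auto simp: F_def)
    then obtain y where y: "P = Point x y" "on_curve E (Point x y)" "cr_eval x y u = 0"
      using S[OF P(1)] by auto
    define y' where "y' = - y - A1 E * x - A3 E"
    have sub: "F x \<subseteq> {Point x y, Point x y'}"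
    proof
      fix R assume "R \<in> F x"
      then obtain z where z: "R = Point x z" "on_curve E (Point x z)"
        using S[of R] by (auto simp: F_def)
      have "(z - y) * (z - y') = (z ^ 2 + A1 E * x * z + A3 E * z) - (y ^ 2 + A1 E * x * y + A3 E * y)"
        unfolding y'_def by (simp add: algebra_simps power2_eq_square)
      also have "\<dots> = 0" using y(2) z(2) by simp
      finally have "z = y \<or> z = y'" by simp
      then show "R \<in> {Point x y, Point x y'}" using z by auto
    qed
    have root: "poly ?N x = 0" using cr_norm_eval[OF y(2)] y(3) by simp
    then have ord1: "order x ?N \<ge> 1" using N0 order_root[of ?N x] by (simp add: Suc_le_eq)
    show ?thesis
    proof (cases "Point x y' \<in> F x \<and> y' \<noteq> y")
      case True
      then have "cr_eval x y' u = 0" using S[of "Point x y'"] by (auto simp: F_def)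
      obtain f g where fg: "u = (f, g)" by (cases u)
      have e: "poly f x + poly g x * y = 0" "poly f x + poly g x * y' = 0"
        using y(3) \<open>cr_eval x y' u = 0\<close> fg by simp_all
      have "poly g x * (y - y') = (poly f x + poly g x * y) - (poly f x + poly g x * y')"
        by (simp add: algebra_simps)
      then have "poly g x * (y - y') = 0" unfolding e by simp
      then have "poly g x = 0" using True by auto
      then have "poly f x = 0" using e by simp
      then obtain f' g' where "f = [:- x, 1:] * f'" "g = [:- x, 1:] * g'"
        using \<open>poly g x = 0\<close> by (metis poly_eq_0_iff_dvd dvdE)
      then have "?N = [:- x, 1:] ^ 2 * cr_norm (f', g')"
        unfolding fg cr_norm.simps by (simp only: power_mult_distrib right_diff_distrib power2_eq_square mult_ac)
      then have "[:- x, 1:] ^ 2 dvd ?N" by (rule dvdI)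
      then have "order x ?N \<ge> 2" using N0 order_divides by blast
      moreover have "card (F x) \<le> card {Point x y, Point x y'}" by (rule card_mono[OF _ sub]) simp
      moreover have "card {Point x y, Point x y'} \<le> 2" by (simp add: card_insert_if)
      ultimately show ?thesis using N0 finite_subset[OF sub] by simp
    next
      case False
      then have sub': "F x \<subseteq> {Point x y}" using sub by auto
      then have "card (F x) \<le> 1" using card_mono[OF _ sub'] by simp
      then show ?thesis using N0 ord1 finite_subset[OF sub'] by simp
    qed
  qed simp
  have S_eq: "S = (\<Union>x\<in>set_mset (proots ?N). F x)"
  proof (intro equalityI subsetI)
    fix P assume P: "P \<in> S"
    then obtain x y where xy: "P = Point x y" "on_curve E P" "cr_eval x y u = 0" using S by blast
    then have "poly ?N x = 0" using cr_norm_eval[of x y u] by simp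
    then show "P \<in> (\<Union>x\<in>set_mset (proots ?N). F x)" using N0 P xy by (auto simp: F_def)
  qed (auto simp: F_def)
  have "card S \<le> (\<Sum>x\<in>set_mset (proots ?N). card (F x))"
    by (subst S_eq) (rule card_UN_le, simp)
  also have "\<dots> \<le> (\<Sum>x\<in>set_mset (proots ?N). count (proots ?N) x)"
    using F by (intro sum_mono) blast
  also have "\<dots> = size (proots ?N)" by (simp add: size_multiset_overloaded_eq)
  also have "\<dots> \<le> degree ?N" by (rule size_proots_le)
  finally have "card S \<le> cr_deg u" .
  moreover have "finite S" by (subst S_eq) (use F in auto)
  ultimately show ?thesis by blast
qed

end

lemma card_atMost_minus_1: "n \<ge> 1 \<Longrightarrow> card ({..n} - {1 :: nat}) = n"
  by (subst card_Diff_subset) auto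

section \<open>Upper bounds for the two groups of points\<close>

context ec_finite
begin

text \<open>
  The Stepanov--Bombieri method: on \<open>S\<close> the \<open>r\<close>-th power of the auxiliary function below is
  \<open>\<Sum>c\<^sub>i\<^sub>j e\<^sub>j\<^sup>r h\<^sub>i\<close>, and the coefficients are chosen such that this sum vanishes identically.
\<close>
lemma stepanov:
  assumes rs: "r = CARD('a) ^ k" "r * s = CARD('a) ^ m"
    and a: "a \<ge> 1" "a < s" and b: "b \<ge> 1" and ineq: "a * b > r * a + b"
    and h: "\<And>i. i \<noteq> 1 \<Longrightarrow> cr_deg (h i) \<le> i"
    and S: "\<And>P. P \<in> S \<Longrightarrow> \<exists>x y. P = Point x y \<and> on_curve E P \<and>
      (\<forall>i. i \<noteq> 1 \<longrightarrow> cr_eval x y (cr_basis i) ^ (CARD('a) ^ m) = cr_eval x y (h i))"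
  shows "finite S \<and> card S \<le> a + b * s"
proof -
  \<comment> \<open>There are b choices of \<open>i\<close> and a choices of \<open>j\<close>, as
    the gap 1 is omitted: a b unknowns. The sum to be annihilated has pole order at most
    \<open>n\<close>, which gives n conditions, and \<open>ineq\<close> makes this system
    solvable.\<close>
  define J where "J = ({..b} - {1 :: nat}) \<times> ({..a} - {1 :: nat})"
  define n where "n = r * a + b"
  define V where "V = (\<lambda>(i, j). cr_mult (cr_power (cr_basis j) r) (h i))"
  define W where "W = (\<lambda>(i, j). cr_mult (cr_basis j) (cr_power (cr_basis i) s))"
  have finJ: "finite J" by (simp add: J_def)
  have cardJ: "card J = b * a" unfolding J_def card_cartesian_product using a b card_atMost_minus_1 by simp
  have n1: "n \<ge> 1" using b by (simp add: n_def)
  have "card ({..n} - {1 :: nat}) < card J"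
    unfolding card_atMost_minus_1[OF n1] cardJ unfolding n_def using ineq by (simp add: mult.commute)
  then obtain c where c: "\<exists>j\<in>J. c j \<noteq> 0"
    "\<forall>l\<in>{..n} - {1}. (\<Sum>j\<in>J. c j * cr_coeff l (V j)) = 0"
    using nontrivial_solution[of "{..n} - {1}" J "\<lambda>l j. cr_coeff l (V j)"] finJ by auto
  have "cr_sum c V J = (0, 0)"
  proof (rule cr_eq_0_if_coeffs)
    show "cr_deg (cr_sum c V J) \<le> n"
    proof (rule cr_deg_sum_le)
      fix ij assume "ij \<in> J"
      then obtain i j where ij: "ij = (i, j)" "i \<le> b" "i \<noteq> 1" "j \<le> a" "j \<noteq> 1"
        by (auto simp: J_def)
      have "cr_deg (V ij) \<le> cr_deg (cr_power (cr_basis j) r) + cr_deg (h i)"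
        unfolding ij V_def prod.case by (rule cr_deg_mult_le)
      also have "\<dots> \<le> r * j + i"
        using cr_deg_power(1)[OF cr_deg_basis(2)[OF ij(5)], of r] cr_deg_basis(1)[OF ij(5)] h[OF ij(3)]
        by simp
      also have "\<dots> \<le> n" unfolding n_def using ij by (intro add_mono mult_le_mono2)
      finally show "cr_deg (V ij) \<le> n" .
    qed
    show "cr_coeff l (cr_sum c V J) = 0" if "l \<le> n" "l \<noteq> 1" for l
      unfolding cr_coeff_sum using c(2) that by simp
  qed
  then have V0: "(\<Sum>j\<in>J. c j * cr_eval x y (V j)) = 0" for x y
    using cr_eval_sum[of x y c V J] by simp
  have r0: "r > 0" using rs by (simp add: card_gt_0_iff)
  \<comment> \<open>As \<open>r\<close> is a power of q, the r-th power is additive; with r-th roots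
    as coefficients the power of the auxiliary function has the coefficients
    \<open>c\<close>.\<close>
  have "\<exists>c'. \<forall>j. c' j ^ r = c j"
  proof -
    have "\<exists>z. z ^ r = w" for w :: "'a alg_closure"
    proof -
      have deg: "degree (monom 1 r + [:- w:]) = r"
        using r0 by (subst degree_add_eq_left) (auto simp: degree_monom_eq)
      have "\<exists>z. poly (monom 1 r + [:- w:]) z = 0"
        by (rule alg_closed_imp_poly_has_root) (use deg r0 in simp)
      then show ?thesis by (auto simp: poly_monom add_eq_0_iff2)
    qed
    then have "\<forall>j. \<exists>z. z ^ r = c j" by blast
    then show ?thesis by (rule choice)
  qed
  then obtain c' where c': "\<And>j. c' j ^ r = c j" by blast
  define G where "G = cr_sum c' W J"
  have W: "W (i, j) \<noteq> (0, 0)" "cr_deg (W (i, j)) = j + s * i" if "(i, j) \<in> J" for i j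
  proof -
    have ij: "i \<noteq> 1" "j \<noteq> 1" using that by (auto simp: J_def)
    note i = cr_deg_power[OF cr_deg_basis(2)[OF ij(1)], of s] cr_deg_basis(1)[OF ij(1)]
    note j = cr_deg_basis[OF ij(2)]
    show "W (i, j) \<noteq> (0, 0)" "cr_deg (W (i, j)) = j + s * i"
      unfolding W_def prod.case using cr_deg_mult[OF j(2) i(2)] i(1,3) j(1) by simp_all
  qed
  have "G \<noteq> (0, 0)"
    unfolding G_def
  proof (rule cr_sum_nonzero[OF finJ])
    show "\<exists>j\<in>J. c' j \<noteq> 0" using c(1) c' r0 by (metis power_0_left not_gr_zero)
    show "W ij \<noteq> (0, 0)" if "ij \<in> J" for ij using W(1) that by (cases ij) auto
    show "inj_on (\<lambda>j. cr_deg (W j)) J"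
    proof (rule inj_onI)
      fix p p' assume pp: "p \<in> J" "p' \<in> J" "cr_deg (W p) = cr_deg (W p')"
      obtain i j i' j' where ij: "p = (i, j)" "p' = (i', j')" by (cases p; cases p')
      \<comment> \<open>Since j <= a < s, the pole order j + s i determines i and j by division with
        remainder; this is the purpose of a < s.\<close>
      have eq: "j + s * i = j' + s * i'" using pp W(2) unfolding ij by simp
      have lt: "j < s" "j' < s" using pp a unfolding ij J_def by auto
      have "(j + s * i) mod s = (j' + s * i') mod s" "(j + s * i) div s = (j' + s * i') div s"
        using eq by simp_all
      then show "p = p'" using lt unfolding ij by simp
    qed
  qed
  moreover have "\<exists>x y. P = Point x y \<and> on_curve E P \<and> cr_eval x y G = 0" if PS: "P \<in> S" for P
  proof -
    obtain x y where P: "P = Point x y" "on_curve E (Point x y)"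
      "\<And>i. i \<noteq> 1 \<Longrightarrow> cr_eval x y (cr_basis i) ^ (CARD('a) ^ m) = cr_eval x y (h i)"
      using S[OF PS] by blast
    have "cr_eval x y G ^ r = (\<Sum>j\<in>J. (c' j * cr_eval x y (W j)) ^ r)"
      unfolding G_def cr_eval_sum rs(1) by (rule frob_sum)
    also have "\<dots> = (\<Sum>j\<in>J. c j * cr_eval x y (V j))"
    proof (rule sum.cong[OF refl])
      fix ij assume "ij \<in> J"
      then obtain i j where ij: "ij = (i, j)" "i \<noteq> 1" "j \<noteq> 1" by (auto simp: J_def)
      have "cr_eval x y (W ij) ^ r = cr_eval x y (cr_basis j) ^ r * cr_eval x y (cr_basis i) ^ (r * s)"
        unfolding ij W_def prod.case cr_eval_mult[OF P(2)] cr_eval_power[OF P(2)]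
        by (simp add: power_mult_distrib mult.commute flip: power_mult)
      also have "\<dots> = cr_eval x y (V ij)"
        unfolding ij V_def prod.case cr_eval_mult[OF P(2)] cr_eval_power[OF P(2)] rs(2) P(3)[OF ij(2)] ..
      finally show "(c' ij * cr_eval x y (W ij)) ^ r = c ij * cr_eval x y (V ij)"
        by (simp add: power_mult_distrib c')
    qed
    also have "\<dots> = 0" by (rule V0)
    finally have "cr_eval x y G = 0" using r0 by simp
    with P show ?thesis by blast
  qed
  ultimately have "finite S \<and> card S \<le> cr_deg G" by (rule card_curve_zeros_le)
  moreover have "cr_deg G \<le> a + b * s"
    unfolding G_def
  proof (rule cr_deg_sum_le)
    fix p assume p: "p \<in> J"
    obtain i j where ij: "p = (i, j)" by (cases p)
    have "j \<le> a" "i \<le> b" using p unfolding ij J_def by auto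
    then have "j + s * i \<le> a + s * b" by (intro add_mono mult_le_mono2)
    then show "cr_deg (W p) \<le> a + b * s" using W(2) p unfolding ij by (simp add: mult.commute)
  qed
  ultimately show ?thesis by linarith
qed

lemma cr_eval_basis_frob:
  "cr_eval x y (cr_basis i) ^ (CARD('a) ^ m) =
    cr_eval (x ^ (CARD('a) ^ m)) (y ^ (CARD('a) ^ m)) (cr_basis i)"
  by (simp add: cr_basis_def poly_monom power_mult_distrib mult.commute flip: power_mult)

text \<open>The parameters are a = s - 1, the largest below s, and b = r + 2. They give at most r s
  + 3 s - 1 affine points, and \<open>Origin\<close> adds one. On \<open>fix_neg\<close> Frobenius
  acts as negation, so the functions \<open>h\<close> are the conjugates of the basis.\<close>

lemma card_fix_le:
  assumes m: "m \<ge> 6"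
  defines "s \<equiv> CARD('a) ^ (m - m div 2)"
  shows "card (fix_pos m) \<le> CARD('a) ^ m + 3 * s" "card (fix_neg m) \<le> CARD('a) ^ m + 3 * s"
proof -
  define q where "q = CARD('a)"
  define r where "r = q ^ (m div 2)"
  have q2: "q \<ge> 2"
    using card_finite_field_ge_2[where ?'a = 'a] by (simp add: q_def)
  have rs: "r * s = CARD('a) ^ m"
    unfolding r_def s_def q_def by (simp flip: power_add)
  have "2 ^ 3 \<le> (2 :: nat) ^ (m - m div 2)" using m by (intro power_increasing) auto
  also have "\<dots> \<le> s" unfolding s_def using q2 by (intro power_mono) (auto simp: q_def)
  finally have s8: "s \<ge> 8" by simp
  have r_le: "r \<le> s" unfolding r_def s_def q_def[symmetric] using q2 by (intro power_increasing) auto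
  \<comment> \<open>The difference of the two sides is 2 s - r - 4. It is positive since r <= s and
    s >= 8, the latter by m >= 6.\<close>
  have ineq: "(s - 1) * (r + 2) > r * (s - 1) + (r + 2)"
    using s8 r_le by (simp add: algebra_simps)
  have bound: "s - 1 + (r + 2) * s \<le> CARD('a) ^ m + 3 * s - 1"
    using s8 by (simp add: rs algebra_simps)
  have pos: "finite (fix_pos m - {Origin}) \<and> card (fix_pos m - {Origin}) \<le> s - 1 + (r + 2) * s"
  proof (rule stepanov[OF r_def[unfolded q_def] rs _ _ _ ineq])
    show "cr_deg (cr_basis i) \<le> i" if "i \<noteq> 1" for i using cr_deg_basis(1)[OF that] by simp
    fix P assume P: "P \<in> fix_pos m - {Origin}"
    then obtain x y where xy: "P = Point x y" by (cases P) auto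
    then have "x ^ (CARD('a) ^ m) = x" "y ^ (CARD('a) ^ m) = y" "on_curve E P"
      using P by (auto simp: fix_pos_def)
    then show "\<exists>x y. P = Point x y \<and> on_curve E P \<and>
      (\<forall>i. i \<noteq> 1 \<longrightarrow> cr_eval x y (cr_basis i) ^ (CARD('a) ^ m) = cr_eval x y (cr_basis i))"
      using xy by (intro exI[of _ x] exI[of _ y]) (simp add: cr_eval_basis_frob del: cr_eval.simps)
  qed (use s8 in auto)
  have neg: "finite (fix_neg m - {Origin}) \<and> card (fix_neg m - {Origin}) \<le> s - 1 + (r + 2) * s"
  proof (rule stepanov[OF r_def[unfolded q_def] rs _ _ _ ineq])
    show "cr_deg (cr_conj (cr_basis i)) \<le> i" if "i \<noteq> 1" for i
      using cr_deg_basis(1)[OF that] by (simp add: cr_norm_conj)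
    fix P assume P: "P \<in> fix_neg m - {Origin}"
    then obtain x y where xy: "P = Point x y" by (cases P) auto
    then have "x ^ (CARD('a) ^ m) = x" "y ^ (CARD('a) ^ m) = - y - A1 E * x - A3 E" "on_curve E P"
      using P by (auto simp: fix_neg_def)
    then show "\<exists>x y. P = Point x y \<and> on_curve E P \<and>
      (\<forall>i. i \<noteq> 1 \<longrightarrow> cr_eval x y (cr_basis i) ^ (CARD('a) ^ m) = cr_eval x y (cr_conj (cr_basis i)))"
      using xy by (intro exI[of _ x] exI[of _ y])
        (simp add: cr_eval_basis_frob cr_eval_conj del: cr_eval.simps)
  qed (use s8 in auto)
  have remove: "card T \<le> Suc (card (T - {Origin}))" if "finite (T - {Origin})"
    for T :: "'a alg_closure ec_point set"
  proof -
    have "card T \<le> card (insert Origin (T - {Origin}))" using that by (intro card_mono) auto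
    also have "\<dots> \<le> Suc (card (T - {Origin}))" using that by (subst card_insert_disjoint) simp_all
    finally show ?thesis .
  qed
  show "card (fix_pos m) \<le> CARD('a) ^ m + 3 * s"
    using remove[of "fix_pos m"] pos bound s8 by linarith
  show "card (fix_neg m) \<le> CARD('a) ^ m + 3 * s"
    using remove[of "fix_neg m"] neg bound s8 by linarith
qed

end

section \<open>Periodic points\<close>

context comm_group
begin

lemma card_subgroup_periodic:
  assumes A: "subgroup A G" "finite A" and n: "n > 0"
  defines "per \<equiv> {x \<in> A. \<exists>k\<ge>1. x [^] (n ^ k) = x}"
    and "nil \<equiv> {x \<in> A. \<exists>k. x [^] (n ^ k) = \<one>}"
  shows "card per * card nil = card A" "pi_prod (int n) (int (card A)) = int (card nil)"
proof -
  interpret A: group "G\<lparr>carrier := A\<rparr>"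
    using A(1) by (rule subgroup.subgroup_is_group) (rule is_group)
  interpret A: comm_group "G\<lparr>carrier := A\<rparr>"
    by (rule A.group_comm_groupI) (use m_comm subgroup.mem_carrier[OF A(1)] in simp)
  have "A.periodic_part n = per" "A.nilpotent_part n = nil"
    by (simp_all add: A.periodic_part_def A.nilpotent_part_def per_def nil_def nat_pow_consistent[symmetric])
  then show "card per * card nil = card A" "pi_prod (int n) (int (card A)) = int (card nil)"
    using A.card_periodic_part[OF _ n] A(2) by simp_all
qed

end

context ec_finite
begin

text \<open>Every abscissa of the finite projective line is counted twice over the two groups
  together, and periodicity depends only on the abscissa.\<close>

lemma Per_eq:
  assumes "d \<noteq> 0" "m \<ge> 1"
  shows "2 * card (Per (lattes E0 d) (CARD('a) ^ m)) =
    card {P \<in> fix_pos m. \<exists>k\<ge>1. ptimes P (nat \<bar>d\<bar> ^ k) = P} +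
    card {P \<in> fix_neg m. \<exists>k\<ge>1. ptimes P (nat \<bar>d\<bar> ^ k) = P}"
proof -
  let ?S = "Per (lattes E0 d) (CARD('a) ^ m)"
  have sub: "?S \<subseteq> P1_over (GF (CARD('a) ^ m))" by (auto simp: Per_def)
  have iff: "x_coord P \<in> ?S \<longleftrightarrow> (\<exists>k\<ge>1. ptimes P (nat \<bar>d\<bar> ^ k) = P)"
    if P: "P \<in> fix_pos m \<union> fix_neg m" for P
  proof -
    have "on_curve E P" using P by (auto simp: fix_pos_def fix_neg_def)
    then show ?thesis
      using periodic_iff[OF assms(1)] x_coord_in_P1_over[OF P] unfolding Per_def by blast
  qed
  have "{P \<in> fix_pos m. x_coord P \<in> ?S} = {P \<in> fix_pos m. \<exists>k\<ge>1. ptimes P (nat \<bar>d\<bar> ^ k) = P}"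
    "{P \<in> fix_neg m. x_coord P \<in> ?S} = {P \<in> fix_neg m. \<exists>k\<ge>1. ptimes P (nat \<bar>d\<bar> ^ k) = P}"
    by (rule Collect_cong, use iff in blast)+
  then show ?thesis using fibre_count_set(1)[OF assms(2) sub] by simp
qed

definition nil_part :: "int \<Rightarrow> 'a alg_closure ec_point set \<Rightarrow> 'a alg_closure ec_point set" where
  "nil_part d A = {P \<in> A. \<exists>k. ptimes P (nat \<bar>d\<bar> ^ k) = Origin}"

lemma pi_prod_abs: "pi_prod d k = pi_prod (int (nat \<bar>d\<bar>)) k"
  by (simp add: pi_prod_def)

lemma pi_prod_card:
  assumes "d \<noteq> 0" "m \<ge> 1"
  shows "pi_prod d (int (card (fix_pos m))) = int (card (nil_part d (fix_pos m)))"
    "pi_prod d (int (card (fix_neg m))) = int (card (nil_part d (fix_neg m)))"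
  using ec.card_subgroup_periodic(2)[OF subgroup_fix_pos card_fix_pos_neg(2)[OF assms(2)], of "nat \<bar>d\<bar>"]
    ec.card_subgroup_periodic(2)[OF subgroup_fix_neg card_fix_pos_neg(3)[OF assms(2)], of "nat \<bar>d\<bar>"] assms(1)
  by (simp_all add: pi_prod_abs[of d] nil_part_def)

lemma card_nil_part_pos:
  assumes "m \<ge> 1"
  shows "card (nil_part d (fix_pos m)) > 0" "card (nil_part d (fix_neg m)) > 0"
proof -
  have "ptimes Origin 1 = Origin" using ec.nat_pow_one[of 1] by simp
  then have "Origin \<in> nil_part d (fix_pos m)" "Origin \<in> nil_part d (fix_neg m)"
    by (auto simp: nil_part_def fix_pos_def fix_neg_def intro!: exI[of _ 0])
  moreover have "finite (nil_part d (fix_pos m))" "finite (nil_part d (fix_neg m))"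
    using card_fix_pos_neg(2,3)[OF assms] by (simp_all add: nil_part_def)
  ultimately show "card (nil_part d (fix_pos m)) > 0" "card (nil_part d (fix_neg m)) > 0"
    by (auto simp: card_gt_0_iff)
qed

lemma per_density_eq:
  assumes "d \<noteq> 0" "m \<ge> 1"
  shows "per_density (lattes E0 d) (CARD('a) ^ m) = 1 / 2 *
    (real (card (fix_pos m)) / real (CARD('a) ^ m + 1) / real (card (nil_part d (fix_pos m))) +
     real (card (fix_neg m)) / real (CARD('a) ^ m + 1) / real (card (nil_part d (fix_neg m))))"
proof -
  have n: "nat \<bar>d\<bar> > 0" using assms by simp
  let ?p = "{P \<in> fix_pos m. \<exists>k\<ge>1. ptimes P (nat \<bar>d\<bar> ^ k) = P}"
    and ?n = "{P \<in> fix_neg m. \<exists>k\<ge>1. ptimes P (nat \<bar>d\<bar> ^ k) = P}"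
  have "card ?p * card (nil_part d (fix_pos m)) = card (fix_pos m)"
    "card ?n * card (nil_part d (fix_neg m)) = card (fix_neg m)"
    using ec.card_subgroup_periodic(1)[OF subgroup_fix_pos card_fix_pos_neg(2)[OF assms(2)] n]
      ec.card_subgroup_periodic(1)[OF subgroup_fix_neg card_fix_pos_neg(3)[OF assms(2)] n]
    by (simp_all add: nil_part_def)
  then have p: "real (card ?p) = real (card (fix_pos m)) / real (card (nil_part d (fix_pos m)))"
    and n: "real (card ?n) = real (card (fix_neg m)) / real (card (nil_part d (fix_neg m)))"
    using card_nil_part_pos[OF assms(2), of d]
    by (simp_all add: field_simps flip: of_nat_mult)
  have "2 * real (card (Per (lattes E0 d) (CARD('a) ^ m))) = real (card ?p) + real (card ?n)"
    using arg_cong[OF Per_eq[OF assms], of real] by simp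
  then have "real (card (Per (lattes E0 d) (CARD('a) ^ m))) = 1 / 2 *
      (real (card (fix_pos m)) / real (card (nil_part d (fix_pos m))) +
       real (card (fix_neg m)) / real (card (nil_part d (fix_neg m))))"
    unfolding p n by simp
  then show ?thesis
    unfolding per_density_def card_P1_over_GF(1)[OF assms(2), where ?'a = 'a]
    by (simp only: add_divide_distrib distrib_left divide_divide_eq_left times_divide_eq_right mult_ac)
qed

section \<open>The d-primary part along the progression\<close>

lemma card_torsion_lt_cube:
  assumes "l \<ge> 2"
  shows "finite {P \<in> carrier ec_group. ptimes P l = \<one>\<^bsub>ec_group\<^esub>} \<and>
    card {P \<in> carrier ec_group. ptimes P l = \<one>\<^bsub>ec_group\<^esub>} < l ^ 3"
proof -
  have "2 * l ^ 2 - 1 < l ^ 3"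
  proof -
    have "2 * l ^ 2 \<le> l ^ 3" using assms by (simp add: power2_eq_square power3_eq_cube)
    moreover have "l ^ 2 > 0" using assms by simp
    ultimately show ?thesis by linarith
  qed
  then show ?thesis using card_torsion_le[of l] assms by auto
qed

lemma lcm_const_dvd:
  assumes "Factorial_Ring.prime l" "l dvd nat \<bar>d\<bar>"
  shows "l ^ 2 - 1 dvd nat (lcm_const d)"
proof -
  have l: "l \<ge> 1" using assms(1) prime_ge_1_nat by blast
  have "int l dvd d" using assms(2) by simp
  then have "int l ^ 2 - 1 dvd lcm_const d"
    unfolding lcm_const_def using assms(1) by (intro dvd_Lcm) auto
  moreover have "int l ^ 2 - 1 = int (l ^ 2 - 1)" using l by (simp add: of_nat_diff)
  moreover have "lcm_const d \<ge> 0" unfolding lcm_const_def by simp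
  ultimately show ?thesis by (simp add: nat_dvd_iff int_dvd_int_iff[symmetric] del: of_nat_diff)
qed

text \<open>The exponents differ by a multiple of c |d|^(e+1), and that power of Frobenius fixes
  every point killed by d^e.\<close>

lemma frob_point_congruent:
  assumes "d \<noteq> 0" "on_curve E P" "ptimes P (nat \<bar>d\<bar> ^ e) = Origin"
    and cong: "[int m = int n] (mod lcm_const d * d ^ N)" and N: "N \<ge> e + 1"
  shows "frob_point m P = frob_point n P"
proof -
  let ?C = "nat (lcm_const d)" and ?d = "nat \<bar>d\<bar>"
  have d: "?d > 0" using assms by simp
  have P: "(frob_point 1 ^^ (?C * ?d ^ (e + 1))) P = P"
  proof (rule frob.endo_tors_power[OF d])
    show "l ^ 2 - 1 dvd ?C" if "Factorial_Ring.prime l" "l dvd ?d" for l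
      using lcm_const_dvd that by blast
    show "finite {P \<in> carrier ec_group. ptimes P l = \<one>\<^bsub>ec_group\<^esub>} \<and>
      card {P \<in> carrier ec_group. ptimes P l = \<one>\<^bsub>ec_group\<^esub>} < l ^ 3"
      if "Factorial_Ring.prime l" "l dvd ?d" for l
      using card_torsion_lt_cube prime_ge_2_nat[OF that(1)] by blast
    show "P \<in> {P \<in> carrier ec_group. ptimes P (?d ^ e) = \<one>\<^bsub>ec_group\<^esub>}" using assms by simp
  qed
  have main: "frob_point (b + k) P = frob_point b P" if "int (?C * ?d ^ (e + 1)) dvd int k" for b k
  proof -
    have "?C * ?d ^ (e + 1) dvd k" using that by (simp only: int_dvd_int_iff)
    then have "(frob_point 1 ^^ k) P = P" using funpow_eq_self_dvd[OF P] by blast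
    then have "frob_point k P = P" using frob_point_funpow[of 1 k] by simp
    then show ?thesis by (simp add: frob_point_add_exp)
  qed
  have C: "int ?C = lcm_const d" unfolding lcm_const_def by simp
  have "int (?C * ?d ^ (e + 1)) dvd lcm_const d * d ^ N"
  proof -
    have "int ?d ^ (e + 1) dvd d ^ N"
      using N by (intro dvd_trans[OF le_imp_power_dvd[OF N]]) (simp add: dvd_power_same)
    then show ?thesis by (simp only: of_nat_mult of_nat_power C mult_dvd_mono dvd_refl)
  qed
  then have dvd: "int (?C * ?d ^ (e + 1)) dvd int m - int n"
    using cong unfolding cong_iff_dvd_diff by (rule dvd_trans)
  show ?thesis
  proof (cases "n \<le> m")
    case True
    then have "int (?C * ?d ^ (e + 1)) dvd int (m - n)" using dvd by (simp add: of_nat_diff)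
    from main[OF this, of n] True show ?thesis by simp
  next
    case False
    have "int (?C * ?d ^ (e + 1)) dvd int n - int m" using dvd by (simp add: dvd_diff_commute)
    then have "int (?C * ?d ^ (e + 1)) dvd int (n - m)" using False by (simp add: of_nat_diff)
    from main[OF this, of m] False show ?thesis by simp
  qed
qed

lemma nil_part_bounded:
  assumes "finite A"
  obtains e where "\<And>P. P \<in> A \<Longrightarrow> on_curve E P \<Longrightarrow> (\<exists>k. ptimes P (nat \<bar>d\<bar> ^ k) = Origin) \<Longrightarrow>
    ptimes P (nat \<bar>d\<bar> ^ e) = Origin"
proof -
  define h where "h P = (LEAST k. ptimes P (nat \<bar>d\<bar> ^ k) = Origin)" for P
  define e where "e = Max (insert 0 (h ` A))"
  have "ptimes P (nat \<bar>d\<bar> ^ e) = Origin"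
    if P: "P \<in> A" "on_curve E P" "\<exists>k. ptimes P (nat \<bar>d\<bar> ^ k) = Origin" for P
  proof -
    have h: "ptimes P (nat \<bar>d\<bar> ^ h P) = Origin" unfolding h_def using P(3) by (rule LeastI_ex)
    have "h P \<le> e" unfolding e_def using assms P(1) by (intro Max_ge) auto
    then have "ptimes P (nat \<bar>d\<bar> ^ e) = ptimes (ptimes P (nat \<bar>d\<bar> ^ h P)) (nat \<bar>d\<bar> ^ (e - h P))"
      using P(2) ec.nat_pow_pow[of P "nat \<bar>d\<bar> ^ h P" "nat \<bar>d\<bar> ^ (e - h P)"]
      by (simp flip: power_add)
    then show ?thesis using h ec.nat_pow_one by simp
  qed
  then show thesis by (rule that)
qed

text \<open>At n the exponent e suffices by assumption; at m it has to be proved. The two sets share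
  their points killed by d^(e+1), one level above e, whence N >= e + 2. This rules out points of
  higher level at m by descent.\<close>

lemma nil_part_subset:
  assumes d: "d \<noteq> 0"
    and A: "A = fix_pos \<or> A = fix_neg"
    and e: "\<And>P. P \<in> A n \<Longrightarrow> on_curve E P \<Longrightarrow> (\<exists>k. ptimes P (nat \<bar>d\<bar> ^ k) = Origin) \<Longrightarrow>
      ptimes P (nat \<bar>d\<bar> ^ e) = Origin"
    and cong: "[int m = int n] (mod lcm_const d * d ^ N)" and N: "N \<ge> e + 2"
  shows "nil_part d (A m) = nil_part d (A n)"
proof -
  let ?d = "nat \<bar>d\<bar>"
  \<comment> \<open>Both groups are cut out by an equation of this form, with \<sigma> the identity
    or the negation, so one argument serves both.\<close>
  have A_def: "\<exists>\<sigma>. \<forall>m P. P \<in> A m \<longleftrightarrow> on_curve E P \<and> frob_point m P = \<sigma> P"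
    using A by (elim disjE) (auto simp: fix_pos_def fix_neg_def)
  then obtain \<sigma> where \<sigma>: "\<And>m P. P \<in> A m \<longleftrightarrow> on_curve E P \<and> frob_point m P = \<sigma> P" by blast
  have subA: "subgroup (A m) ec_group" using A subgroup_fix_pos subgroup_fix_neg by blast
  have same: "P \<in> A m \<longleftrightarrow> P \<in> A n" if "on_curve E P" "ptimes P (?d ^ Suc e) = Origin" for P
    unfolding \<sigma> using frob_point_congruent[OF d that cong] N by simp
  have comp: "ptimes P (?d ^ (a + b)) = ptimes (ptimes P (?d ^ a)) (?d ^ b)" if "on_curve E P" for P a b
    using that ec.nat_pow_pow[of P "?d ^ a" "?d ^ b"] by (simp add: power_add)
  have step: "ptimes P (?d ^ Suc e) = Origin" if "on_curve E P" "ptimes P (?d ^ e) = Origin" for P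
    unfolding Suc_eq_plus1 comp[OF that(1)] that(2) using ec.nat_pow_one by simp
  have bound: "ptimes P (?d ^ e) = Origin" if P: "P \<in> A m" "ptimes P (?d ^ k) = Origin" for P k
    using P(2)
  proof (induction k)
    case 0
    have "on_curve E P" using P \<sigma> by blast
    then show ?case using 0 comp[of P 0 e] ec.nat_pow_one by simp
  next
    case (Suc k)
    have on: "on_curve E P" using P \<sigma> by blast
    show ?case
    proof (cases "k < e")
      case True
      then have "e = Suc k + (e - Suc k)" by simp
      then have "ptimes P (?d ^ e) = ptimes (ptimes P (?d ^ Suc k)) (?d ^ (e - Suc k))"
        using comp[OF on] by metis
      then show ?thesis using Suc.prems ec.nat_pow_one by simp
    next
      case False
      \<comment> \<open>This multiple of \<open>P\<close> is killed by d^(e+1), so it also belongs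
        to \<open>A n\<close>, where d^e already kills it. Hence d^k kills \<open>P\<close>, and the
        exponent has dropped by one.\<close>
      define Q where "Q = ptimes P (?d ^ (k - e))"
      have Q: "on_curve E Q" unfolding Q_def using on by (rule on_curve_ptimes)
      have "ptimes Q (?d ^ Suc e) = ptimes P (?d ^ (k - e + Suc e))"
        unfolding Q_def using comp[OF on] by metis
      also have "k - e + Suc e = Suc k" using False by simp
      finally have Q0: "ptimes Q (?d ^ Suc e) = Origin" using Suc.prems by simp
      have pow: "ptimes P j \<in> A m" for j
      proof (induction j)
        case (Suc j)
        then show ?case using subgroup.m_closed[OF subA Suc P(1)] by simp
      qed (use subgroup.one_closed[OF subA] in simp)
      have "Q \<in> A n" using same[OF Q Q0] pow unfolding Q_def by blast
      then have "ptimes Q (?d ^ e) = Origin" using e[of Q] Q Q0 by blast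
      then have "ptimes P (?d ^ (k - e + e)) = Origin" unfolding Q_def using comp[OF on] by metis
      then have "ptimes P (?d ^ k) = Origin" using False by simp
      then show ?thesis by (rule Suc.IH)
    qed
  qed
  show ?thesis
  proof (intro equalityI subsetI)
    fix P assume "P \<in> nil_part d (A m)"
    then have P: "P \<in> A m" "\<exists>k. ptimes P (?d ^ k) = Origin" by (auto simp: nil_part_def)
    then have "P \<in> A n" using same[of P] step bound \<sigma> by blast
    with P show "P \<in> nil_part d (A n)" by (simp add: nil_part_def)
  next
    fix P assume "P \<in> nil_part d (A n)"
    then have P: "P \<in> A n" "\<exists>k. ptimes P (?d ^ k) = Origin" by (auto simp: nil_part_def)
    then have "P \<in> A m" using same[of P] step e \<sigma> by blast
    with P show "P \<in> nil_part d (A m)" by (simp add: nil_part_def)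
  qed
qed

text \<open>The exponents of the finite sets at n for both signs determine the level. Allowing all
  larger \<open>N\<close> lets finitely many levels be replaced by their maximum.\<close>

lemma ex_congruence_level:
  assumes d: "d \<noteq> 0" and n: "n \<ge> 1"
  shows "\<exists>N0. \<forall>N\<ge>N0. \<forall>m\<ge>1. [int m = int n] (mod lcm_const d * d ^ N) \<longrightarrow>
    nil_part d (fix_pos m) = nil_part d (fix_pos n) \<and> nil_part d (fix_neg m) = nil_part d (fix_neg n)"
proof -
  obtain e1 where e1: "\<And>P. P \<in> fix_pos n \<Longrightarrow> on_curve E P \<Longrightarrow>
      (\<exists>k. ptimes P (nat \<bar>d\<bar> ^ k) = Origin) \<Longrightarrow> ptimes P (nat \<bar>d\<bar> ^ e1) = Origin"
    using nil_part_bounded[OF card_fix_pos_neg(2)[OF n]] by metis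
  obtain e2 where e2: "\<And>P. P \<in> fix_neg n \<Longrightarrow> on_curve E P \<Longrightarrow>
      (\<exists>k. ptimes P (nat \<bar>d\<bar> ^ k) = Origin) \<Longrightarrow> ptimes P (nat \<bar>d\<bar> ^ e2) = Origin"
    using nil_part_bounded[OF card_fix_pos_neg(3)[OF n]] by metis
  show ?thesis
  proof (intro exI[of _ "e1 + e2 + 2"] allI impI)
    fix N m assume N: "N \<ge> e1 + e2 + 2" and c: "[int m = int n] (mod lcm_const d * d ^ N)"
    have "nil_part d (fix_pos m) = nil_part d (fix_pos n)"
      by (rule nil_part_subset[OF d _ e1 c]) (use N in auto)
    moreover have "nil_part d (fix_neg m) = nil_part d (fix_neg n)"
      by (rule nil_part_subset[OF d _ e2 c]) (use N in auto)
    ultimately show "nil_part d (fix_pos m) = nil_part d (fix_pos n) \<and>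
      nil_part d (fix_neg m) = nil_part d (fix_neg n)" ..
  qed
qed


section \<open>The limit\<close>

lemma card_fix_tendsto:
  "(\<lambda>m. real (card (fix_pos m)) / real (CARD('a) ^ m + 1)) \<longlonglongrightarrow> 1"
  "(\<lambda>m. real (card (fix_neg m)) / real (CARD('a) ^ m + 1)) \<longlonglongrightarrow> 1"
proof -
  define q where "q = real CARD('a)"
  have q2: "q \<ge> 2"
    using card_finite_field_ge_2[where ?'a = 'a] by (simp add: q_def)
  \<comment> \<open>This is 3 s / Q for the bound Q + 3 s with s = q^(m - m div 2).\<close>
  define err where "err m = 3 / q ^ (m div 2)" for m :: nat
  have err: "err \<longlonglongrightarrow> 0"
  proof -
    have "(\<lambda>k. 3 * (1 / q) ^ k) \<longlonglongrightarrow> 3 * 0"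
      using q2 by (intro tendsto_mult tendsto_const LIMSEQ_power_zero) simp
    moreover have "filterlim (\<lambda>m :: nat. m div 2) sequentially sequentially"
      unfolding filterlim_at_top
    proof
      fix k :: nat
      show "eventually (\<lambda>m. k \<le> m div 2) sequentially"
        using eventually_ge_at_top[of "2 * k"] by eventually_elim linarith
    qed
    ultimately have "(\<lambda>m. 3 * (1 / q) ^ (m div 2)) \<longlonglongrightarrow> 3 * 0"
      by (rule filterlim_compose)
    moreover have "err = (\<lambda>m. 3 * (1 / q) ^ (m div 2))"
      by (simp add: err_def fun_eq_iff divide_inverse power_inverse)
    ultimately show ?thesis by simp
  qed
  \<comment> \<open>The bound on \<open>c'\<close> and the sum of both counts give the lower bound Q
    + 2 - 3 s for \<open>c\<close>.\<close>
  have close: "\<bar>real c / real (CARD('a) ^ m + 1) - 1\<bar> \<le> err m"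
    if m: "m \<ge> 6" and c: "c + c' = 2 * (CARD('a) ^ m + 1)"
      "c \<le> CARD('a) ^ m + 3 * CARD('a) ^ (m - m div 2)"
      "c' \<le> CARD('a) ^ m + 3 * CARD('a) ^ (m - m div 2)" for m c c'
  proof -
    define Q s where "Q = q ^ m" and "s = q ^ (m - m div 2)"
    have r: "real c + real c' = 2 * (Q + 1)" "real c \<le> Q + 3 * s" "real c' \<le> Q + 3 * s"
    proof -
      show "real c + real c' = 2 * (Q + 1)"
        using arg_cong[OF c(1), of real] by (simp add: Q_def q_def)
      show "real c \<le> Q + 3 * s" "real c' \<le> Q + 3 * s"
        using c(2,3)[THEN of_nat_mono[where ?'a = real]] by (simp_all add: Q_def s_def q_def)
    qed
    have s1: "s \<ge> 1" and Q0: "Q > 0" using q2 by (simp_all add: s_def Q_def)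
    have abs: "\<bar>real c - (Q + 1)\<bar> \<le> 3 * s"
    proof (rule abs_leI)
      have "real c' = 2 * Q + 2 - real c" using r(1) by simp
      then show "- (real c - (Q + 1)) \<le> 3 * s" using r(3) s1 by simp
      show "real c - (Q + 1) \<le> 3 * s" using r(2) s1 by simp
    qed
    have "\<bar>real c / (Q + 1) - 1\<bar> = \<bar>real c - (Q + 1)\<bar> / (Q + 1)"
      using Q0 by (simp add: field_simps abs_divide)
    also have "\<dots> \<le> 3 * s / Q" using abs Q0 s1 by (intro frac_le) auto
    also have "\<dots> = err m"
    proof -
      have "Q = s * q ^ (m div 2)" unfolding Q_def s_def by (simp flip: power_add)
      then show ?thesis unfolding err_def using s1 by simp
    qed
    finally show ?thesis by (simp add: Q_def q_def add.commute)
  qed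
  have ev: "\<forall>\<^sub>F m in sequentially. norm (real (card (fix_pos m)) / real (CARD('a) ^ m + 1) - 1) \<le> err m"
    "\<forall>\<^sub>F m in sequentially. norm (real (card (fix_neg m)) / real (CARD('a) ^ m + 1) - 1) \<le> err m"
    using eventually_ge_at_top[of 6]
  proof (eventually_elim)
    case (elim m)
    have m: "1 \<le> m" using elim by simp
    note c = card_fix_pos_neg(1)[OF m] card_fix_le[OF elim]
    show "norm (real (card (fix_pos m)) / real (CARD('a) ^ m + 1) - 1) \<le> err m"
      unfolding real_norm_def by (rule close[OF elim c])
  next
    show "\<forall>\<^sub>F m in sequentially. norm (real (card (fix_neg m)) / real (CARD('a) ^ m + 1) - 1) \<le> err m"
      using eventually_ge_at_top[of 6]
    proof eventually_elim
      case (elim m)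
      have m: "1 \<le> m" using elim by simp
      have "card (fix_neg m) + card (fix_pos m) = 2 * (CARD('a) ^ m + 1)"
        using card_fix_pos_neg(1)[OF m] by simp
      from close[OF elim this card_fix_le(2,1)[OF elim]] show ?case unfolding real_norm_def .
    qed
  qed
  show "(\<lambda>m. real (card (fix_pos m)) / real (CARD('a) ^ m + 1)) \<longlonglongrightarrow> 1"
    by (rule LIM_zero_cancel, rule tendsto_0_le[OF err, of _ 1], rule eventually_mono[OF ev(1)])
      (simp add: order_trans[OF _ abs_ge_self])
  show "(\<lambda>m. real (card (fix_neg m)) / real (CARD('a) ^ m + 1)) \<longlonglongrightarrow> 1"
    by (rule LIM_zero_cancel, rule tendsto_0_le[OF err, of _ 1], rule eventually_mono[OF ev(2)])
      (simp add: order_trans[OF _ abs_ge_self])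
qed

lemma per_density_tendsto:
  assumes d: "d \<noteq> 0" and n: "n \<ge> 1"
  shows "\<exists>N0. \<forall>N\<ge>N0. ((\<lambda>m. per_density (lattes E0 d) (CARD('a) ^ m)) \<longlongrightarrow>
      1 / 2 * (1 / real_of_int (pi_prod d (int CARD('a) ^ n + 1 + frob_trace E0 n)) +
               1 / real_of_int (pi_prod d (int CARD('a) ^ n + 1 - frob_trace E0 n))))
    (inf sequentially (principal {m. m \<ge> 1 \<and> [int m = int n] (mod lcm_const d * d ^ N)}))"
proof -
  obtain N0 where N0: "\<And>N m. N \<ge> N0 \<Longrightarrow> m \<ge> 1 \<Longrightarrow> [int m = int n] (mod lcm_const d * d ^ N) \<Longrightarrow>
    nil_part d (fix_pos m) = nil_part d (fix_pos n) \<and> nil_part d (fix_neg m) = nil_part d (fix_neg n)"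
    using ex_congruence_level[OF assms] by metis
  define cp cn where "cp = real (card (nil_part d (fix_pos n)))"
    and "cn = real (card (nil_part d (fix_neg n)))"
  have pis: "real_of_int (pi_prod d (int CARD('a) ^ n + 1 + frob_trace E0 n)) = cn"
    "real_of_int (pi_prod d (int CARD('a) ^ n + 1 - frob_trace E0 n)) = cp"
    unfolding card_fix_frob_trace[OF n] pi_prod_card[OF d n] cp_def cn_def by simp_all
  have nz: "cp \<noteq> 0" "cn \<noteq> 0" using card_nil_part_pos[OF n, of d] by (simp_all add: cp_def cn_def)
  show ?thesis
  proof (intro exI[of _ N0] allI impI)
    fix N assume N: "N \<ge> N0"
    let ?F = "inf sequentially (principal {m. m \<ge> 1 \<and> [int m = int n] (mod lcm_const d * d ^ N)})"
    have "((\<lambda>m. 1 / 2 * (real (card (fix_pos m)) / real (CARD('a) ^ m + 1) / cp +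
        real (card (fix_neg m)) / real (CARD('a) ^ m + 1) / cn)) \<longlongrightarrow> 1 / 2 * (1 / cp + 1 / cn)) sequentially"
      using nz by (intro tendsto_intros card_fix_tendsto)
    then have lim: "((\<lambda>m. 1 / 2 * (real (card (fix_pos m)) / real (CARD('a) ^ m + 1) / cp +
        real (card (fix_neg m)) / real (CARD('a) ^ m + 1) / cn)) \<longlongrightarrow> 1 / 2 * (1 / cp + 1 / cn)) ?F"
      by (rule tendsto_mono[rotated]) simp
    have "\<forall>\<^sub>F m in ?F. 1 / 2 * (real (card (fix_pos m)) / real (CARD('a) ^ m + 1) / cp +
        real (card (fix_neg m)) / real (CARD('a) ^ m + 1) / cn) = per_density (lattes E0 d) (CARD('a) ^ m)"
      unfolding eventually_inf_principal
    proof (rule always_eventually, intro allI impI)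
      fix m assume "m \<in> {m. m \<ge> 1 \<and> [int m = int n] (mod lcm_const d * d ^ N)}"
      then have m: "m \<ge> 1" "[int m = int n] (mod lcm_const d * d ^ N)" by auto
      show "1 / 2 * (real (card (fix_pos m)) / real (CARD('a) ^ m + 1) / cp +
        real (card (fix_neg m)) / real (CARD('a) ^ m + 1) / cn) = per_density (lattes E0 d) (CARD('a) ^ m)"
        unfolding per_density_eq[OF d m(1)] cp_def cn_def using N0[OF N m] by simp
    qed
    from Lim_transform_eventually[OF lim this]
    show "((\<lambda>m. per_density (lattes E0 d) (CARD('a) ^ m)) \<longlongrightarrow>
      1 / 2 * (1 / real_of_int (pi_prod d (int CARD('a) ^ n + 1 + frob_trace E0 n)) +
               1 / real_of_int (pi_prod d (int CARD('a) ^ n + 1 - frob_trace E0 n)))) ?F"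
      unfolding pis by (simp add: add.commute)
  qed
qed

end

lemma finite_weierstrass: "finite (UNIV :: 'c :: finite weierstrass set)"
proof -
  have "(UNIV :: 'c weierstrass set) = range (\<lambda>(a, b, c, d, e). Weierstrass a b c d e)"
  proof (intro equalityI subsetI)
    fix E :: "'c weierstrass"
    show "E \<in> range (\<lambda>(a, b, c, d, e). Weierstrass a b c d e)"
      by (cases E) (auto intro: image_eqI[of _ _ "(_, _, _, _, _)"])
  qed simp
  then show ?thesis by (metis finite finite_imageI)
qed

text \<open>
  There are only finitely many curves over a finite field, so the level \<open>N\<close> can be chosen
  uniformly for all of them.
\<close>
theorem theorem1p3:
  shows "\<exists>N :: nat \<Rightarrow> int \<Rightarrow> int \<Rightarrow> nat \<Rightarrow> nat.
    \<forall>(E :: 'a :: finite_field weierstrass) (d :: int) (n :: nat).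
      elliptic_curve E \<longrightarrow> coprime d (int CARD('a)) \<longrightarrow> n \<ge> 1 \<longrightarrow>
      ((\<lambda>m. per_density (lattes E d) (CARD('a) ^ m)) \<longlongrightarrow>
         1 / 2 * (1 / real_of_int (pi_prod d (int CARD('a) ^ n + 1 + frob_trace E n)) +
                  1 / real_of_int (pi_prod d (int CARD('a) ^ n + 1 - frob_trace E n))))
      (inf sequentially (principal
         {m. m \<ge> 1 \<and>
             [int m = int n] (mod lcm_const d * d ^ N CARD('a) (frob_trace E 1) d n)}))"
proof -
  define lim where "lim E d n N \<longleftrightarrow> ((\<lambda>m. per_density (lattes E d) (CARD('a) ^ m)) \<longlongrightarrow>
         1 / 2 * (1 / real_of_int (pi_prod d (int CARD('a) ^ n + 1 + frob_trace E n)) +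
                  1 / real_of_int (pi_prod d (int CARD('a) ^ n + 1 - frob_trace E n))))
      (inf sequentially (principal {m. m \<ge> 1 \<and> [int m = int n] (mod lcm_const d * d ^ N)}))"
    for E :: "'a weierstrass" and d n N
  have "\<exists>N0. \<forall>N\<ge>N0. elliptic_curve E \<longrightarrow> coprime d (int CARD('a)) \<longrightarrow> n \<ge> 1 \<longrightarrow> lim E d n N"
    for E d n
  proof (cases "elliptic_curve E \<and> coprime d (int CARD('a)) \<and> n \<ge> 1")
    case True
    then interpret ec_finite E by unfold_locales simp
    \<comment> \<open>Zero is coprime only to units, and q is at least 2.\<close>
    have "d \<noteq> 0" using True card_finite_field_ge_2[where ?'a = 'a] by auto
    then show ?thesis using per_density_tendsto[of d n] True unfolding lim_def by blast
  qed blast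
  then obtain N0 where N0: "\<And>E d n N. N \<ge> N0 E d n \<Longrightarrow> elliptic_curve E \<Longrightarrow>
    coprime d (int CARD('a)) \<Longrightarrow> n \<ge> 1 \<Longrightarrow> lim E d n N" by metis
  define N where "N = (\<lambda>(q :: nat) (t :: int) d n. Max (range (\<lambda>E. N0 E d n)))"
  have "N0 E d n \<le> N q t d n" for E q t d n
    unfolding N_def by (intro Max_ge finite_imageI finite_weierstrass) auto
  then show ?thesis using N0 unfolding lim_def by blast
qed

end
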